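(* Let $\delta\in\mathbf{C}$ and let $\mathcal{G}$ be the Brauer category over $\mathbf{C}$ with parameter $\delta$. Let $\mathcal{U}$ (resp. $\mathcal{D}$) be the wide subcategory of $\mathcal{G}$ in which $\mathrm{Hom}_{\mathcal{U}}(S,T)$ (resp. $\mathrm{Hom}_{\mathcal{D}}(S,T)$) is the subspace of $\mathrm{Hom}_{\mathcal{G}}(S,T)$ spanned by the upwards (resp. downwards) Brauer diagrams. Then $\mathcal{G}$, equipped with $(\mathcal{U},\mathcal{D})$, is a triangular category.
   Context: Brauer category. For finite sets $S,T$, a Brauer diagram from $S$ to $T$ is a perfect matching on $S\amalg T$, i.e. a partition of $S\amalg T$ into two-element subsets, called edges. An edge is vertical if it has one vertex in $S$ and one in $T$; otherwise it is a horizontal edge in $S$ or a horizontal edge in $T$. Given Brauer diagrams $\alpha$ from $S$ to $T$ and $\beta$ from $T$ to $U$, let $\beta\cup\alpha$ be the (multi)graph on $S\amalg T\amalg U$ whose edge set is the disjoint union of those of $\alpha$ and $\beta$. Let $\beta\bullet\alpha$ be the Brauer diagram from $S$ to $U$ joining $x$ and $y$ when there is a path from $x$ to $y$ in $\beta\cup\alpha$, and let $c(\beta,\alpha)$ be the number of cycles in $\beta\cup\alpha$ (a double edge counts as a cycle). The Brauer category $\mathcal{G}$ with parameter $\delta$ has finite sets as objects, $\mathrm{Hom}_{\mathcal{G}}(S,T)$ is the $\mathbf{C}$-vector space with basis the Brauer diagrams from $S$ to $T$, and composition is bilinear with $\beta\circ\alpha=\delta^{c(\beta,\alpha)}\,(\beta\bullet\alpha)$.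 A Brauer diagram from $S$ to $T$ is upwards if it has no horizontal edges in $S$, and downwards if it has no horizontal edges in $T$. Triangular categories. Let $\mathbf{k}$ be an algebraically closed field (here $\mathbf{k}=\mathbf{C}$). A subcategory is wide if it contains all objects. Write $|\mathcal{G}|$ for the set of isomorphism classes of objects. Given a partial order $\le$ on $|\mathcal G|$, a wide subcategory is upwards (resp. downwards) if existence of a non-zero morphism $x\to y$ in it implies $x\le y$ (resp. $x\ge y$). A triangular category is a $\mathbf{k}$-linear category $\mathcal{G}$ together with a pair $(\mathcal{U},\mathcal{D})$ of wide subcategories such that: (T0) $\mathcal{G}$ is essentially small and all Hom spaces are finite dimensional; (T1) $\mathrm{End}_{\mathcal{U}}(x)=\mathrm{End}_{\mathcal{D}}(x)$ for all objects $x$, and this ring is semi-simple; (T2) there is a partial order $\le$ on $|\mathcal{G}|$ such that for every $x$ there are only finitely many $y\le x$, $\mathcal{U}$ is upwards, and $\mathcal{D}$ is downwards; (T3) for all $x,z\in\mathcal{G}$ the map $\bigoplus_{y\in|\mathcal{G}|}\mathrm{Hom}_{\mathcal{U}}(y,z)\otimes_{\mathrm{End}_{\mathcal{U}}(y)}\mathrm{Hom}_{\mathcal{D}}(x,y)\to\mathrm{Hom}_{\mathcal{G}}(x,z)$ induced by composition is an isomorphism. *)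

theory Defs
  imports
    "HOL-Algebra.Free_Abelian_Groups"
    "HOL-Algebra.AbelCoset"
    "HOL-Computational_Algebra.Fundamental_Theorem_Algebra"
    "HOL-Library.Disjoint_Sets"
    "HOL-Library.Infinite_Typeclass"
begin

section \<open>Semisimple rings and tensor products over noncommutative rings\<close>

definition left_ideal :: "'r set \<Rightarrow> ('r, 'x) ring_scheme \<Rightarrow> bool" where
  "left_ideal I R \<longleftrightarrow>
     additive_subgroup I R \<and> (\<forall>a\<in>carrier R. \<forall>x\<in>I. a \<otimes>\<^bsub>R\<^esub> x \<in> I)"

text \<open>The left regular module is semisimple: every submodule is a direct summand.\<close>

definition semisimple_ring :: "('r, 'x) ring_scheme \<Rightarrow> bool" where
  "semisimple_ring R \<longleftrightarrow> ring R \<and>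
     (\<forall>I. left_ideal I R \<longrightarrow>
        (\<exists>J. left_ideal J R \<and> I \<inter> J = {\<zero>\<^bsub>R\<^esub>} \<and> set_add R I J = carrier R))"

text \<open>
  \<open>M\<close> and \<open>N\<close> are additive subgroups of the ambient types, carrying a right action \<open>ra\<close> and a left
  action \<open>la\<close> of \<open>R\<close>. The tensor product over \<open>R\<close> is the free abelian group on \<open>M \<times> N\<close> modulo the
  biadditivity and balancing relations.
\<close>

definition tensor_relators ::
  "'r set \<Rightarrow> 'm::ab_group_add set \<Rightarrow> 'n::ab_group_add set \<Rightarrow> ('m \<Rightarrow> 'r \<Rightarrow> 'm) \<Rightarrow> ('r \<Rightarrow> 'n \<Rightarrow> 'n)
    \<Rightarrow> ('m \<times> 'n \<Rightarrow>\<^sub>0 int) set" where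
  "tensor_relators R M N ra la =
     {frag_of (m + m', n) - frag_of (m, n) - frag_of (m', n) | m m' n. m \<in> M \<and> m' \<in> M \<and> n \<in> N}
   \<union> {frag_of (m, n + n') - frag_of (m, n) - frag_of (m, n') | m n n'. m \<in> M \<and> n \<in> N \<and> n' \<in> N}
   \<union> {frag_of (ra m r, n) - frag_of (m, la r n) | m r n. m \<in> M \<and> r \<in> R \<and> n \<in> N}"

definition tensor_kernel ::
  "'r set \<Rightarrow> 'm::ab_group_add set \<Rightarrow> 'n::ab_group_add set \<Rightarrow> ('m \<Rightarrow> 'r \<Rightarrow> 'm) \<Rightarrow> ('r \<Rightarrow> 'n \<Rightarrow> 'n)
    \<Rightarrow> ('m \<times> 'n \<Rightarrow>\<^sub>0 int) set" where
  "tensor_kernel R M N ra la =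
     generate (free_Abelian_group (M \<times> N)) (tensor_relators R M N ra la)"

definition tensor_group ::
  "'r set \<Rightarrow> 'm::ab_group_add set \<Rightarrow> 'n::ab_group_add set \<Rightarrow> ('m \<Rightarrow> 'r \<Rightarrow> 'm) \<Rightarrow> ('r \<Rightarrow> 'n \<Rightarrow> 'n)
    \<Rightarrow> ('m \<times> 'n \<Rightarrow>\<^sub>0 int) set monoid" where
  "tensor_group R M N ra la = free_Abelian_group (M \<times> N) Mod tensor_kernel R M N ra la"

definition pure_tensor ::
  "'r set \<Rightarrow> 'm::ab_group_add set \<Rightarrow> 'n::ab_group_add set \<Rightarrow> ('m \<Rightarrow> 'r \<Rightarrow> 'm) \<Rightarrow> ('r \<Rightarrow> 'n \<Rightarrow> 'n)
    \<Rightarrow> 'm \<Rightarrow> 'n \<Rightarrow> ('m \<times> 'n \<Rightarrow>\<^sub>0 int) set" where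
  "pure_tensor R M N ra la m n =
     tensor_kernel R M N ra la #>\<^bsub>free_Abelian_group (M \<times> N)\<^esub> frag_of (m, n)"

definition sum_group_inclusion :: "'i set \<Rightarrow> ('i \<Rightarrow> ('b, 'x) monoid_scheme) \<Rightarrow> 'i \<Rightarrow> 'b \<Rightarrow> 'i \<Rightarrow> 'b" where
  "sum_group_inclusion I G i b = (\<lambda>j\<in>I. if j = i then b else \<one>\<^bsub>G j\<^esub>)"


section \<open>Linear categories\<close>

text \<open>
  The Hom spaces are subspaces of one ambient vector space, which loses no generality up to
  isomorphism. They may overlap, so composition carries its three objects:
  \<open>Comp x y z g f\<close> is the composite of \<open>f : x \<rightarrow> y\<close> and \<open>g : y \<rightarrow> z\<close>.
\<close>

locale linear_category = vector_space scale
  for scale :: "'k::field \<Rightarrow> 'm::ab_group_add \<Rightarrow> 'm" +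
  fixes Ob :: "'o set"
    and Hom :: "'o \<Rightarrow> 'o \<Rightarrow> 'm set"
    and ident :: "'o \<Rightarrow> 'm"
    and Comp :: "'o \<Rightarrow> 'o \<Rightarrow> 'o \<Rightarrow> 'm \<Rightarrow> 'm \<Rightarrow> 'm"
  assumes Hom_subspace: "\<lbrakk>x \<in> Ob; y \<in> Ob\<rbrakk> \<Longrightarrow> subspace (Hom x y)"
    and ident_in_Hom: "x \<in> Ob \<Longrightarrow> ident x \<in> Hom x x"
    and Comp_in_Hom:
      "\<lbrakk>x \<in> Ob; y \<in> Ob; z \<in> Ob; f \<in> Hom x y; g \<in> Hom y z\<rbrakk> \<Longrightarrow> Comp x y z g f \<in> Hom x z"
    and Comp_ident_left:
      "\<lbrakk>x \<in> Ob; y \<in> Ob; f \<in> Hom x y\<rbrakk> \<Longrightarrow> Comp x y y (ident y) f = f"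
    and Comp_ident_right:
      "\<lbrakk>x \<in> Ob; y \<in> Ob; f \<in> Hom x y\<rbrakk> \<Longrightarrow> Comp x x y f (ident x) = f"
    and Comp_assoc:
      "\<lbrakk>w \<in> Ob; x \<in> Ob; y \<in> Ob; z \<in> Ob; f \<in> Hom w x; g \<in> Hom x y; h \<in> Hom y z\<rbrakk>
       \<Longrightarrow> Comp w y z h (Comp w x y g f) = Comp w x z (Comp x y z h g) f"
    and Comp_add_left:
      "\<lbrakk>x \<in> Ob; y \<in> Ob; z \<in> Ob; f \<in> Hom x y; g \<in> Hom y z; g' \<in> Hom y z\<rbrakk>
       \<Longrightarrow> Comp x y z (g + g') f = Comp x y z g f + Comp x y z g' f"
    and Comp_add_right:
      "\<lbrakk>x \<in> Ob; y \<in> Ob; z \<in> Ob; f \<in> Hom x y; f' \<in> Hom x y; g \<in> Hom y z\<rbrakk>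
       \<Longrightarrow> Comp x y z g (f + f') = Comp x y z g f + Comp x y z g f'"
    and Comp_scale_left:
      "\<lbrakk>x \<in> Ob; y \<in> Ob; z \<in> Ob; f \<in> Hom x y; g \<in> Hom y z\<rbrakk>
       \<Longrightarrow> Comp x y z (scale a g) f = scale a (Comp x y z g f)"
    and Comp_scale_right:
      "\<lbrakk>x \<in> Ob; y \<in> Ob; z \<in> Ob; f \<in> Hom x y; g \<in> Hom y z\<rbrakk>
       \<Longrightarrow> Comp x y z g (scale a f) = scale a (Comp x y z g f)"
begin

definition isomorphic :: "'o \<Rightarrow> 'o \<Rightarrow> bool" where
  "isomorphic x y \<longleftrightarrow>
     (\<exists>f\<in>Hom x y. \<exists>g\<in>Hom y x. Comp x y x g f = ident x \<and> Comp y x y f g = ident y)"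

definition iso_class :: "'o \<Rightarrow> 'o set" where
  "iso_class x = {y \<in> Ob. isomorphic x y}"

definition iso_classes :: "'o set set" where
  "iso_classes = iso_class ` Ob"

text \<open>
  In HOL every category lives on a type, so \<open>small\<close> only has content relative to a type \<open>'s\<close> taken
  as the measure of smallness. The morphisms between two objects already form a set.
\<close>

definition essentially_small :: "'s itself \<Rightarrow> bool" where
  "essentially_small _ \<longleftrightarrow> (\<exists>f :: 'o set \<Rightarrow> 's. inj_on f iso_classes)"

definition finite_dimensional_Homs :: bool where
  "finite_dimensional_Homs \<longleftrightarrow>
     (\<forall>x\<in>Ob. \<forall>y\<in>Ob. \<exists>B. finite B \<and> B \<subseteq> Hom x y \<and> span B = Hom x y)"

text \<open>Subcategories of a linear category are understood to be linear.\<close>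

definition wide_subcategory :: "('o \<Rightarrow> 'o \<Rightarrow> 'm set) \<Rightarrow> bool" where
  "wide_subcategory H \<longleftrightarrow>
     (\<forall>x\<in>Ob. \<forall>y\<in>Ob. subspace (H x y) \<and> H x y \<subseteq> Hom x y) \<and>
     (\<forall>x\<in>Ob. ident x \<in> H x x) \<and>
     (\<forall>x\<in>Ob. \<forall>y\<in>Ob. \<forall>z\<in>Ob. \<forall>f\<in>H x y. \<forall>g\<in>H y z. Comp x y z g f \<in> H x z)"

definition upwards :: "('o set \<times> 'o set) set \<Rightarrow> ('o \<Rightarrow> 'o \<Rightarrow> 'm set) \<Rightarrow> bool" where
  "upwards ord H \<longleftrightarrow>
     (\<forall>x\<in>Ob. \<forall>y\<in>Ob. (\<exists>f\<in>H x y. f \<noteq> 0) \<longrightarrow> (iso_class x, iso_class y) \<in> ord)"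

definition downwards :: "('o set \<times> 'o set) set \<Rightarrow> ('o \<Rightarrow> 'o \<Rightarrow> 'm set) \<Rightarrow> bool" where
  "downwards ord H \<longleftrightarrow>
     (\<forall>x\<in>Ob. \<forall>y\<in>Ob. (\<exists>f\<in>H x y. f \<noteq> 0) \<longrightarrow> (iso_class y, iso_class x) \<in> ord)"

definition End_ring :: "('o \<Rightarrow> 'o \<Rightarrow> 'm set) \<Rightarrow> 'o \<Rightarrow> 'm ring" where
  "End_ring H x = \<lparr>carrier = H x x, monoid.mult = Comp x x x, one = ident x,
                   ring.zero = 0, ring.add = (+)\<rparr>"

definition Hom_group :: "'o \<Rightarrow> 'o \<Rightarrow> 'm monoid" where
  "Hom_group x y = \<lparr>carrier = Hom x y, monoid.mult = (+), one = 0\<rparr>"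

text \<open>\<open>Hom\<^sub>U(y, z)\<close> tensored over \<open>End\<^sub>U(y)\<close> with \<open>Hom\<^sub>D(x, y)\<close>; both actions are composition.\<close>

definition Hom_tensor ::
  "('o \<Rightarrow> 'o \<Rightarrow> 'm set) \<Rightarrow> ('o \<Rightarrow> 'o \<Rightarrow> 'm set) \<Rightarrow> 'o \<Rightarrow> 'o \<Rightarrow> 'o \<Rightarrow> ('m \<times> 'm \<Rightarrow>\<^sub>0 int) set monoid" where
  "Hom_tensor U D x y z = tensor_group (U y y) (U y z) (D x y) (Comp y y z) (Comp x y y)"

definition Hom_pure_tensor ::
  "('o \<Rightarrow> 'o \<Rightarrow> 'm set) \<Rightarrow> ('o \<Rightarrow> 'o \<Rightarrow> 'm set) \<Rightarrow> 'o \<Rightarrow> 'o \<Rightarrow> 'o \<Rightarrow> 'm \<Rightarrow> 'm \<Rightarrow> ('m \<times> 'm \<Rightarrow>\<^sub>0 int) set" where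
  "Hom_pure_tensor U D x y z = pure_tensor (U y y) (U y z) (D x y) (Comp y y z) (Comp x y y)"

text \<open>
  The map induced by composition is the unique homomorphism with the prescribed values on pure
  tensors; a bijective one is automatically linear for the scalar action on either tensor factor.
  The direct sum over isomorphism classes uses a representative \<open>rep c\<close> of each class \<open>c\<close>.
\<close>

definition composition_isomorphism ::
  "('o \<Rightarrow> 'o \<Rightarrow> 'm set) \<Rightarrow> ('o \<Rightarrow> 'o \<Rightarrow> 'm set) \<Rightarrow> ('o set \<Rightarrow> 'o) \<Rightarrow> 'o \<Rightarrow> 'o \<Rightarrow> bool" where
  "composition_isomorphism U D rep x z \<longleftrightarrow>
     (let T = (\<lambda>c. Hom_tensor U D x (rep c) z) in
      \<exists>\<phi> \<in> iso (sum_group iso_classes T) (Hom_group x z).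
        \<forall>c\<in>iso_classes. \<forall>u\<in>U (rep c) z. \<forall>d\<in>D x (rep c).
          \<phi> (sum_group_inclusion iso_classes T c (Hom_pure_tensor U D x (rep c) z u d))
            = Comp x (rep c) z u d)"

end


section \<open>Triangular categories\<close>

locale triangular_category = linear_category scale Ob Hom ident Comp
  for scale :: "'k::alg_closed_field \<Rightarrow> 'm::ab_group_add \<Rightarrow> 'm"
    and Ob :: "'o set"
    and Hom :: "'o \<Rightarrow> 'o \<Rightarrow> 'm set"
    and ident :: "'o \<Rightarrow> 'm"
    and Comp :: "'o \<Rightarrow> 'o \<Rightarrow> 'o \<Rightarrow> 'm \<Rightarrow> 'm \<Rightarrow> 'm" +
  fixes small :: "'s itself"
    and U :: "'o \<Rightarrow> 'o \<Rightarrow> 'm set"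
    and D :: "'o \<Rightarrow> 'o \<Rightarrow> 'm set"
  assumes wide_U: "wide_subcategory U"
    and wide_D: "wide_subcategory D"
    and T0_small: "essentially_small small"
    and T0_finite: "finite_dimensional_Homs"
    and T1_eq: "x \<in> Ob \<Longrightarrow> End_ring U x = End_ring D x"
    and T1_semisimple: "x \<in> Ob \<Longrightarrow> semisimple_ring (End_ring U x)"
    and T2: "\<exists>ord. partial_order_on iso_classes ord \<and>
               (\<forall>c\<in>iso_classes. finite {b \<in> iso_classes. (b, c) \<in> ord}) \<and>
               upwards ord U \<and> downwards ord D"
    and T3: "\<lbrakk>x \<in> Ob; z \<in> Ob; \<And>c. c \<in> iso_classes \<Longrightarrow> rep c \<in> c\<rbrakk>
             \<Longrightarrow> composition_isomorphism U D rep x z"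


section \<open>Brauer diagrams\<close>

text \<open>
  A diagram from \<open>S\<close> to \<open>T\<close> is a perfect matching on the disjoint union of \<open>S\<close> (tagged \<open>Inl\<close>) and
  \<open>T\<close> (tagged \<open>Inr\<close>).
\<close>

type_synonym 'a diagram = "('a + 'a) set set"

definition brauer_diagrams :: "'a set \<Rightarrow> 'a set \<Rightarrow> 'a diagram set" where
  "brauer_diagrams S T = {\<alpha>. partition_on (Inl ` S \<union> Inr ` T) \<alpha> \<and> (\<forall>e\<in>\<alpha>. card e = 2)}"

definition upwards_diagrams :: "'a set \<Rightarrow> 'a set \<Rightarrow> 'a diagram set" where
  "upwards_diagrams S T = {\<alpha> \<in> brauer_diagrams S T. \<not> (\<exists>e\<in>\<alpha>. e \<subseteq> Inl ` S)}"

definition downwards_diagrams :: "'a set \<Rightarrow> 'a set \<Rightarrow> 'a diagram set" where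
  "downwards_diagrams S T = {\<alpha> \<in> brauer_diagrams S T. \<not> (\<exists>e\<in>\<alpha>. e \<subseteq> Inr ` T)}"

definition id_diagram :: "'a set \<Rightarrow> 'a diagram" where
  "id_diagram S = {{Inl s, Inr s} | s. s \<in> S}"

text \<open>
  A multigraph is given by an edge set \<open>E\<close> together with the map \<open>ends\<close> sending an edge to its set
  of endpoints. Cycles are identified with their edge sets, so that neither the starting point nor
  the orientation matters; two distinct parallel edges form a cycle of length 2.
\<close>

definition connected_in :: "'e set \<Rightarrow> ('e \<Rightarrow> 'v set) \<Rightarrow> 'v \<Rightarrow> 'v \<Rightarrow> bool" where
  "connected_in E ends x y \<longleftrightarrow> (x, y) \<in> {(v, w). \<exists>e\<in>E. ends e = {v, w}}\<^sup>*"

definition cycles :: "'e set \<Rightarrow> ('e \<Rightarrow> 'v set) \<Rightarrow> 'e set set" where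
  "cycles E ends =
     {set es | es vs. es \<noteq> [] \<and> length vs = length es \<and> distinct vs \<and> distinct es \<and> set es \<subseteq> E \<and>
        (\<forall>i<length es. ends (es ! i) = {vs ! i, vs ! (Suc i mod length es)})}"

text \<open>
  The vertices of the graph obtained by stacking \<open>\<beta> : T \<rightarrow> U\<close> on \<open>\<alpha> : S \<rightarrow> T\<close> are tagged
  \<open>Inl s\<close>, \<open>Inr (Inl t)\<close> and \<open>Inr (Inr u)\<close>.
\<close>

definition stack_edges :: "'a diagram \<Rightarrow> 'a diagram \<Rightarrow> (('a + 'a) set + ('a + 'a) set) set" where
  "stack_edges \<beta> \<alpha> = Inl ` \<alpha> \<union> Inr ` \<beta>"

fun stack_ends :: "('a + 'a) set + ('a + 'a) set \<Rightarrow> ('a + 'a + 'a) set" where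
  "stack_ends (Inl e) = map_sum id Inl ` e"
| "stack_ends (Inr e) = Inr ` e"

definition diagram_comp :: "'a set \<Rightarrow> 'a set \<Rightarrow> 'a diagram \<Rightarrow> 'a diagram \<Rightarrow> 'a diagram" where
  "diagram_comp S U \<beta> \<alpha> =
     {{x, y} | x y. x \<in> Inl ` S \<union> Inr ` U \<and> y \<in> Inl ` S \<union> Inr ` U \<and> x \<noteq> y \<and>
        connected_in (stack_edges \<beta> \<alpha>) stack_ends (map_sum id Inr x) (map_sum id Inr y)}"

definition loop_count :: "'a diagram \<Rightarrow> 'a diagram \<Rightarrow> nat" where
  "loop_count \<beta> \<alpha> = card (cycles (stack_edges \<beta> \<alpha>) stack_ends)"


section \<open>The Brauer category\<close>

text \<open>
  Formal linear combinations of diagrams are finitely supported coefficient functions; the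
  diagram \<open>\<alpha>\<close> itself is the basis vector \<open>diagram_vec \<alpha>\<close>.
\<close>

type_synonym 'a brauer_vec = "'a diagram \<Rightarrow>\<^sub>0 complex"

definition vec_scale :: "complex \<Rightarrow> 'a brauer_vec \<Rightarrow> 'a brauer_vec" where
  "vec_scale c = Poly_Mapping.map ((*) c)"

definition diagram_vec :: "'a diagram \<Rightarrow> 'a brauer_vec" where
  "diagram_vec \<alpha> = Poly_Mapping.single \<alpha> 1"

definition brauer_objects :: "'a set set" where
  "brauer_objects = {S. finite S}"

definition brauer_Hom :: "'a set \<Rightarrow> 'a set \<Rightarrow> 'a brauer_vec set" where
  "brauer_Hom S T = {f. Poly_Mapping.keys f \<subseteq> brauer_diagrams S T}"

definition brauer_ident :: "'a set \<Rightarrow> 'a brauer_vec" where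
  "brauer_ident S = diagram_vec (id_diagram S)"

definition brauer_Comp ::
  "complex \<Rightarrow> 'a set \<Rightarrow> 'a set \<Rightarrow> 'a set \<Rightarrow> 'a brauer_vec \<Rightarrow> 'a brauer_vec \<Rightarrow> 'a brauer_vec" where
  "brauer_Comp \<delta> S T U g f =
     (\<Sum>\<beta>\<in>Poly_Mapping.keys g. \<Sum>\<alpha>\<in>Poly_Mapping.keys f.
        vec_scale (Poly_Mapping.lookup g \<beta> * Poly_Mapping.lookup f \<alpha> * \<delta> ^ loop_count \<beta> \<alpha>)
          (diagram_vec (diagram_comp S U \<beta> \<alpha>)))"

definition brauer_U :: "'a set \<Rightarrow> 'a set \<Rightarrow> 'a brauer_vec set" where
  "brauer_U S T = module.span vec_scale (diagram_vec ` upwards_diagrams S T)"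

definition brauer_D :: "'a set \<Rightarrow> 'a set \<Rightarrow> 'a brauer_vec set" where
  "brauer_D S T = module.span vec_scale (diagram_vec ` downwards_diagrams S T)"

end

theory Submission
  imports Defs "HOL-Combinatorics.Cycles"
begin

text \<open>
  Two matchings are a pair of involutions \<open>a\<close>, \<open>b\<close>, and the components of their union are the
  orbits of the dihedral group they generate. Such an orbit contains either exactly two fixed points,
  which makes the composite of two diagrams a diagram, or none, in which case it is a cycle; so loops
  are counted by connectivity classes without outer vertices. In this form both the composite and the
  loop count of three stacked diagrams are symmetric in the order of composition, which gives
  associativity.

  For the triangular structure, upwards endomorphisms are permutations (Maschke), and every diagram
  factors as an upwards diagram after a downwards one through a set of as many points as it has
  vertical edges, uniquely up to a permutation of these points.
\<close>

section \<open>Orbits of two involutions\<close>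

text \<open>The parameter \<open>\<delta>\<close> enters only through loops, and a loop consists of
  middle vertices alone. If the lower diagram is downwards or the upper one is upwards, every middle
  vertex is joined to an outer one. So no loop arises inside \<open>brauer_U\<close>, inside
  \<open>brauer_D\<close>, or in a composite of an upwards after a downwards diagram, and the
  argument for the triangular structure is uniform in \<open>\<delta>\<close>, zero included. The
  obstacle is associativity: the two bracketings stack different graphs, and a cycle of one may run
  through contracted edges of the other, so edge sets cannot be compared. Connectivity classes
  survive contraction, and both bracketings contract the same union of three matchings. In the
  tensor product the generators have integer coefficients only. Complex scalars live in the tensor
  factors and pass from one to the other by balancing with multiples of the identity.\<close>

locale two_involutions =
  fixes a b :: "'v \<Rightarrow> 'v" and V :: "'v set"
  assumes fin: "finite V"
    and aa [simp]: "a (a v) = v" and bb [simp]: "b (b v) = v"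
    and a_out: "v \<notin> V \<Longrightarrow> a v = v" and b_out: "v \<notin> V \<Longrightarrow> b v = v"
    and no_common: "v \<in> V \<Longrightarrow> a v = v \<Longrightarrow> b v \<noteq> v"
begin

text \<open>The rotation of the dihedral group: two steps along an alternating path.\<close>

definition rot :: "'v \<Rightarrow> 'v" where "rot = b \<circ> a"

definition linked :: "('v \<times> 'v) set" where
  "linked = ({(v, a v) | v. True} \<union> {(v, b v) | v. True})\<^sup>*"

lemma permutation_rot: "permutation rot"
proof -
  have "bij rot"
    unfolding rot_def by (intro bij_comp involuntory_imp_bij) auto
  moreover have "{v. rot v \<noteq> v} \<subseteq> V"
    using a_out b_out by (metis (mono_tags, lifting) comp_apply mem_Collect_eq rot_def subsetI)
  ultimately show ?thesis
    by (auto simp: permutation fin finite_subset)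
qed

lemma inj_rot_pow: "(rot ^^ n) x = (rot ^^ n) y \<longleftrightarrow> x = y"
  using bij_fn[of rot n] permutation_rot by (auto simp: permutation bij_def inj_eq)

text \<open>Conjugation by the reflection \<open>a\<close> inverts the rotation; this is the
  dihedral relation, written without negative powers.\<close>

lemma rot_pow_flip: "(rot ^^ n) (a ((rot ^^ n) x)) = a x"
proof (induction n)
  case (Suc n)
  have "rot (a (rot ((rot ^^ n) x))) = a ((rot ^^ n) x)"
    by (simp add: rot_def)
  then show ?case
    using Suc by (simp add: funpow_swap1)
qed simp

text \<open>The dihedral relation asks for the power \<open>-n\<close> of \<open>rot\<close>. As
  \<open>rot\<close> has a finite order \<open>m\<close>, the natural exponent
  \<open>n * (m - 1)\<close> serves for it.\<close>

lemma a_rot_pow: "\<exists>k. a ((rot ^^ n) x) = (rot ^^ k) (a x)"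
proof -
  obtain m where m: "rot ^^ m = id" "m > 0"
    using permutation_is_nilpotent[OF permutation_rot] by auto
  define w where "w = a ((rot ^^ n) x)"
  have "(rot ^^ (n * (m - 1))) (a x) = (rot ^^ (n * (m - 1) + n)) w"
    unfolding funpow_add w_def using rot_pow_flip[of n x] by simp
  also have "n * (m - 1) + n = m * n"
    using m(2) by (simp add: algebra_simps)
  also have "rot ^^ (m * n) = id"
    by (simp flip: funpow_mult add: m(1))
  finally show ?thesis
    unfolding w_def by (metis id_apply)
qed

lemma b_eq_rot_a: "b v = rot (a v)"
  by (simp add: rot_def)

lemma b_rot_pow: "\<exists>k. b ((rot ^^ n) x) = (rot ^^ k) (a x)"
proof -
  obtain k where "a ((rot ^^ n) x) = (rot ^^ k) (a x)"
    using a_rot_pow by blast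
  then have "b ((rot ^^ n) x) = (rot ^^ Suc k) (a x)"
    by (simp add: b_eq_rot_a)
  then show ?thesis by blast
qed

lemma linked_step: "(x, y) \<in> linked \<Longrightarrow> (x, a y) \<in> linked \<and> (x, b y) \<in> linked"
  unfolding linked_def by (auto intro: rtrancl_into_rtrancl)

lemma linked_rot_pow: "(x, (rot ^^ n) x) \<in> linked"
proof (induction n)
  case 0 then show ?case by (simp add: linked_def)
next
  case (Suc n) then show ?case
    using linked_step by (simp add: rot_def)
qed

lemma linked_rot_pow_a: "(x, (rot ^^ n) (a x)) \<in> linked"
  using linked_rot_pow[of "a x" n] linked_step[of x x]
  unfolding linked_def by (meson rtrancl.rtrancl_refl rtrancl_trans)

text \<open>A dihedral orbit is the union of two orbits of the rotation, because both reflections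
  exchange these two.\<close>

lemma linked_iff: "(x, y) \<in> linked \<longleftrightarrow> (\<exists>n. y = (rot ^^ n) x \<or> y = (rot ^^ n) (a x))"
proof
  assume "(x, y) \<in> linked"
  then show "\<exists>n. y = (rot ^^ n) x \<or> y = (rot ^^ n) (a x)"
    unfolding linked_def
  proof (induction rule: rtrancl_induct)
    case base
    have "x = (rot ^^ 0) x" by simp
    then show ?case by blast
  next
    case (step y z)
    then obtain n where "y = (rot ^^ n) x \<or> y = (rot ^^ n) (a x)" by blast
    moreover have "z = a y \<or> z = b y" using step by auto
    ultimately show ?case
      using a_rot_pow[of n x] a_rot_pow[of n "a x"] b_rot_pow[of n x] b_rot_pow[of n "a x"]
      by (metis aa)
  qed
next
  show "\<exists>n. y = (rot ^^ n) x \<or> y = (rot ^^ n) (a x) \<Longrightarrow> (x, y) \<in> linked"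
    using linked_rot_pow linked_rot_pow_a by auto
qed

text \<open>
  The orbit of a fixed point \<open>x\<close> of \<open>a\<close> is the \<open>rot\<close>-cycle of \<open>x\<close>, on which \<open>a\<close> acts as
  \<open>n \<mapsto> -n\<close> and \<open>b\<close> as \<open>n \<mapsto> 1 - n\<close>. Modulo the period \<open>m\<close> the only fixed point other than \<open>0\<close>
  is the solution of \<open>2n = 0\<close> or of \<open>2n = 1\<close>, depending on the parity of \<open>m\<close>.
\<close>

lemma other_fixed_point:
  assumes x: "x \<in> V" "a x = x"
  shows "\<exists>!y. y \<noteq> x \<and> (x, y) \<in> linked \<and> (a y = y \<or> b y = y)"
proof -
  define m where "m = least_power rot x"
  have period: "(rot ^^ n) x = x \<longleftrightarrow> m dvd n" for n
    using least_power_dvd[OF permutation_rot] by (simp add: m_def)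
  have per: "(rot ^^ (i + n)) x = (rot ^^ i) x \<longleftrightarrow> m dvd n" for i n
    by (simp add: funpow_add inj_rot_pow period)
  \<comment> \<open>Period one would make \<open>x\<close> a fixed point of \<open>b\<close> as well
    as of \<open>a\<close>.\<close>
  have "\<not> m dvd 1"
    using no_common[OF x] x period[of 1] by (simp add: rot_def)
  moreover have "m > 0"
    unfolding m_def using least_power_of_permutation[OF permutation_rot] by auto
  ultimately have m2: "m \<ge> 2"
    by (metis One_nat_def Suc_leI less_one nat_dvd_1_iff_1 nat_neq_iff numeral_2_eq_2 One_nat_def)
  have afix: "a ((rot ^^ n) x) = (rot ^^ n) x \<longleftrightarrow> m dvd 2 * n" for n
  proof -
    have "a ((rot ^^ n) x) = (rot ^^ n) x \<longleftrightarrow>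
        (rot ^^ n) (a ((rot ^^ n) x)) = (rot ^^ n) ((rot ^^ n) x)"
      by (simp add: inj_rot_pow)
    also have "\<dots> \<longleftrightarrow> x = (rot ^^ (2 * n)) x"
      by (simp add: rot_pow_flip x mult_2 funpow_add)
    finally show ?thesis using period by metis
  qed
  \<comment> \<open>At \<open>n = 0\<close> natural subtraction would turn \<open>2 * n - 1\<close>
    into \<open>0\<close> and make the right-hand side true, although \<open>b\<close> moves
    \<open>x\<close>.\<close>
  have bfix: "b ((rot ^^ n) x) = (rot ^^ n) x \<longleftrightarrow> m dvd 2 * n - 1" if "n \<ge> 1" for n
  proof -
    have "b ((rot ^^ n) x) = (rot ^^ n) x \<longleftrightarrow>
        (rot ^^ n) (rot (a ((rot ^^ n) x))) = (rot ^^ n) ((rot ^^ n) x)"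
      by (simp add: inj_rot_pow b_eq_rot_a)
    also have "(rot ^^ n) (rot (a ((rot ^^ n) x))) = rot x"
      by (simp add: rot_pow_flip x flip: funpow_swap1)
    also have "(rot ^^ n) ((rot ^^ n) x) = (rot ^^ (1 + (2 * n - 1))) x"
      using that by (simp add: mult_2 flip: funpow_add[THEN fun_cong, simplified])
    also have "rot x = (rot ^^ (1 + (2 * n - 1))) x \<longleftrightarrow> m dvd 2 * n - 1"
      using per[of 1 "2 * n - 1"] by auto
    finally show ?thesis .
  qed
  have orbit: "(x, y) \<in> linked \<longleftrightarrow> (\<exists>n. y = (rot ^^ n) x)" for y
    using linked_iff x by auto
  show ?thesis
  proof (rule ex_ex1I)
    show "\<exists>y. y \<noteq> x \<and> (x, y) \<in> linked \<and> (a y = y \<or> b y = y)"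
    \<comment> \<open>The witness is the far end of the path: the exponent \<open>m div 2\<close>
      solves \<open>2 * n = m\<close>, the exponent \<open>(m + 1) div 2\<close> solves
      \<open>2 * n - 1 = m\<close>.\<close>
    proof (cases "even m")
      case True
      have "\<not> m dvd m div 2"
        using m2 nat_dvd_not_less by auto
      moreover have "m dvd 2 * (m div 2)"
        using True by simp
      ultimately show ?thesis
        using period afix orbit by blast
    next
      case False
      have "m \<noteq> 2" using False by auto
      then have "\<not> m dvd (m + 1) div 2"
        using m2 by (intro nat_dvd_not_less) auto
      moreover have "2 * ((m + 1) div 2) - 1 = m"
        using False by simp
      ultimately show ?thesis
        using period[of "(m + 1) div 2"] bfix[of "(m + 1) div 2"] orbit m2
        by (intro exI[of _ "(rot ^^ ((m + 1) div 2)) x"]) auto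
    qed
  next
    fix y y'
    assume "y \<noteq> x \<and> (x, y) \<in> linked \<and> (a y = y \<or> b y = y)"
      and "y' \<noteq> x \<and> (x, y') \<in> linked \<and> (a y' = y' \<or> b y' = y')"
    then obtain n k where nk: "y = (rot ^^ n) x" "y' = (rot ^^ k) x" "\<not> m dvd n" "\<not> m dvd k"
        "m dvd 2 * n \<or> m dvd 2 * n - 1" "m dvd 2 * k \<or> m dvd 2 * k - 1"
      unfolding orbit using period afix bfix
      by (metis One_nat_def Suc_leI dvd_0_right gr0I)
    have *: "(rot ^^ n) x = (rot ^^ k) x"
      if nk: "n \<le> k" "\<not> m dvd n" "\<not> m dvd k"
        "m dvd 2 * n \<or> m dvd 2 * n - 1" "m dvd 2 * k \<or> m dvd 2 * k - 1" for n k
    proof -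
      have pos: "n > 0" "k > 0" using nk by (auto intro!: gr0I)
      have "m dvd k - n"
      proof (cases "even m")
        case True
        have "\<not> m dvd 2 * i - 1" if "i > 0" for i
        proof
          assume "m dvd 2 * i - 1"
          then have "even (2 * i - 1)" using True dvd_trans by blast
          with that show False by simp
        qed
        then have mm: "m dvd 2 * n" "m dvd 2 * k" using nk pos by auto
        \<comment> \<open>With \<open>m = 2 * q\<close> both exponents are odd multiples of
          \<open>q\<close>, so they differ by a multiple of \<open>2 * q\<close>.\<close>
        obtain q where q: "m = 2 * q" using True by auto
        then have "q dvd n" "q dvd k" using mm by auto
        then obtain i j where ij: "n = q * i" "k = q * j" by (auto elim!: dvdE)
        have "odd i" "odd j"
          using nk ij q by (auto simp: mult.commute)
        then have "2 dvd j - i" by auto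
        then have "q * 2 dvd q * (j - i)" by (rule mult_dvd_mono[OF dvd_refl])
        then show ?thesis by (simp add: q ij algebra_simps)
      next
        case False
        \<comment> \<open>For odd \<open>m\<close> only \<open>2 * n - 1\<close> and
          \<open>2 * k - 1\<close> can be the multiples of \<open>m\<close>. Then so is their
          difference \<open>2 * (k - n)\<close>, where the factor \<open>2\<close> cancels.\<close>
        then have co: "coprime m 2" by simp
        have "\<not> m dvd 2 * n" "\<not> m dvd 2 * k"
          using nk co by (auto simp: coprime_dvd_mult_right_iff)
        then have "m dvd (2 * k - 1) - (2 * n - 1)"
          using nk by (meson dvd_diff_nat)
        also have "(2 * k - 1) - (2 * n - 1) = 2 * (k - n)"
          using nk pos by auto
        finally show ?thesis using co by (auto simp: coprime_dvd_mult_right_iff)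
      qed
      then show ?thesis using per[of n "k - n"] nk by simp
    qed
    show "y = y'"
    proof (cases "n \<le> k")
      case True
      show ?thesis using *[OF True nk(3-6)] nk(1,2) by simp
    next
      case False
      then have "k \<le> n" by simp
      show ?thesis using *[OF \<open>k \<le> n\<close> nk(4,3,6,5)] nk(1,2) by simp
    qed
  qed
qed

end

lemma two_involutions_swap: "two_involutions a b V \<Longrightarrow> two_involutions b a V"
  unfolding two_involutions_def by blast

lemma linked_swap:
  assumes "two_involutions a b V"
  shows "two_involutions.linked b a = two_involutions.linked a b"
  unfolding two_involutions.linked_def[OF assms]
    two_involutions.linked_def[OF two_involutions_swap[OF assms]]
  by (simp add: Un_commute)

lemma (in two_involutions) other_fixed_point':
  assumes x: "x \<in> V" "a x = x \<or> b x = x"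
  shows "\<exists>!y. y \<noteq> x \<and> (x, y) \<in> linked \<and> (a y = y \<or> b y = y)"
proof (cases "a x = x")
  case False
  have ti: "two_involutions b a V"
    by (rule two_involutions_swap) (rule two_involutions_axioms)
  show ?thesis
    using two_involutions.other_fixed_point[OF ti x(1)] False x(2)
      linked_swap[OF two_involutions_axioms]
    by (simp add: disj_commute)
qed (use other_fixed_point x in blast)


section \<open>Perfect matchings, partners and connectivity\<close>

definition perfect_matching :: "'v set \<Rightarrow> 'v set set \<Rightarrow> bool" where
  "perfect_matching V M \<longleftrightarrow> partition_on V M \<and> (\<forall>e\<in>M. card e = 2)"

text \<open>The identity off the support, so that matchings with different supports give involutions
  of one type, and a vertex covered by only one of them is fixed by the other.\<close>

definition partner :: "'v set set \<Rightarrow> 'v \<Rightarrow> 'v" where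
  "partner M v = (if v \<in> \<Union>M then THE w. {v, w} \<in> M else v)"

definition joined :: "'v set set \<Rightarrow> ('v \<times> 'v) set" where
  "joined M = {(x, y). {x, y} \<in> M}\<^sup>*"

text \<open>With \<open>I\<close> the vertices covered by both of two matchings, these are the
  components without end vertices, that is, the loops.\<close>

definition closed_classes :: "'v set set \<Rightarrow> 'v set \<Rightarrow> 'v set set" where
  "closed_classes M I = {joined M `` {v} | v. v \<in> I \<and> joined M `` {v} \<subseteq> I}"

text \<open>In the union of two matchings these are the vertices of degree one, the ends of the
  paths.\<close>

definition sym_diff_supports :: "'v set set \<Rightarrow> 'v set set \<Rightarrow> 'v set" where
  "sym_diff_supports A B = (\<Union>A - \<Union>B) \<union> (\<Union>B - \<Union>A)"

text \<open>Every path is shrunk to a single edge between its ends. This is the composite of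
  diagrams, stated for matchings on arbitrary overlapping vertex sets.\<close>

definition contract :: "'v set set \<Rightarrow> 'v set set \<Rightarrow> 'v set set" where
  "contract A B = {{x, y} | x y. x \<in> sym_diff_supports A B \<and> y \<in> sym_diff_supports A B \<and> x \<noteq> y \<and>
     (x, y) \<in> joined (A \<union> B)}"

lemma perfect_matching_Union: "perfect_matching V M \<Longrightarrow> \<Union>M = V"
  by (simp add: perfect_matching_def partition_on_def)

lemma perfect_matching_eqI:
  "perfect_matching V M \<Longrightarrow> e \<in> M \<Longrightarrow> e' \<in> M \<Longrightarrow> v \<in> e \<Longrightarrow> v \<in> e' \<Longrightarrow> e = e'"
  unfolding perfect_matching_def partition_on_def disjoint_def by blast

lemma perfect_matching_unique:
  assumes "perfect_matching V M" "{v, w} \<in> M" "{v, w'} \<in> M"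
  shows "w = w'"
  using perfect_matching_eqI[OF assms, of v] by (auto simp: doubleton_eq_iff)

lemma perfect_matching_neq: "perfect_matching V M \<Longrightarrow> {v, w} \<in> M \<Longrightarrow> v \<noteq> w"
  unfolding perfect_matching_def by force

lemma perfect_matching_edge_cases:
  assumes "perfect_matching V M" "e \<in> M"
  obtains v w where "e = {v, w}" "v \<noteq> w" "v \<in> V" "w \<in> V"
  using assms unfolding perfect_matching_def
  by (metis Union_iff card_2_iff insert_iff partition_onD1)

lemma perfect_matching_in:
  "perfect_matching V M \<Longrightarrow> {v, w} \<in> M \<Longrightarrow> v \<in> V" "perfect_matching V M \<Longrightarrow> {v, w} \<in> M \<Longrightarrow> w \<in> V"
  using perfect_matching_Union by fastforce+

lemma perfect_matching_ex:
  assumes M: "perfect_matching V M" and "v \<in> V"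
  obtains w where "{v, w} \<in> M"
proof -
  obtain e where e: "e \<in> M" "v \<in> e"
    using assms perfect_matching_Union by blast
  then obtain x y where "e = {x, y}"
    using perfect_matching_edge_cases[OF M] by metis
  then have "e = {v, y} \<or> e = {v, x}" using e by auto
  then show ?thesis using e that by auto
qed

lemma perfect_matchingI:
  assumes "\<And>v. v \<in> V \<Longrightarrow> \<exists>w. {v, w} \<in> M"
    and "\<And>e. e \<in> M \<Longrightarrow> \<exists>v w. e = {v, w} \<and> v \<noteq> w \<and> v \<in> V \<and> w \<in> V"
    and "\<And>v w w'. {v, w} \<in> M \<Longrightarrow> {v, w'} \<in> M \<Longrightarrow> w = w'"
  shows "perfect_matching V M"
proof -
  have "partition_on V M"
  proof (rule partition_onI)
    show "\<Union>M = V"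
    proof (intro equalityI subsetI)
      fix v assume "v \<in> \<Union>M" then show "v \<in> V" using assms(2) by fast
    next
      fix v assume "v \<in> V"
      then obtain w where "{v, w} \<in> M" using assms(1) by blast
      then show "v \<in> \<Union>M" by blast
    qed
    show "{} \<notin> M" using assms(2) by blast
    show "disjnt e e'" if e: "e \<in> M" "e' \<in> M" "e \<noteq> e'" for e e'
    proof (rule ccontr)
      assume "\<not> disjnt e e'"
      then obtain v where v: "v \<in> e" "v \<in> e'" by (auto simp: disjnt_iff)
      obtain w where "e = {v, w}" using assms(2)[OF e(1)] v by (metis insertE insert_commute singletonD)
      moreover obtain w' where "e' = {v, w'}"
        using assms(2)[OF e(2)] v by (metis insertE insert_commute singletonD)
      ultimately show False using assms(3) e by blast
    qed
  qed
  moreover have "card e = 2" if "e \<in> M" for e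
    using assms(2)[OF that] by (auto simp: card_2_iff)
  ultimately show ?thesis by (simp add: perfect_matching_def)
qed

text \<open>An edge of \<open>N\<close> starts at a vertex that \<open>M\<close> also matches, and
  in \<open>N\<close> this vertex has only one partner. Hence one inclusion suffices to identify a
  composite of diagrams.\<close>

lemma perfect_matching_subset_eq:
  assumes "perfect_matching V M" "perfect_matching V N" "M \<subseteq> N"
  shows "M = N"
proof
  show "N \<subseteq> M"
  proof
    fix e assume "e \<in> N"
    then obtain v w where e: "e = {v, w}" "v \<in> V"
      using perfect_matching_edge_cases[OF assms(2)] by metis
    then obtain w' where "{v, w'} \<in> M" using perfect_matching_ex[OF assms(1)] by blast
    then show "e \<in> M"
      using perfect_matching_unique[OF assms(2)] assms(3) e \<open>e \<in> N\<close> by blast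
  qed
qed fact

lemma partner_edge:
  assumes "perfect_matching V M" "v \<in> V"
  shows "{v, partner M v} \<in> M"
proof -
  obtain w where w: "{v, w} \<in> M" using perfect_matching_ex[OF assms] .
  then have "(THE w. {v, w} \<in> M) = w"
    using perfect_matching_unique[OF assms(1)] by blast
  then show ?thesis using assms w perfect_matching_Union by (auto simp: partner_def)
qed

lemma partner_eqI: "perfect_matching V M \<Longrightarrow> {v, w} \<in> M \<Longrightarrow> partner M v = w"
  by (meson partner_edge perfect_matching_in(1) perfect_matching_unique)

lemma partner_outside: "perfect_matching V M \<Longrightarrow> v \<notin> V \<Longrightarrow> partner M v = v"
  unfolding partner_def using perfect_matching_Union by auto

lemma partner_partner: "perfect_matching V M \<Longrightarrow> partner M (partner M v) = v"
  by (metis insert_commute partner_edge partner_eqI partner_outside)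

lemma partner_neq: "perfect_matching V M \<Longrightarrow> v \<in> V \<Longrightarrow> partner M v \<noteq> v"
  by (metis partner_edge perfect_matching_neq)

lemma joined_refl [simp]: "(x, x) \<in> joined M"
  by (simp add: joined_def)

lemma joined_edge: "{x, y} \<in> M \<Longrightarrow> (x, y) \<in> joined M"
  by (auto simp: joined_def)

lemma joined_trans: "(x, y) \<in> joined M \<Longrightarrow> (y, z) \<in> joined M \<Longrightarrow> (x, z) \<in> joined M"
  by (auto simp: joined_def)

lemma joined_sym: "(x, y) \<in> joined M \<Longrightarrow> (y, x) \<in> joined M"
proof -
  have "sym {(x, y). {x, y} \<in> M}"
    by (auto simp: sym_def insert_commute)
  then show "(x, y) \<in> joined M \<Longrightarrow> (y, x) \<in> joined M"
    unfolding joined_def by (rule symD[OF sym_rtrancl])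
qed

lemma joined_class_eq: "(x, y) \<in> joined M \<Longrightarrow> joined M `` {x} = joined M `` {y}"
  unfolding set_eq_iff Image_singleton_iff by (meson joined_sym joined_trans)

lemma joined_mono: "M \<subseteq> N \<Longrightarrow> joined M \<subseteq> joined N"
  unfolding joined_def by (intro rtrancl_mono) auto

lemma joined_induct [consumes 1, case_names base step]:
  assumes "(x, y) \<in> joined M" "R x" "\<And>y z. (x, y) \<in> joined M \<Longrightarrow> {y, z} \<in> M \<Longrightarrow> R y \<Longrightarrow> R z"
  shows "R y"
  using assms(1) unfolding joined_def
  by (induction rule: rtrancl_induct) (use assms(2,3) in \<open>auto simp: joined_def\<close>)

lemma contract_commute: "contract A B = contract B A"
proof -
  have "sym_diff_supports A B = sym_diff_supports B A"
    by (auto simp: sym_diff_supports_def)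
  then show ?thesis by (simp add: contract_def Un_commute)
qed

section \<open>The union of two perfect matchings\<close>

locale two_matchings =
  fixes P Q :: "'v set" and A B :: "'v set set"
  assumes finite_P: "finite P" and finite_Q: "finite Q"
    and A: "perfect_matching P A" and B: "perfect_matching Q B"
begin

sublocale two_involutions "partner A" "partner B" "P \<union> Q"
proof
  show "finite (P \<union> Q)" using finite_P finite_Q by simp
  show "partner A (partner A v) = v" "partner B (partner B v) = v" for v
    using partner_partner A B by metis+
  show "partner A v = v" "partner B v = v" if "v \<notin> P \<union> Q" for v
    using that partner_outside A B by auto
  show "partner B v \<noteq> v" if "v \<in> P \<union> Q" "partner A v = v" for v
    using that partner_neq[OF A] partner_neq[OF B] by auto
qed

lemma joined_eq_linked: "joined (A \<union> B) = linked"
  unfolding joined_def linked_def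
proof (rule sym, rule rtrancl_subset)
  show "{(x, y). {x, y} \<in> A \<union> B} \<subseteq> {(v, partner A v) |v. True} \<union> {(v, partner B v) |v. True}"
    using partner_eqI[OF A] partner_eqI[OF B] by auto
  have "(v, partner A v) \<in> {(x, y). {x, y} \<in> A \<union> B}\<^sup>*" for v
    using partner_edge[OF A, of v] partner_outside[OF A, of v]
    by (cases "v \<in> P") (auto intro!: r_into_rtrancl)
  moreover have "(v, partner B v) \<in> {(x, y). {x, y} \<in> A \<union> B}\<^sup>*" for v
    using partner_edge[OF B, of v] partner_outside[OF B, of v]
    by (cases "v \<in> Q") (auto intro!: r_into_rtrancl)
  ultimately show "{(v, partner A v) |v. True} \<union> {(v, partner B v) |v. True}
      \<subseteq> {(x, y). {x, y} \<in> A \<union> B}\<^sup>*"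
    by auto
qed

lemma joined_in: "(x, y) \<in> joined (A \<union> B) \<Longrightarrow> x \<in> P \<union> Q \<Longrightarrow> y \<in> P \<union> Q"
  by (induction rule: joined_induct)
    (auto dest: perfect_matching_in(2)[OF A] perfect_matching_in(2)[OF B])

lemma fixed_iff:
  "v \<in> P \<union> Q \<Longrightarrow> partner A v = v \<or> partner B v = v \<longleftrightarrow> v \<in> (P - Q) \<union> (Q - P)"
  using partner_neq[OF A] partner_neq[OF B] partner_outside[OF A] partner_outside[OF B] by blast

text \<open>A vertex covered by exactly one matching is a fixed point of the other partner map, so
  this is the count of fixed points on a dihedral orbit.\<close>

lemma ex1_joined:
  assumes "x \<in> (P - Q) \<union> (Q - P)"
  shows "\<exists>!y. y \<in> (P - Q) \<union> (Q - P) \<and> y \<noteq> x \<and> (x, y) \<in> joined (A \<union> B)"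
proof -
  have x: "x \<in> P \<union> Q" using assms by auto
  have eq: "y \<in> (P - Q) \<union> (Q - P) \<and> y \<noteq> x \<and> (x, y) \<in> joined (A \<union> B) \<longleftrightarrow>
      y \<noteq> x \<and> (x, y) \<in> linked \<and> (partner A y = y \<or> partner B y = y)" for y
    using joined_in[OF _ x] fixed_iff by (auto simp: joined_eq_linked)
  show ?thesis
    unfolding eq using x assms fixed_iff[OF x] by (intro other_fixed_point') auto
qed

lemma sym_diff_supports_eq: "sym_diff_supports A B = (P - Q) \<union> (Q - P)"
  by (simp add: sym_diff_supports_def perfect_matching_Union[OF A] perfect_matching_Union[OF B])

lemma contract_edge_iff:
  "{x, y} \<in> contract A B \<longleftrightarrow>
     x \<in> (P - Q) \<union> (Q - P) \<and> y \<in> (P - Q) \<union> (Q - P) \<and> x \<noteq> y \<and> (x, y) \<in> joined (A \<union> B)"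
  unfolding contract_def sym_diff_supports_eq by (auto simp: doubleton_eq_iff dest: joined_sym)

lemma perfect_matching_contract: "perfect_matching ((P - Q) \<union> (Q - P)) (contract A B)"
proof (rule perfect_matchingI)
  show "\<exists>w. {v, w} \<in> contract A B" if "v \<in> (P - Q) \<union> (Q - P)" for v
    using ex1_joined[OF that] that by (metis contract_edge_iff)
  show "w = w'" if "{v, w} \<in> contract A B" "{v, w'} \<in> contract A B" for v w w'
    using that ex1_joined[of v] unfolding contract_edge_iff by metis
qed (auto simp: contract_def sym_diff_supports_eq)

section \<open>Cycles of the multigraph of two matchings, where a common edge counts twice\<close>

context
  fixes EA EB E :: "'e set" and ends :: "'e \<Rightarrow> 'v set"
  assumes E: "E = EA \<union> EB" and disj: "EA \<inter> EB = {}"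
    and ends_A: "bij_betw ends EA A" and ends_B: "bij_betw ends EB B"
begin

lemma ends_EA: "e \<in> EA \<Longrightarrow> ends e \<in> A" and ends_EB: "e \<in> EB \<Longrightarrow> ends e \<in> B"
  using ends_A ends_B by (auto simp: bij_betw_def)

lemma edge_at:
  shows edge_at_A: "v \<in> P \<Longrightarrow> \<exists>e\<in>EA. ends e = {v, partner A v}"
    and edge_at_B: "v \<in> Q \<Longrightarrow> \<exists>e\<in>EB. ends e = {v, partner B v}"
  using partner_edge[OF A, of v] partner_edge[OF B, of v] ends_A ends_B
  by (auto simp: bij_betw_def)

lemma edge_unique:
  shows "e \<in> EA \<Longrightarrow> e' \<in> EA \<Longrightarrow> v \<in> ends e \<Longrightarrow> v \<in> ends e' \<Longrightarrow> e = e'"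
    and "e \<in> EB \<Longrightarrow> e' \<in> EB \<Longrightarrow> v \<in> ends e \<Longrightarrow> v \<in> ends e' \<Longrightarrow> e = e'"
  by (meson A B ends_A ends_B bij_betw_def inj_onD ends_EA ends_EB perfect_matching_eqI)+

text \<open>Each matching has one edge at most at a given vertex. Two edges there come from
  different matchings, and no third one is left.\<close>

lemma two_edges:
  assumes e: "e \<in> E" "e' \<in> E" "e \<noteq> e'" "v \<in> ends e" "v \<in> ends e'"
  shows "v \<in> P \<inter> Q" and "e'' \<in> E \<Longrightarrow> v \<in> ends e'' \<Longrightarrow> e'' = e \<or> e'' = e'"
proof -
  have *: "e \<in> EA \<and> e' \<in> EB \<or> e \<in> EB \<and> e' \<in> EA"
    using e edge_unique E by blast
  then show "v \<in> P \<inter> Q"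
    using e ends_EA ends_EB perfect_matching_Union[OF A] perfect_matching_Union[OF B] by blast
  show "e'' = e \<or> e'' = e'" if "e'' \<in> E" "v \<in> ends e''"
    using * that e edge_unique E by blast
qed

lemma ends_in: "e \<in> E \<Longrightarrow> ends e \<in> A \<union> B"
  using E ends_EA ends_EB by blast

text \<open>Two edges of the cycle meet at each of its vertices, and there are no others, so no edge
  leaves the cycle and its vertices form a whole component inside the common support. The third
  claim recovers the cycle from its vertices.\<close>

lemma cycle_vertices:
  assumes C: "C \<in> cycles E ends"
  shows "\<exists>v\<in>P \<inter> Q. \<Union>(ends ` C) = joined (A \<union> B) `` {v}"
    and "\<Union>(ends ` C) \<subseteq> P \<inter> Q"
    and "C = {e \<in> E. ends e \<inter> \<Union>(ends ` C) \<noteq> {}}"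
proof -
  obtain es vs where C_eq: "C = set es" and es: "es \<noteq> []" "length vs = length es" "distinct vs"
      "distinct es" "set es \<subseteq> E"
    and step: "\<And>i. i < length es \<Longrightarrow> ends (es ! i) = {vs ! i, vs ! (Suc i mod length es)}"
    using C unfolding cycles_def by auto
  define n where "n = length es"
  have card2: "card (ends e) = 2" if "e \<in> E" for e
    using ends_in[OF that] A B by (auto simp: perfect_matching_def)
  \<comment> \<open>A cycle of length one would be an edge with a single endpoint. From length two
    on, the two cycle edges at a vertex are different.\<close>
  have "n \<noteq> 1"
  proof
    assume "n = 1"
    then have "ends (es ! 0) = {vs ! 0}" "es ! 0 \<in> E"
      using step[of 0] es by (auto simp: n_def)
    then show False using card2[of "es ! 0"] by simp
  qed
  then have n: "n \<ge> 2" using es by (cases n) (auto simp: n_def)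
  let ?K = "\<Union>(ends ` C)"
  have K: "?K = set vs"
  proof (intro equalityI subsetI)
    fix v assume "v \<in> ?K"
    then obtain i where "i < n" "v \<in> ends (es ! i)"
      by (auto simp: C_eq in_set_conv_nth n_def)
    then show "v \<in> set vs"
      using step[of i] es n by (auto simp: n_def)
  next
    fix v assume "v \<in> set vs"
    then obtain i where "i < n" "v = vs ! i"
      using es by (auto simp: in_set_conv_nth n_def)
    then show "v \<in> ?K"
      using step[of i] by (auto simp: C_eq n_def intro!: bexI[of _ "es ! i"])
  qed
  have star: "v \<in> P \<inter> Q" "e \<in> E \<Longrightarrow> v \<in> ends e \<Longrightarrow> e \<in> C" if "v \<in> ?K" for v e
  proof -
    have "v \<in> set vs" using that unfolding K .
    then obtain i where i: "i < n" "v = vs ! i"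
      unfolding in_set_conv_nth using es(2) n_def by metis
    \<comment> \<open>The cyclic predecessor of \<open>i\<close>: the edges with indices
      \<open>i\<close> and \<open>j\<close> are the two cycle edges at
      \<open>vs ! i\<close>.\<close>
    define j where "j = (if i = 0 then n - 1 else i - 1)"
    have j: "j < n" "j \<noteq> i" "Suc j mod n = i"
      using i n by (auto simp: j_def)
    have "es ! i \<noteq> es ! j"
      using i j es by (auto simp: n_def distinct_conv_nth)
    moreover have "v \<in> ends (es ! i)" "v \<in> ends (es ! j)"
      using step[of i] step[of j] i j by (auto simp: n_def)
    moreover have "es ! i \<in> C" "es ! j \<in> C"
      using i j by (auto simp: C_eq n_def)
    ultimately show "v \<in> P \<inter> Q" "e \<in> E \<Longrightarrow> v \<in> ends e \<Longrightarrow> e \<in> C"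
      using two_edges[of "es ! i" "es ! j" v] es C_eq by blast+
  qed
  show sub: "?K \<subseteq> P \<inter> Q" using star by blast
  have CE: "C \<subseteq> E" using C_eq es by simp
  show "C = {e \<in> E. ends e \<inter> ?K \<noteq> {}}"
  proof (intro equalityI subsetI)
    fix e assume e: "e \<in> C"
    then have "ends e \<noteq> {}" using card2 CE by fastforce
    then show "e \<in> {e \<in> E. ends e \<inter> ?K \<noteq> {}}" using e CE by auto
  qed (use star in blast)
  have "vs ! 0 \<in> ?K" unfolding K using es n by (intro nth_mem) (simp add: n_def)
  have "?K = joined (A \<union> B) `` {vs ! 0}"
  proof (intro equalityI subsetI)
    fix v assume "v \<in> ?K"
    then have "v \<in> set vs" unfolding K .
    then obtain i where i: "i < n" "v = vs ! i"
      unfolding in_set_conv_nth using es(2) n_def by metis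
    have "i < n \<Longrightarrow> (vs ! 0, vs ! i) \<in> joined (A \<union> B)" for i
    proof (induction i)
      case (Suc i)
      have "es ! i \<in> E" using Suc(2) es(5) by (auto simp: n_def)
      then have "ends (es ! i) \<in> A \<union> B" by (rule ends_in)
      then have "{vs ! i, vs ! Suc i} \<in> A \<union> B" using step[of i] Suc by (auto simp: n_def)
      then show ?case using Suc joined_edge joined_trans by (metis Suc_lessD)
    qed simp
    then show "v \<in> joined (A \<union> B) `` {vs ! 0}" using i by auto
  next
    fix v assume "v \<in> joined (A \<union> B) `` {vs ! 0}"
    then have "(vs ! 0, v) \<in> joined (A \<union> B)" by simp
    then show "v \<in> ?K"
    proof (induction rule: joined_induct)
      case base show ?case by fact
    next
      case (step y z)
      from step(2) obtain e where "e \<in> E" "ends e = {y, z}"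
        using ends_A ends_B E unfolding bij_betw_def by (metis Un_iff imageE)
      then show ?case using star(2)[OF step(3)] by blast
    qed
  qed
  then show "\<exists>v\<in>P \<inter> Q. ?K = joined (A \<union> B) `` {v}"
    using \<open>vs ! 0 \<in> ?K\<close> sub by blast
qed

text \<open>The orbit of \<open>v\<close> has no fixed points. Then the rotation orbits of
  \<open>v\<close> and of its partner in \<open>A\<close> are disjoint, and alternating between them
  gives a walk that visits every vertex once before it closes.\<close>

lemma cycle_through:
  assumes v: "joined (A \<union> B) `` {v} \<subseteq> P \<inter> Q"
  shows "\<exists>C\<in>cycles E ends. v \<in> \<Union>(ends ` C)"
proof -
  let ?a = "partner A" and ?b = "partner B"
  define r where "r n = (rot ^^ n) v" for n
  have r_in: "r n \<in> P \<inter> Q" "?a (r n) \<in> P \<inter> Q" for n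
    using v linked_rot_pow[of v n] linked_step[of v "r n"] joined_eq_linked by (auto simp: r_def)
  have nofix: "?a (r n) \<noteq> r n" "?b (r n) \<noteq> r n" for n
    using r_in partner_neq[OF A] partner_neq[OF B] by auto
  have r_add: "(rot ^^ i) (r j) = r (i + j)" for i j
    by (simp add: r_def funpow_add)
  have b_a: "?b (?a (r n)) = r (Suc n)" for n
    by (simp add: r_def rot_def)
  have flip: "(rot ^^ n) (?a (r n)) = ?a v" for n
    using rot_pow_flip by (simp add: r_def)
  \<comment> \<open>If \<open>?a v = r n\<close>, there is a fixed point halfway: \<open>?a\<close>
    fixes \<open>r k\<close> for \<open>n = 2 * k\<close>, and \<open>?b\<close> fixes
    \<open>r (Suc k)\<close> for \<open>n = 2 * k + 1\<close>.\<close>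
  have a_v: "?a v \<noteq> r n" for n
  proof
    assume eq: "?a v = r n"
    show False
    proof (cases "even n")
      case True
      then obtain k where "n = k + k" by (metis evenE mult_2)
      then have "(rot ^^ k) (?a (r k)) = (rot ^^ k) (r k)"
        using eq flip r_add by metis
      then show False using nofix by (simp add: inj_rot_pow)
    next
      case False
      then obtain k where "n = 2 * k + 1" by (rule oddE)
      then have k: "n = k + Suc k" by simp
      have "(rot ^^ k) (rot (?a (r (Suc k)))) = (rot ^^ k) (r (Suc k))"
        using eq flip[of "Suc k"] r_add[of k "Suc k"] k by (simp add: funpow_swap1)
      then have "?b (r (Suc k)) = r (Suc k)" by (simp only: inj_rot_pow b_eq_rot_a)
      then show False using nofix by blast
    qed
  qed
  have a_r: "?a (r k) \<noteq> r i" for k i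
  proof
    assume "?a (r k) = r i"
    then have "?a v = r (k + i)" using flip[of k] r_add by metis
    then show False using a_v by blast
  qed
  define m where "m = least_power rot v"
  have m: "m > 0" "r m = v"
    using least_power_of_permutation[OF permutation_rot, of v] by (auto simp: m_def r_def)
  have r_inj: "r i = r k \<Longrightarrow> i < m \<Longrightarrow> k < m \<Longrightarrow> i = k" for i k
  proof -
    have *: "i = k" if "r i = r k" "i \<le> k" "k < m" for i k
    proof -
      have "(rot ^^ i) v = (rot ^^ i) (r (k - i))"
        using that r_add[of i "k - i"] by (simp add: r_def)
      then have "m dvd k - i"
        using least_power_dvd[OF permutation_rot, of v "k - i"]
        by (simp add: inj_rot_pow m_def r_def)
      then show "i = k" using that by (auto dest: dvd_imp_le)
    qed
    show "r i = r k \<Longrightarrow> i < m \<Longrightarrow> k < m \<Longrightarrow> i = k"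
      using *[of i k] *[of k i] by (cases "i \<le> k") auto
  qed
  \<comment> \<open>The closed walk \<open>v\<close>, \<open>?a v\<close>, \<open>rot v\<close>,
    \<open>?a (rot v)\<close>, and so on, of length \<open>2 * m\<close>. Steps from even positions
    use edges of \<open>A\<close>, steps from odd positions edges of \<open>B\<close>.\<close>
  define vx where "vx j = (if even j then r (j div 2) else ?a (r (j div 2)))" for j
  define eA where "eA x = inv_into EA ends {x, ?a x}" for x
  define eB where "eB x = inv_into EB ends {x, ?b x}" for x
  define ex where "ex j = (if even j then eA (vx j) else eB (vx j))" for j
  have eA: "eA x \<in> EA" "ends (eA x) = {x, ?a x}" if "x \<in> P" for x
    using edge_at_A[OF that] unfolding eA_def
    by (metis (mono_tags, lifting) f_inv_into_f imageI inv_into_into)+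
  have eB: "eB x \<in> EB" "ends (eB x) = {x, ?b x}" if "x \<in> Q" for x
    using edge_at_B[OF that] unfolding eB_def
    by (metis (mono_tags, lifting) f_inv_into_f imageI inv_into_into)+
  have vx_in: "vx j \<in> P \<inter> Q" for j using r_in by (auto simp: vx_def)
  have vx_wrap: "vx (Suc j mod (2 * m)) = vx (Suc j)" if "j < 2 * m" for j
  \<comment> \<open>The walk closes because \<open>m\<close> is the period of \<open>v\<close> under
    the rotation.\<close>
  proof (cases "Suc j = 2 * m")
    case True
    then show ?thesis using m by (simp add: vx_def r_def)
  qed (use that in simp)
  have ends_ex: "ends (ex j) = {vx j, vx (Suc j)}" for j
  proof (cases "even j")
    case True
    then show ?thesis using eA[of "vx j"] vx_in[of j] by (simp add: ex_def vx_def)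
  next
    case False
    then have "vx (Suc j) = ?b (vx j)" by (auto simp: vx_def b_a elim!: oddE)
    then show ?thesis using eB[of "vx j"] vx_in[of j] False by (simp add: ex_def)
  qed
  have ex_in: "even j \<Longrightarrow> ex j \<in> EA" "odd j \<Longrightarrow> ex j \<in> EB" for j
    using eA eB vx_in[of j] by (auto simp: ex_def)
  have vx_parity: "vx i \<noteq> vx j" if "even i" "odd j" for i j
    using a_r that by (metis vx_def)
  have vx_inj: "i = j" if ij: "vx i = vx j" "i < 2 * m" "j < 2 * m" for i j
  proof -
    have par: "even i = even j" using ij vx_parity[of i j] vx_parity[of j i] by metis
    then have "r (i div 2) = r (j div 2)"
      using ij unfolding vx_def by (metis aa)
    then have "i div 2 = j div 2" using ij by (intro r_inj) auto
    then show "i = j" using par by (metis bit_eq_rec)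
  qed
  \<comment> \<open>Edges of different parity lie in the disjoint sets \<open>EA\<close> and
    \<open>EB\<close> even if their endpoints agree. This covers the double edge, the case
    \<open>m = 1\<close>.\<close>
  have ex_inj: "i = j" if ij: "ex i = ex j" "i < 2 * m" "j < 2 * m" for i j
  proof -
    have par: "even i = even j" using ij ex_in[of i] ex_in[of j] disj by auto
    have "vx i \<in> {vx j, vx (Suc j)}" using ends_ex ij by (metis insertI1)
    moreover have "vx i \<noteq> vx (Suc j)"
      using vx_parity[of i "Suc j"] vx_parity[of "Suc j" i] par by fastforce
    ultimately show ?thesis using vx_inj ij by auto
  qed
  define es where "es = map ex [0..<2 * m]"
  define vs where "vs = map vx [0..<2 * m]"
  have "set es \<in> cycles E ends"
    unfolding cycles_def
  proof (intro CollectI exI conjI allI impI)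
    show "set es = set es" ..
    show "es \<noteq> []" "length vs = length es" using m by (auto simp: es_def vs_def)
    show "distinct vs" "distinct es"
      using vx_inj ex_inj by (auto simp: es_def vs_def distinct_map inj_on_def)
    show "set es \<subseteq> E" using ex_in E by (auto simp: es_def)
    fix i assume "i < length es"
    then show "ends (es ! i) = {vs ! i, vs ! (Suc i mod length es)}"
      using ends_ex vx_wrap by (simp add: es_def vs_def)
  qed
  moreover have "ex 0 \<in> set es" using m by (simp add: es_def)
  moreover have "v \<in> ends (ex 0)" using ends_ex[of 0] by (simp add: vx_def r_def)
  ultimately show ?thesis by blast
qed

text \<open>The vertex set identifies a cycle with a component. This replaces edge sets by
  connectivity classes, which are compatible with contraction.\<close>

lemma card_cycles: "card (cycles E ends) = card (closed_classes (A \<union> B) (P \<inter> Q))"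
proof (rule bij_betw_same_card)
  show "bij_betw (\<lambda>C. \<Union>(ends ` C)) (cycles E ends) (closed_classes (A \<union> B) (P \<inter> Q))"
    unfolding bij_betw_def
  proof
    show "inj_on (\<lambda>C. \<Union>(ends ` C)) (cycles E ends)"
    proof (rule inj_onI)
      fix C C'
      assume "C \<in> cycles E ends" "C' \<in> cycles E ends" "\<Union>(ends ` C) = \<Union>(ends ` C')"
      then show "C = C'" using cycle_vertices(3) by metis
    qed
    show "(\<lambda>C. \<Union>(ends ` C)) ` cycles E ends = closed_classes (A \<union> B) (P \<inter> Q)"
    proof (intro equalityI subsetI)
      fix K assume "K \<in> (\<lambda>C. \<Union>(ends ` C)) ` cycles E ends"
      then show "K \<in> closed_classes (A \<union> B) (P \<inter> Q)"
        using cycle_vertices(1,2) unfolding closed_classes_def by fastforce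
    next
      fix K assume "K \<in> closed_classes (A \<union> B) (P \<inter> Q)"
      then obtain v where v: "K = joined (A \<union> B) `` {v}" "K \<subseteq> P \<inter> Q"
        by (auto simp: closed_classes_def)
      then obtain C where C: "C \<in> cycles E ends" "v \<in> \<Union>(ends ` C)"
        using cycle_through by blast
      obtain w where "\<Union>(ends ` C) = joined (A \<union> B) `` {w}"
        using cycle_vertices(1)[OF C(1)] by blast
      then have "\<Union>(ends ` C) = K"
        using C(2) v(1) joined_class_eq by (metis Image_singleton_iff)
      then show "K \<in> (\<lambda>C. \<Union>(ends ` C)) ` cycles E ends" using C(1) by blast
    qed
  qed
qed

end

end

section \<open>Contraction of matchings\<close>

context two_matchings
begin

lemma joined_outside: "(x, y) \<in> joined (A \<union> B) \<Longrightarrow> x \<notin> P \<union> Q \<Longrightarrow> y = x"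
  by (induction rule: joined_induct)
    (auto dest: perfect_matching_in(1)[OF A] perfect_matching_in(1)[OF B])

lemma joined_contractI:
  assumes "(x, y) \<in> joined (A \<union> B)" "x \<notin> P \<inter> Q" "y \<notin> P \<inter> Q"
  shows "(x, y) \<in> joined (contract A B)"
proof (cases "x = y")
  case False
  then have "x \<in> P \<union> Q" "y \<in> P \<union> Q"
    using joined_outside joined_sym assms(1) by metis+
  then have "{x, y} \<in> contract A B"
    using False assms by (auto simp: contract_edge_iff)
  then show ?thesis by (rule joined_edge)
qed simp

text \<open>As \<open>C\<close> avoids the doubly covered vertices, a path can change between
  \<open>C\<close> and the two matchings only at ends of their paths. Each stretch inside
  \<open>A \<union> B\<close> between such changes is one contracted edge or trivial.\<close>

lemma joined_contract_iff:
  assumes C: "\<Union>C \<inter> (P \<inter> Q) = {}" and x: "x \<notin> P \<inter> Q" and y: "y \<notin> P \<inter> Q"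
  shows "(x, y) \<in> joined (contract A B \<union> C) \<longleftrightarrow> (x, y) \<in> joined (A \<union> B \<union> C)"
proof
  assume "(x, y) \<in> joined (contract A B \<union> C)"
  then show "(x, y) \<in> joined (A \<union> B \<union> C)"
  proof (induction rule: joined_induct)
    case (step y z)
    have "(y, z) \<in> joined (A \<union> B \<union> C)"
    proof (cases "{y, z} \<in> C")
      case True then show ?thesis by (intro joined_edge) auto
    next
      case False
      then have "(y, z) \<in> joined (A \<union> B)" using step contract_edge_iff by auto
      then show ?thesis using joined_mono[of "A \<union> B" "A \<union> B \<union> C"] by auto
    qed
    then show ?case using step joined_trans by metis
  qed simp
next
  assume "(x, y) \<in> joined (A \<union> B \<union> C)"
  \<comment> \<open>The invariant remembers a vertex \<open>w\<close> that survives contraction,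
    since the current vertex may lie in the interior of a stretch that is contracted as a
    whole.\<close>
  then have "\<exists>w. w \<notin> P \<inter> Q \<and> (x, w) \<in> joined (contract A B \<union> C) \<and> (w, y) \<in> joined (A \<union> B)"
  proof (induction rule: joined_induct)
    case base
    show ?case using x by (intro exI[of _ x]) auto
  next
    case (step y z)
    then obtain w where w: "w \<notin> P \<inter> Q" "(x, w) \<in> joined (contract A B \<union> C)"
      "(w, y) \<in> joined (A \<union> B)" by blast
    show ?case
    proof (cases "{y, z} \<in> C")
      case True
      then have yz: "y \<notin> P \<inter> Q" "z \<notin> P \<inter> Q" using C by auto
      have "(w, y) \<in> joined (contract A B \<union> C)"
        using joined_contractI[OF w(3,1) yz(1)] joined_mono[of "contract A B" "contract A B \<union> C"]
        by auto
      moreover have "(y, z) \<in> joined (contract A B \<union> C)"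
        using True by (intro joined_edge) auto
      ultimately have "(x, z) \<in> joined (contract A B \<union> C)"
        using w(2) joined_trans by metis
      then show ?thesis using yz by (intro exI[of _ z]) auto
    next
      case False
      then have "(y, z) \<in> joined (A \<union> B)" using step by (intro joined_edge) auto
      then show ?thesis using w joined_trans by metis
    qed
  qed
  then obtain w where w: "w \<notin> P \<inter> Q" "(x, w) \<in> joined (contract A B \<union> C)"
      "(w, y) \<in> joined (A \<union> B)" by blast
  then have "(w, y) \<in> joined (contract A B \<union> C)"
    using joined_contractI[OF w(3,1) y] joined_mono[of "contract A B" "contract A B \<union> C"] by auto
  then show "(x, y) \<in> joined (contract A B \<union> C)"
    using w joined_trans by metis
qed

lemma joined_contract_avoids:
  assumes C: "\<Union>C \<inter> (P \<inter> Q) = {}" and "(x, y) \<in> joined (contract A B \<union> C)" "x \<notin> P \<inter> Q"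
  shows "y \<notin> P \<inter> Q"
  using assms(2,3) by (induction rule: joined_induct) (use C in \<open>auto simp: contract_edge_iff\<close>)

text \<open>A loop of \<open>A \<union> B\<close> has no vertex where an edge of \<open>C\<close>
  could be attached.\<close>

lemma joined_closed_class:
  assumes C: "\<Union>C \<inter> (P \<inter> Q) = {}" and v: "joined (A \<union> B) `` {v} \<subseteq> P \<inter> Q"
  shows "joined (A \<union> B \<union> C) `` {v} = joined (A \<union> B) `` {v}"
proof
  show "joined (A \<union> B) `` {v} \<subseteq> joined (A \<union> B \<union> C) `` {v}"
    using joined_mono[of "A \<union> B" "A \<union> B \<union> C"] by auto
  show "joined (A \<union> B \<union> C) `` {v} \<subseteq> joined (A \<union> B) `` {v}"
  proof
    fix y assume "y \<in> joined (A \<union> B \<union> C) `` {v}"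
    then have "(v, y) \<in> joined (A \<union> B \<union> C)" by simp
    then show "y \<in> joined (A \<union> B) `` {v}"
    proof (induction rule: joined_induct)
      case (step y z)
      then have "{y, z} \<notin> C" using C v by auto
      then have "{y, z} \<in> A \<union> B" using step by auto
      then have "(y, z) \<in> joined (A \<union> B)" by (rule joined_edge)
      moreover have "(v, y) \<in> joined (A \<union> B)" using step(3) by simp
      ultimately show ?case using joined_trans by fast
    qed simp
  qed
qed

text \<open>
  A closed class of the union of three matchings either lies in \<open>P \<inter> Q\<close>, or is determined by
  its trace outside \<open>P \<inter> Q\<close>, which is a closed class after contraction.
\<close>

lemma card_closed_classes_contract:
  assumes C: "\<Union>C \<inter> (P \<inter> Q) = {}" and J: "finite J" "J \<inter> (P \<inter> Q) = {}"
  shows "card (closed_classes (A \<union> B \<union> C) (P \<inter> Q \<union> J)) =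
    card (closed_classes (A \<union> B) (P \<inter> Q)) + card (closed_classes (contract A B \<union> C) J)"
proof -
  let ?I = "P \<inter> Q" and ?M = "A \<union> B \<union> C" and ?N = "contract A B \<union> C"
  define X where "X = closed_classes ?M (?I \<union> J)"
  have trace: "joined ?M `` {w} - ?I = joined ?N `` {w}" if "w \<notin> ?I" for w
    using that joined_contract_iff[OF C] joined_contract_avoids[OF C] by auto
  have fin: "finite X"
  proof -
    have "X \<subseteq> (\<lambda>v. joined ?M `` {v}) ` (?I \<union> J)" by (auto simp: X_def closed_classes_def)
    then show ?thesis using J finite_P by (auto intro: finite_subset)
  qed
  have 1: "{K \<in> X. K \<subseteq> ?I} = closed_classes (A \<union> B) ?I"
  proof (intro equalityI subsetI)
    fix K assume "K \<in> {K \<in> X. K \<subseteq> ?I}"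
    then obtain v where v: "K = joined ?M `` {v}" "K \<subseteq> ?I"
      by (auto simp: X_def closed_classes_def)
    then have "v \<in> ?I" by auto
    moreover have "joined (A \<union> B) `` {v} \<subseteq> ?I"
      using v joined_mono[of "A \<union> B" ?M] by auto
    ultimately show "K \<in> closed_classes (A \<union> B) ?I"
      using joined_closed_class[OF C] v by (auto simp: closed_classes_def)
  next
    fix K assume "K \<in> closed_classes (A \<union> B) ?I"
    then obtain v where v: "v \<in> ?I" "K = joined (A \<union> B) `` {v}" "K \<subseteq> ?I"
      by (auto simp: closed_classes_def)
    then have "K = joined ?M `` {v}" using joined_closed_class[OF C, of v] by simp
    then show "K \<in> {K \<in> X. K \<subseteq> ?I}" using v unfolding X_def closed_classes_def by blast
  qed
  have 2: "bij_betw (\<lambda>K. K - ?I) {K \<in> X. \<not> K \<subseteq> ?I} (closed_classes ?N J)"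
    unfolding bij_betw_def
  proof
    show "inj_on (\<lambda>K. K - ?I) {K \<in> X. \<not> K \<subseteq> ?I}"
    proof (rule inj_onI)
      fix K K' assume K: "K \<in> {K \<in> X. \<not> K \<subseteq> ?I}" "K' \<in> {K \<in> X. \<not> K \<subseteq> ?I}" "K - ?I = K' - ?I"
      then obtain v v' where v: "K = joined ?M `` {v}" "K' = joined ?M `` {v'}"
        by (auto simp: X_def closed_classes_def)
      \<comment> \<open>The equal traces are nonempty, so the two classes share a vertex and
        coincide.\<close>
      obtain w where "w \<in> K" "w \<in> K'" using K by blast
      then show "K = K'" using v joined_class_eq by (metis Image_singleton_iff)
    qed
    show "(\<lambda>K. K - ?I) ` {K \<in> X. \<not> K \<subseteq> ?I} = closed_classes ?N J"
    proof (intro equalityI subsetI)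
      fix L assume "L \<in> (\<lambda>K. K - ?I) ` {K \<in> X. \<not> K \<subseteq> ?I}"
      then obtain v where v: "L = joined ?M `` {v} - ?I" "joined ?M `` {v} \<subseteq> ?I \<union> J"
          "\<not> joined ?M `` {v} \<subseteq> ?I"
        by (auto simp: X_def closed_classes_def)
      then obtain w where w: "(v, w) \<in> joined ?M" "w \<notin> ?I" by auto
      then have "L = joined ?N `` {w}" using trace[OF w(2)] v(1) joined_class_eq[OF w(1)] by simp
      moreover have "w \<in> J" "L \<subseteq> J" using w v by auto
      ultimately show "L \<in> closed_classes ?N J" by (auto simp: closed_classes_def)
    next
      fix L assume "L \<in> closed_classes ?N J"
      then obtain w where w: "w \<in> J" "L = joined ?N `` {w}" "L \<subseteq> J"
        by (auto simp: closed_classes_def)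
      have "w \<notin> ?I" using w(1) J by auto
      then have L: "L = joined ?M `` {w} - ?I" using trace w by simp
      moreover have "joined ?M `` {w} \<subseteq> ?I \<union> J" using w(3) unfolding L by (auto simp: Diff_subset_conv)
      moreover have "\<not> joined ?M `` {w} \<subseteq> ?I" 
        using \<open>w \<notin> ?I\<close> by (metis Image_singleton_iff joined_refl subsetD)
      ultimately show "L \<in> (\<lambda>K. K - ?I) ` {K \<in> X. \<not> K \<subseteq> ?I}"
        using w(1) unfolding X_def closed_classes_def by blast
    qed
  qed
  have "card X = card ({K \<in> X. K \<subseteq> ?I} \<union> {K \<in> X. \<not> K \<subseteq> ?I})"
    by (rule arg_cong[of _ _ card]) auto
  also have "\<dots> = card {K \<in> X. K \<subseteq> ?I} + card {K \<in> X. \<not> K \<subseteq> ?I}"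
    using fin by (intro card_Un_disjoint) auto
  finally show ?thesis
    using 1 bij_betw_same_card[OF 2] by (simp add: X_def)
qed

end

text \<open>No vertex is covered three times, so the ends of paths are those covered exactly once.
  The resulting description treats the three matchings symmetrically, and associativity follows from
  it.\<close>

lemma contract_three:
  assumes fin: "finite P" "finite Q" and A: "perfect_matching P A" and B: "perfect_matching Q B"
    and C: "perfect_matching R C" and PQR: "P \<inter> Q \<inter> R = {}"
  shows "contract (contract A B) C =
    {{x, y} | x y. x \<in> (P - Q - R) \<union> (Q - P - R) \<union> (R - P - Q) \<and>
       y \<in> (P - Q - R) \<union> (Q - P - R) \<union> (R - P - Q) \<and> x \<noteq> y \<and> (x, y) \<in> joined (A \<union> B \<union> C)}"
proof -
  interpret two_matchings P Q A B using fin A B by unfold_locales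
  let ?O = "(P - Q - R) \<union> (Q - P - R) \<union> (R - P - Q)"
  have supp: "sym_diff_supports (contract A B) C = ?O"
    using perfect_matching_Union[OF perfect_matching_contract] perfect_matching_Union[OF C] PQR
    by (auto simp: sym_diff_supports_def)
  have "(x, y) \<in> joined (contract A B \<union> C) \<longleftrightarrow> (x, y) \<in> joined (A \<union> B \<union> C)"
    if "x \<in> ?O" "y \<in> ?O" for x y
    using that PQR perfect_matching_Union[OF C] by (intro joined_contract_iff) auto
  then show ?thesis unfolding contract_def[of "contract A B"] supp by blast
qed

text \<open>The symmetric description of a double contraction is used for \<open>A\<close>,
  \<open>B\<close>, \<open>C\<close> and for the rotated order \<open>B\<close>, \<open>C\<close>,
  \<open>A\<close>; commutativity of \<open>contract\<close> restores the order.\<close>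

lemma contract_assoc:
  assumes fin: "finite P" "finite Q" "finite R" and A: "perfect_matching P A"
    and B: "perfect_matching Q B" and C: "perfect_matching R C" and PQR: "P \<inter> Q \<inter> R = {}"
  shows "contract (contract A B) C = contract A (contract B C)"
proof -
  have *: "A \<union> B \<union> C = B \<union> C \<union> A" "Q \<inter> R \<inter> P = {}"
    "(P - Q - R) \<union> (Q - P - R) \<union> (R - P - Q) = (Q - R - P) \<union> (R - Q - P) \<union> (P - Q - R)"
    using PQR by auto
  show ?thesis
    unfolding contract_three[OF fin(1,2) A B C PQR] contract_commute[of A "contract B C"]
      contract_three[OF fin(2,3) B C A *(2)] *(1,3) ..
qed

text \<open>Both sums count the closed classes of \<open>A \<union> B \<union> C\<close> among the
  vertices covered twice, split according to which pair is contracted first.\<close>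

lemma closed_classes_assoc:
  assumes fin: "finite P" "finite Q" "finite R" and A: "perfect_matching P A"
    and B: "perfect_matching Q B" and C: "perfect_matching R C" and PQR: "P \<inter> Q \<inter> R = {}"
  shows "card (closed_classes (A \<union> B) (P \<inter> Q)) +
      card (closed_classes (contract A B \<union> C) (((P - Q) \<union> (Q - P)) \<inter> R)) =
    card (closed_classes (B \<union> C) (Q \<inter> R)) +
      card (closed_classes (A \<union> contract B C) (P \<inter> ((Q - R) \<union> (R - Q))))"
proof -
  interpret AB: two_matchings P Q A B using fin A B by unfold_locales
  interpret BC: two_matchings Q R B C using fin B C by unfold_locales
  have "card (closed_classes (A \<union> B) (P \<inter> Q)) +
      card (closed_classes (contract A B \<union> C) (((P - Q) \<union> (Q - P)) \<inter> R)) =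
    card (closed_classes (A \<union> B \<union> C) (P \<inter> Q \<union> ((P - Q) \<union> (Q - P)) \<inter> R))"
    using fin PQR perfect_matching_Union[OF C]
    by (intro AB.card_closed_classes_contract[symmetric]) auto
  also have "A \<union> B \<union> C = B \<union> C \<union> A" by auto
  also have "P \<inter> Q \<union> ((P - Q) \<union> (Q - P)) \<inter> R = Q \<inter> R \<union> P \<inter> ((Q - R) \<union> (R - Q))"
    using PQR by auto
  also have "card (closed_classes (B \<union> C \<union> A) (Q \<inter> R \<union> P \<inter> ((Q - R) \<union> (R - Q)))) =
    card (closed_classes (B \<union> C) (Q \<inter> R)) +
      card (closed_classes (contract B C \<union> A) (P \<inter> ((Q - R) \<union> (R - Q))))"
    using fin PQR perfect_matching_Union[OF A]
    by (intro BC.card_closed_classes_contract) auto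
  finally show ?thesis by (simp only: Un_commute[of A "contract B C"])
qed

section \<open>Transport of matchings along injective maps\<close>

lemma joined_image:
  assumes f: "inj f"
  shows "(f x, f y) \<in> joined ((`) f ` M) \<longleftrightarrow> (x, y) \<in> joined M"
proof
  assume "(x, y) \<in> joined M"
  then show "(f x, f y) \<in> joined ((`) f ` M)"
  proof (induction rule: joined_induct)
    case (step y z)
    then have "f ` {y, z} \<in> (`) f ` M" by blast
    then have "(f y, f z) \<in> joined ((`) f ` M)" by (intro joined_edge) simp
    then show ?case using step joined_trans by metis
  qed simp
next
  have "(f x, v) \<in> joined ((`) f ` M) \<Longrightarrow> \<exists>y. v = f y \<and> (x, y) \<in> joined M" for v
  proof (induction rule: joined_induct)
    case (step v w)
    then obtain y where y: "v = f y" "(x, y) \<in> joined M" by blast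
    obtain e where e: "e \<in> M" "f ` e = {f y, w}" using step y by auto
    then obtain z where z: "w = f z" by auto
    then have "e = {y, z}"
      using e(2) inj_image_eq_iff[OF f, of e "{y, z}"] by simp
    then show ?case using e y z joined_edge joined_trans by metis
  qed auto
  then show "(f x, f y) \<in> joined ((`) f ` M) \<Longrightarrow> (x, y) \<in> joined M"
    using f by (metis injD)
qed

lemma joined_image_class:
  assumes f: "inj f"
  shows "joined ((`) f ` M) `` {f x} = f ` (joined M `` {x})"
proof (intro equalityI subsetI)
  fix v assume "v \<in> joined ((`) f ` M) `` {f x}"
  then have *: "(f x, v) \<in> joined ((`) f ` M)" by simp
  then have "v \<in> range f" by (induction rule: joined_induct) auto
  then show "v \<in> f ` (joined M `` {x})" using * joined_image[OF f] by auto
qed (use joined_image[OF f] in auto)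

lemma card_closed_classes_image:
  assumes f: "inj f"
  shows "card (closed_classes ((`) f ` M) (f ` I)) = card (closed_classes M I)"
proof -
  have "closed_classes ((`) f ` M) (f ` I) = (`) f ` closed_classes M I"
  proof (intro equalityI subsetI)
    fix K assume "K \<in> closed_classes ((`) f ` M) (f ` I)"
    then obtain v where v: "v \<in> I" "K = f ` (joined M `` {v})" "K \<subseteq> f ` I"
      by (auto simp: closed_classes_def joined_image_class[OF f])
    then have "joined M `` {v} \<subseteq> I" using inj_image_subset_iff[OF f] by metis
    then have "joined M `` {v} \<in> closed_classes M I" using v(1) unfolding closed_classes_def by blast
    then show "K \<in> (`) f ` closed_classes M I" using v(2) by (rule image_eqI[rotated])
  next
    fix K assume "K \<in> (`) f ` closed_classes M I"
    then obtain v where v: "v \<in> I" "K = f ` (joined M `` {v})" "joined M `` {v} \<subseteq> I"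
      by (auto simp: closed_classes_def)
    have "K = joined ((`) f ` M) `` {f v}" "f v \<in> f ` I"
      using v(1,2) by (simp_all add: joined_image_class[OF f])
    moreover have "K \<subseteq> f ` I" using v(2,3) by (simp add: image_mono)
    ultimately show "K \<in> closed_classes ((`) f ` M) (f ` I)"
      unfolding closed_classes_def by blast
  qed
  then show ?thesis
    using card_image[of "(`) f"] inj_on_image[of f] f by (simp add: inj_on_def inj_image_eq_iff)
qed

lemma perfect_matching_image_iff:
  assumes f: "inj f"
  shows "perfect_matching (f ` V) ((`) f ` M) \<longleftrightarrow> perfect_matching V M"
proof -
  have "\<Union>((`) f ` M) = f ` V \<longleftrightarrow> \<Union>M = V"
    using inj_image_eq_iff[OF f, of "\<Union>M" V] by (simp add: image_Union)
  moreover have "disjoint ((`) f ` M) \<longleftrightarrow> disjoint M"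
    using f by (auto simp: disjoint_def inj_image_eq_iff image_Int[OF f, symmetric])
  moreover have "card (f ` e) = card e" for e
    using f by (simp add: card_image inj_on_subset)
  ultimately show ?thesis
    by (auto simp: perfect_matching_def partition_on_def)
qed

text \<open>
  Diagrams are placed between layers of \<open>nat \<times> 'a\<close>, which makes the vertex sets of all iterated
  stackings disjoint parts of one type.
\<close>

definition layers :: "nat \<Rightarrow> nat \<Rightarrow> 'a + 'a \<Rightarrow> nat \<times> 'a" where
  "layers p q = case_sum (Pair p) (Pair q)"

definition layers3 :: "nat \<Rightarrow> nat \<Rightarrow> nat \<Rightarrow> 'a + 'a + 'a \<Rightarrow> nat \<times> 'a" where
  "layers3 p q r = case_sum (Pair p) (layers q r)"

definition lift_diagram :: "nat \<Rightarrow> nat \<Rightarrow> 'a diagram \<Rightarrow> (nat \<times> 'a) set set" where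
  "lift_diagram p q \<alpha> = (`) (layers p q) ` \<alpha>"

lemma inj_layers: "p \<noteq> q \<Longrightarrow> inj (layers p q)"
  by (auto simp: layers_def inj_def split: sum.splits)

lemma inj_layers3: "p \<noteq> q \<Longrightarrow> p \<noteq> r \<Longrightarrow> q \<noteq> r \<Longrightarrow> inj (layers3 p q r)"
  by (auto simp: layers3_def layers_def inj_def split: sum.splits)

lemma layers3_compose:
  "layers3 p q r \<circ> map_sum id Inl = layers p q" "layers3 p q r \<circ> Inr = layers q r"
  "layers3 p q r \<circ> map_sum id Inr = layers p r"
  by (auto simp: fun_eq_iff layers3_def layers_def split: sum.splits)

lemma layers_image: "layers p q ` (Inl ` S \<union> Inr ` T) = {p} \<times> S \<union> {q} \<times> T"
  by (auto simp: layers_def image_Un image_image)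

lemma brauer_diagrams_iff: "\<alpha> \<in> brauer_diagrams S T \<longleftrightarrow> perfect_matching (Inl ` S \<union> Inr ` T) \<alpha>"
  by (simp add: brauer_diagrams_def perfect_matching_def)

lemma perfect_matching_lift:
  "p \<noteq> q \<Longrightarrow> perfect_matching ({p} \<times> S \<union> {q} \<times> T) (lift_diagram p q \<alpha>) \<longleftrightarrow> \<alpha> \<in> brauer_diagrams S T"
  unfolding brauer_diagrams_iff lift_diagram_def
  using perfect_matching_image_iff[OF inj_layers] layers_image by metis

lemma lift_diagram_inject: "p \<noteq> q \<Longrightarrow> lift_diagram p q \<alpha> = lift_diagram p q \<beta> \<longleftrightarrow> \<alpha> = \<beta>"
  unfolding lift_diagram_def
  by (rule inj_image_eq_iff) (simp add: inj_def inj_image_eq_iff[OF inj_layers])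

lemma connected_in_eq_joined: "connected_in E ends x y \<longleftrightarrow> (x, y) \<in> joined (ends ` E)"
proof -
  have "{(v, w). \<exists>e\<in>E. ends e = {v, w}} = {(x, y). {x, y} \<in> ends ` E}" by (auto simp: image_iff)
  then show ?thesis by (simp add: connected_in_def joined_def)
qed

lemma stack_ends_image:
  "stack_ends ` stack_edges \<beta> \<alpha> = (`) (map_sum id Inl) ` \<alpha> \<union> (`) Inr ` \<beta>"
  by (simp add: stack_edges_def image_Un image_image)

lemma layers3_stack:
  "(`) (layers3 p q r) ` ((`) (map_sum id Inl) ` \<alpha> \<union> (`) Inr ` \<beta>)
    = lift_diagram p q \<alpha> \<union> lift_diagram q r \<beta>"
proof -
  have "layers3 p q r ` map_sum id Inl ` e = layers p q ` e" for e :: "('a + 'a) set"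
    by (simp add: image_comp layers3_compose)
  moreover have "layers3 p q r ` Inr ` e = layers q r ` e" for e :: "('a + 'a) set"
    by (simp add: image_comp layers3_compose)
  ultimately show ?thesis
    by (simp add: image_Un image_image lift_diagram_def)
qed

section \<open>Composition and loops of diagrams placed between layers\<close>

context
  fixes p q r :: nat
  assumes pqr: "p \<noteq> q" "p \<noteq> r" "q \<noteq> r"
begin

lemma connected_in_stack_iff:
  "connected_in (stack_edges \<beta> \<alpha>) stack_ends x y \<longleftrightarrow>
     (layers3 p q r x, layers3 p q r y) \<in> joined (lift_diagram p q \<alpha> \<union> lift_diagram q r \<beta>)"
  unfolding connected_in_eq_joined stack_ends_image layers3_stack[symmetric]
    joined_image[OF inj_layers3[OF pqr]] ..

text \<open>The middle layer \<open>q\<close> is covered by both diagrams, so the ends of paths are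
  exactly the vertices of the layers \<open>p\<close> and \<open>r\<close>.\<close>

lemma lift_diagram_comp:
  assumes \<alpha>: "\<alpha> \<in> brauer_diagrams S T" and \<beta>: "\<beta> \<in> brauer_diagrams T U"
  shows "lift_diagram p r (diagram_comp S U \<beta> \<alpha>)
    = contract (lift_diagram p q \<alpha>) (lift_diagram q r \<beta>)"
proof -
  let ?J = "joined (lift_diagram p q \<alpha> \<union> lift_diagram q r \<beta>)"
  have supp: "sym_diff_supports (lift_diagram p q \<alpha>) (lift_diagram q r \<beta>)
      = layers p r ` (Inl ` S \<union> Inr ` U)"
    using perfect_matching_Union[of "{p} \<times> S \<union> {q} \<times> T" "lift_diagram p q \<alpha>"]
      perfect_matching_Union[of "{q} \<times> T \<union> {r} \<times> U" "lift_diagram q r \<beta>"] pqr \<alpha> \<beta>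
    by (auto simp: perfect_matching_lift sym_diff_supports_def layers_image)
  have l3: "layers3 p q r (map_sum id Inr x) = layers p r x" for x
    using layers3_compose(3)[of p q r] by (metis comp_apply)
  have neq: "layers p r x = layers p r y \<longleftrightarrow> x = y" for x y
    using inj_layers[OF pqr(2)] by (auto dest: injD)
  show ?thesis
  proof (intro equalityI subsetI)
    fix e assume "e \<in> lift_diagram p r (diagram_comp S U \<beta> \<alpha>)"
    then obtain x y where xy: "e = layers p r ` {x, y}" "x \<in> Inl ` S \<union> Inr ` U" "y \<in> Inl ` S \<union> Inr ` U"
        "x \<noteq> y" "(layers p r x, layers p r y) \<in> ?J"
      unfolding lift_diagram_def[of p r] diagram_comp_def connected_in_stack_iff l3
      by blast
    have "e = {layers p r x, layers p r y}" "layers p r x \<noteq> layers p r y"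
      using xy neq by auto
    then show "e \<in> contract (lift_diagram p q \<alpha>) (lift_diagram q r \<beta>)"
      unfolding contract_def supp using xy(2,3,5) by blast
  next
    fix e assume "e \<in> contract (lift_diagram p q \<alpha>) (lift_diagram q r \<beta>)"
    then obtain v w where vw: "e = {v, w}" "v \<in> layers p r ` (Inl ` S \<union> Inr ` U)"
        "w \<in> layers p r ` (Inl ` S \<union> Inr ` U)" "v \<noteq> w" "(v, w) \<in> ?J"
      unfolding contract_def supp by blast
    then obtain x y where xy: "v = layers p r x" "w = layers p r y"
        "x \<in> Inl ` S \<union> Inr ` U" "y \<in> Inl ` S \<union> Inr ` U" by blast
    then have "{x, y} \<in> diagram_comp S U \<beta> \<alpha>"
      unfolding diagram_comp_def connected_in_stack_iff l3 using vw(4,5) by blast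
    moreover have "e = layers p r ` {x, y}" using vw(1) xy(1,2) by simp
    ultimately show "e \<in> lift_diagram p r (diagram_comp S U \<beta> \<alpha>)"
      unfolding lift_diagram_def[of p r] by (rule rev_image_eqI)
  qed
qed

text \<open>Cycles are counted in the nested sum type, where \<open>stack_ends\<close> is injective
  on each half of the edges but may identify an edge of \<open>\<alpha>\<close> with one of
  \<open>\<beta>\<close>. Only then are the classes moved to the layers.\<close>

lemma loop_count_eq:
  assumes \<alpha>: "\<alpha> \<in> brauer_diagrams S T" and \<beta>: "\<beta> \<in> brauer_diagrams T U"
    and fin: "finite S" "finite T" "finite U"
  shows "loop_count \<beta> \<alpha> =
    card (closed_classes (lift_diagram p q \<alpha> \<union> lift_diagram q r \<beta>) ({q} \<times> T))"
proof -
  have inj: "inj (map_sum id Inl :: 'a + 'a \<Rightarrow> 'a + 'a + 'a)"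
    by (auto simp: inj_def map_sum_def split: sum.splits)
  let ?P = "map_sum id Inl ` (Inl ` S \<union> Inr ` T) :: ('a + 'a + 'a) set"
  let ?Q = "Inr ` (Inl ` T \<union> Inr ` U) :: ('a + 'a + 'a) set"
  let ?A = "(`) (map_sum id Inl) ` \<alpha> :: ('a + 'a + 'a) set set"
  let ?B = "(`) Inr ` \<beta> :: ('a + 'a + 'a) set set"
  interpret two_matchings ?P ?Q ?A ?B
    using fin \<alpha> \<beta> perfect_matching_image_iff[OF inj]
      perfect_matching_image_iff[of "Inr :: 'a + 'a \<Rightarrow> 'a + 'a + 'a"]
    by unfold_locales (auto simp: brauer_diagrams_iff)
  have "loop_count \<beta> \<alpha> = card (closed_classes (?A \<union> ?B) (?P \<inter> ?Q))"
    unfolding loop_count_def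
  proof (rule card_cycles)
    show "stack_edges \<beta> \<alpha> = Inl ` \<alpha> \<union> Inr ` \<beta>" by (simp add: stack_edges_def)
    show "bij_betw stack_ends (Inl ` \<alpha>) ?A"
      by (auto simp: bij_betw_def inj_on_def image_image inj_image_eq_iff[OF inj])
    show "bij_betw stack_ends (Inr ` \<beta>) ?B"
      by (auto simp: bij_betw_def inj_on_def image_image inj_image_eq_iff)
  qed auto
  also have "?P \<inter> ?Q = Inr ` Inl ` T" by (auto simp: image_Un image_image)
  also have "card (closed_classes (?A \<union> ?B) (Inr ` Inl ` T)) =
      card (closed_classes ((`) (layers3 p q r) ` (?A \<union> ?B)) (layers3 p q r ` Inr ` Inl ` T))"
    by (rule card_closed_classes_image[OF inj_layers3[OF pqr], symmetric])
  also have "(`) (layers3 p q r) ` (?A \<union> ?B) = lift_diagram p q \<alpha> \<union> lift_diagram q r \<beta>"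
    by (rule layers3_stack)
  also have "layers3 p q r ` Inr ` Inl ` T = {q} \<times> T"
    by (auto simp: layers3_def layers_def image_iff)
  finally show ?thesis .
qed

end

lemma diagram_comp_in:
  assumes \<alpha>: "\<alpha> \<in> brauer_diagrams S T" and \<beta>: "\<beta> \<in> brauer_diagrams T U"
    and fin: "finite S" "finite T" "finite U"
  shows "diagram_comp S U \<beta> \<alpha> \<in> brauer_diagrams S U"
proof -
  interpret two_matchings "{0} \<times> S \<union> {1} \<times> T" "{1} \<times> T \<union> {2} \<times> U"
    "lift_diagram 0 1 \<alpha>" "lift_diagram 1 2 \<beta>"
    using assms by unfold_locales (auto simp: perfect_matching_lift)
  have "({0 :: nat} \<times> S \<union> {1} \<times> T) - ({1} \<times> T \<union> {2} \<times> U) \<union> (({1} \<times> T \<union> {2} \<times> U) - ({0} \<times> S \<union> {1} \<times> T))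
      = {0} \<times> S \<union> {2} \<times> U"
    by auto
  then have "perfect_matching ({0} \<times> S \<union> {2} \<times> U) (lift_diagram 0 2 (diagram_comp S U \<beta> \<alpha>))"
    using perfect_matching_contract lift_diagram_comp[OF _ _ _ \<alpha> \<beta>, of 0 1 2] by simp
  then show ?thesis by (simp add: perfect_matching_lift)
qed

context
  fixes \<alpha> \<beta> \<gamma> :: "'a diagram" and S T U V :: "'a set"
  assumes \<alpha>: "\<alpha> \<in> brauer_diagrams S T" and \<beta>: "\<beta> \<in> brauer_diagrams T U"
    and \<gamma>: "\<gamma> \<in> brauer_diagrams U V"
    and fin: "finite S" "finite T" "finite U" "finite V"
begin

lemma perfect_matching_lifts:
  "perfect_matching ({0} \<times> S \<union> {1} \<times> T) (lift_diagram 0 1 \<alpha>)"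
  "perfect_matching ({1} \<times> T \<union> {2} \<times> U) (lift_diagram 1 2 \<beta>)"
  "perfect_matching ({2} \<times> U \<union> {3} \<times> V) (lift_diagram 2 3 \<gamma>)"
  by (simp_all add: perfect_matching_lift \<alpha> \<beta> \<gamma>)

lemma finite_layers:
  "finite ({0 :: nat} \<times> S \<union> {1} \<times> T)" "finite ({1 :: nat} \<times> T \<union> {2} \<times> U)"
  "finite ({2 :: nat} \<times> U \<union> {3} \<times> V)"
  using fin by simp_all

lemma layers_disjoint:
  "({0 :: nat} \<times> S \<union> {1} \<times> T) \<inter> ({1} \<times> T \<union> {2} \<times> U) \<inter> ({2} \<times> U \<union> {3} \<times> V) = {}"
  by auto

lemma lift_comps:
  "lift_diagram 0 2 (diagram_comp S U \<beta> \<alpha>) = contract (lift_diagram 0 1 \<alpha>) (lift_diagram 1 2 \<beta>)"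
  "lift_diagram 1 3 (diagram_comp T V \<gamma> \<beta>) = contract (lift_diagram 1 2 \<beta>) (lift_diagram 2 3 \<gamma>)"
  "lift_diagram 0 3 (diagram_comp S V \<gamma> (diagram_comp S U \<beta> \<alpha>)) =
     contract (lift_diagram 0 2 (diagram_comp S U \<beta> \<alpha>)) (lift_diagram 2 3 \<gamma>)"
  "lift_diagram 0 3 (diagram_comp S V (diagram_comp T V \<gamma> \<beta>) \<alpha>) =
     contract (lift_diagram 0 1 \<alpha>) (lift_diagram 1 3 (diagram_comp T V \<gamma> \<beta>))"
  using lift_diagram_comp[of 0 1 2, OF _ _ _ \<alpha> \<beta>] lift_diagram_comp[of 1 2 3, OF _ _ _ \<beta> \<gamma>]
    lift_diagram_comp[of 0 2 3, OF _ _ _ diagram_comp_in[OF \<alpha> \<beta> fin(1,2,3)] \<gamma>]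
    lift_diagram_comp[of 0 1 3, OF _ _ _ \<alpha> diagram_comp_in[OF \<beta> \<gamma> fin(2,3,4)]]
  by simp_all

lemma diagram_comp_assoc:
  "diagram_comp S V \<gamma> (diagram_comp S U \<beta> \<alpha>) = diagram_comp S V (diagram_comp T V \<gamma> \<beta>) \<alpha>"
proof -
  have "lift_diagram 0 3 (diagram_comp S V \<gamma> (diagram_comp S U \<beta> \<alpha>)) =
      lift_diagram 0 3 (diagram_comp S V (diagram_comp T V \<gamma> \<beta>) \<alpha>)"
    unfolding lift_comps
    by (rule contract_assoc[OF finite_layers perfect_matching_lifts layers_disjoint])
  then show ?thesis by (subst (asm) lift_diagram_inject) simp_all
qed

lemma loop_count_assoc:
  "loop_count \<beta> \<alpha> + loop_count \<gamma> (diagram_comp S U \<beta> \<alpha>) =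
     loop_count \<gamma> \<beta> + loop_count (diagram_comp T V \<gamma> \<beta>) \<alpha>"
proof -
  let ?P = "{0 :: nat} \<times> S \<union> {1} \<times> T" and ?Q = "{1 :: nat} \<times> T \<union> {2} \<times> U" and ?R = "{2 :: nat} \<times> U \<union> {3} \<times> V"
  have *: "?P \<inter> ?Q = {1} \<times> T" "((?P - ?Q) \<union> (?Q - ?P)) \<inter> ?R = {2} \<times> U" "?Q \<inter> ?R = {2} \<times> U"
    "?P \<inter> ((?Q - ?R) \<union> (?R - ?Q)) = {1} \<times> T"
    by auto
  show ?thesis
    using closed_classes_assoc[OF finite_layers perfect_matching_lifts layers_disjoint]
      loop_count_eq[of 0 1 2, OF _ _ _ \<alpha> \<beta> fin(1,2,3)]
      loop_count_eq[of 1 2 3, OF _ _ _ \<beta> \<gamma> fin(2,3,4)]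
      loop_count_eq[of 0 2 3, OF _ _ _ diagram_comp_in[OF \<alpha> \<beta> fin(1,2,3)] \<gamma> fin(1,3,4)]
      loop_count_eq[of 0 1 3, OF _ _ _ \<alpha> diagram_comp_in[OF \<beta> \<gamma> fin(2,3,4)] fin(1,2,4)]
    unfolding * lift_comps by simp
qed

end

section \<open>Composition of Brauer diagrams\<close>

definition stacked :: "'a diagram \<Rightarrow> 'a diagram \<Rightarrow> (('a + 'a + 'a) \<times> ('a + 'a + 'a)) set" where
  "stacked \<beta> \<alpha> = joined (stack_ends ` stack_edges \<beta> \<alpha>)"

lemma stacked_iff: "(x, y) \<in> stacked \<beta> \<alpha> \<longleftrightarrow> connected_in (stack_edges \<beta> \<alpha>) stack_ends x y"
  by (simp add: stacked_def connected_in_eq_joined)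

lemma stacked_trans: "(x, y) \<in> stacked \<beta> \<alpha> \<Longrightarrow> (y, z) \<in> stacked \<beta> \<alpha> \<Longrightarrow> (x, z) \<in> stacked \<beta> \<alpha>"
  unfolding stacked_def by (rule joined_trans)

lemma stacked_sym: "(x, y) \<in> stacked \<beta> \<alpha> \<Longrightarrow> (y, x) \<in> stacked \<beta> \<alpha>"
  unfolding stacked_def by (rule joined_sym)

lemma stacked_lower:
  assumes "{x, y} \<in> \<alpha>"
  shows "(map_sum id Inl x, map_sum id Inl y) \<in> stacked \<beta> \<alpha>"
proof -
  have "map_sum id Inl ` {x, y} \<in> stack_ends ` stack_edges \<beta> \<alpha>"
    unfolding stack_ends_image using assms by blast
  then show ?thesis unfolding stacked_def by (intro joined_edge) simp
qed

lemma stacked_upper: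
  assumes "{x, y} \<in> \<beta>"
  shows "(Inr x, Inr y) \<in> stacked \<beta> \<alpha>"
proof -
  have "Inr ` {x, y} \<in> stack_ends ` stack_edges \<beta> \<alpha>"
    unfolding stack_ends_image using assms by blast
  then show ?thesis unfolding stacked_def by (intro joined_edge) simp
qed

lemma stacked_edges:
  "{Inl s, Inl s'} \<in> \<alpha> \<Longrightarrow> (Inl s, Inl s') \<in> stacked \<beta> \<alpha>"
  "{Inl s, Inr t} \<in> \<alpha> \<Longrightarrow> (Inl s, Inr (Inl t)) \<in> stacked \<beta> \<alpha>"
  "{Inr t, Inr t'} \<in> \<alpha> \<Longrightarrow> (Inr (Inl t), Inr (Inl t')) \<in> stacked \<beta> \<alpha>"
  "{Inl t, Inl t'} \<in> \<beta> \<Longrightarrow> (Inr (Inl t), Inr (Inl t')) \<in> stacked \<beta> \<alpha>"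
  "{Inl t, Inr u} \<in> \<beta> \<Longrightarrow> (Inr (Inl t), Inr (Inr u)) \<in> stacked \<beta> \<alpha>"
  "{Inr u, Inr u'} \<in> \<beta> \<Longrightarrow> (Inr (Inr u), Inr (Inr u')) \<in> stacked \<beta> \<alpha>"
  using stacked_lower[of "Inl s" "Inl s'" \<alpha> \<beta>] stacked_lower[of "Inl s" "Inr t" \<alpha> \<beta>]
    stacked_lower[of "Inr t" "Inr t'" \<alpha> \<beta>] stacked_upper[of "Inl t" "Inl t'" \<beta> \<alpha>]
    stacked_upper[of "Inl t" "Inr u" \<beta> \<alpha>] stacked_upper[of "Inr u" "Inr u'" \<beta> \<alpha>]
  by simp_all

lemma diagram_comp_edge_iff:
  "{x, y} \<in> diagram_comp S U \<beta> \<alpha> \<longleftrightarrow>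
     x \<in> Inl ` S \<union> Inr ` U \<and> y \<in> Inl ` S \<union> Inr ` U \<and> x \<noteq> y \<and>
     (map_sum id Inr x, map_sum id Inr y) \<in> stacked \<beta> \<alpha>"
  unfolding diagram_comp_def stacked_iff[symmetric]
  by (auto simp: doubleton_eq_iff intro: stacked_sym)

lemma diagram_comp_edgesI:
  "(Inl s, Inl s') \<in> stacked \<beta> \<alpha> \<Longrightarrow> s \<in> S \<Longrightarrow> s' \<in> S \<Longrightarrow> s \<noteq> s' \<Longrightarrow> {Inl s, Inl s'} \<in> diagram_comp S U \<beta> \<alpha>"
  "(Inl s, Inr (Inr u)) \<in> stacked \<beta> \<alpha> \<Longrightarrow> s \<in> S \<Longrightarrow> u \<in> U \<Longrightarrow> {Inl s, Inr u} \<in> diagram_comp S U \<beta> \<alpha>"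
  "(Inr (Inr u), Inr (Inr u')) \<in> stacked \<beta> \<alpha> \<Longrightarrow> u \<in> U \<Longrightarrow> u' \<in> U \<Longrightarrow> u \<noteq> u' \<Longrightarrow>
    {Inr u, Inr u'} \<in> diagram_comp S U \<beta> \<alpha>"
  unfolding diagram_comp_edge_iff by auto

lemma brauer_edge_unique: "\<alpha> \<in> brauer_diagrams S T \<Longrightarrow> {v, w} \<in> \<alpha> \<Longrightarrow> {v, w'} \<in> \<alpha> \<Longrightarrow> w = w'"
  unfolding brauer_diagrams_iff by (rule perfect_matching_unique)

lemma brauer_edge_unique': "\<alpha> \<in> brauer_diagrams S T \<Longrightarrow> {w, v} \<in> \<alpha> \<Longrightarrow> {w', v} \<in> \<alpha> \<Longrightarrow> w = w'"
  using brauer_edge_unique by (metis insert_commute)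

lemma brauer_edge_neq: "\<alpha> \<in> brauer_diagrams S T \<Longrightarrow> {v, w} \<in> \<alpha> \<Longrightarrow> v \<noteq> w"
  unfolding brauer_diagrams_iff by (rule perfect_matching_neq)

lemma brauer_edge_in:
  assumes "\<alpha> \<in> brauer_diagrams S T"
  shows "{Inl s, w} \<in> \<alpha> \<Longrightarrow> s \<in> S" "{w, Inl s} \<in> \<alpha> \<Longrightarrow> s \<in> S"
    "{Inr t, w} \<in> \<alpha> \<Longrightarrow> t \<in> T" "{w, Inr t} \<in> \<alpha> \<Longrightarrow> t \<in> T"
  using assms perfect_matching_in unfolding brauer_diagrams_iff by fastforce+

lemma brauer_Inl_cases:
  assumes "\<alpha> \<in> brauer_diagrams S T" "s \<in> S"
  obtains (horizontal) s' where "s' \<in> S" "{Inl s, Inl s'} \<in> \<alpha>"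
    | (vertical) t where "t \<in> T" "{Inl s, Inr t} \<in> \<alpha>"
proof -
  obtain w where w: "{Inl s, w} \<in> \<alpha>"
    using perfect_matching_ex[of "Inl ` S \<union> Inr ` T" \<alpha> "Inl s"] assms
    unfolding brauer_diagrams_iff by auto
  show thesis
  proof (cases w)
    case (Inl s') then show ?thesis using w horizontal brauer_edge_in(2)[OF assms(1)] by simp
  next
    case (Inr t) then show ?thesis using w vertical brauer_edge_in(4)[OF assms(1)] by simp
  qed
qed

lemma brauer_Inr_cases:
  assumes "\<alpha> \<in> brauer_diagrams S T" "t \<in> T"
  obtains (horizontal) t' where "t' \<in> T" "{Inr t, Inr t'} \<in> \<alpha>"
    | (vertical) s where "s \<in> S" "{Inl s, Inr t} \<in> \<alpha>"
proof -
  obtain w where w: "{Inr t, w} \<in> \<alpha>"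
    using perfect_matching_ex[of "Inl ` S \<union> Inr ` T" \<alpha> "Inr t"] assms
    unfolding brauer_diagrams_iff by auto
  show thesis
  proof (cases w)
    case (Inl s')
    then have "{Inl s', Inr t} \<in> \<alpha>" using w by (simp add: insert_commute)
    then show ?thesis using vertical brauer_edge_in(1)[OF assms(1)] by blast
  next
    case (Inr t) then show ?thesis using w horizontal brauer_edge_in(4)[OF assms(1)] by simp
  qed
qed

text \<open>The composite and \<open>\<gamma>\<close> are perfect matchings of the same vertices, so
  it is enough to exhibit one path for each edge of \<open>\<gamma>\<close>; arbitrary paths in the
  stacked graph need no analysis.\<close>

lemma diagram_comp_eqI:
  assumes \<alpha>: "\<alpha> \<in> brauer_diagrams S T" and \<beta>: "\<beta> \<in> brauer_diagrams T U"
    and \<gamma>: "\<gamma> \<in> brauer_diagrams S U"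
    and fin: "finite S" "finite T" "finite U"
    and ll: "\<And>s s'. {Inl s, Inl s'} \<in> \<gamma> \<Longrightarrow> (Inl s, Inl s') \<in> stacked \<beta> \<alpha>"
    and lr: "\<And>s u. {Inl s, Inr u} \<in> \<gamma> \<Longrightarrow> (Inl s, Inr (Inr u)) \<in> stacked \<beta> \<alpha>"
    and rr: "\<And>u u'. {Inr u, Inr u'} \<in> \<gamma> \<Longrightarrow> (Inr (Inr u), Inr (Inr u')) \<in> stacked \<beta> \<alpha>"
  shows "diagram_comp S U \<beta> \<alpha> = \<gamma>"
proof (rule sym, rule perfect_matching_subset_eq)
  show \<gamma>_pm: "perfect_matching (Inl ` S \<union> Inr ` U) \<gamma>" using \<gamma> by (simp add: brauer_diagrams_iff)
  show "perfect_matching (Inl ` S \<union> Inr ` U) (diagram_comp S U \<beta> \<alpha>)"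
    using diagram_comp_in[OF \<alpha> \<beta> fin] by (simp add: brauer_diagrams_iff)
  show "\<gamma> \<subseteq> diagram_comp S U \<beta> \<alpha>"
  proof
    fix e assume e: "e \<in> \<gamma>"
    then obtain v w where vw: "e = {v, w}" "v \<noteq> w" "v \<in> Inl ` S \<union> Inr ` U" "w \<in> Inl ` S \<union> Inr ` U"
      using perfect_matching_edge_cases[OF \<gamma>_pm] by metis
    have "(map_sum id Inr v, map_sum id Inr w) \<in> stacked \<beta> \<alpha>"
    proof (cases v)
      case v: (Inl s)
      show ?thesis
      proof (cases w)
        case (Inl s') then show ?thesis using v ll e vw by simp
      next
        case (Inr u) then show ?thesis using v lr e vw by simp
      qed
    next
      case v: (Inr u)
      show ?thesis
      proof (cases w)
        case (Inl s)
        then show ?thesis using v lr[of s u] e vw(1) by (auto simp: insert_commute intro: stacked_sym)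
      next
        case (Inr u') then show ?thesis using v rr e vw by simp
      qed
    qed
    then show "e \<in> diagram_comp S U \<beta> \<alpha>" using vw diagram_comp_edge_iff by blast
  qed
qed

section \<open>Upwards and downwards diagrams\<close>

lemma upwards_diagrams_iff:
  "\<alpha> \<in> upwards_diagrams S T \<longleftrightarrow> \<alpha> \<in> brauer_diagrams S T \<and> (\<forall>s\<in>S. \<exists>t\<in>T. {Inl s, Inr t} \<in> \<alpha>)"
proof (intro iffI conjI ballI)
  assume \<alpha>: "\<alpha> \<in> upwards_diagrams S T"
  then show "\<alpha> \<in> brauer_diagrams S T" by (simp add: upwards_diagrams_def)
  fix s assume "s \<in> S"
  then show "\<exists>t\<in>T. {Inl s, Inr t} \<in> \<alpha>"
    using \<alpha> by (cases rule: brauer_Inl_cases[OF \<open>\<alpha> \<in> brauer_diagrams S T\<close>])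
      (auto simp: upwards_diagrams_def)
next
  assume \<alpha>: "\<alpha> \<in> brauer_diagrams S T \<and> (\<forall>s\<in>S. \<exists>t\<in>T. {Inl s, Inr t} \<in> \<alpha>)"
  have "\<not> e \<subseteq> Inl ` S" if e: "e \<in> \<alpha>" for e
  proof
    assume sub: "e \<subseteq> Inl ` S"
    obtain v w where vw: "e = {v, w}"
      using perfect_matching_edge_cases[of "Inl ` S \<union> Inr ` T" \<alpha> e] \<alpha> e
      unfolding brauer_diagrams_iff by metis
    then obtain s s' where s: "v = Inl s" "s \<in> S" "w = Inl s'" using sub by auto
    then show False using \<alpha> brauer_edge_unique[of \<alpha> S T v w] e vw by fastforce
  qed
  then show "\<alpha> \<in> upwards_diagrams S T" using \<alpha> by (auto simp: upwards_diagrams_def)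
qed

lemma downwards_diagrams_iff:
  "\<alpha> \<in> downwards_diagrams S T \<longleftrightarrow> \<alpha> \<in> brauer_diagrams S T \<and> (\<forall>t\<in>T. \<exists>s\<in>S. {Inl s, Inr t} \<in> \<alpha>)"
proof (intro iffI conjI ballI)
  assume \<alpha>: "\<alpha> \<in> downwards_diagrams S T"
  then show "\<alpha> \<in> brauer_diagrams S T" by (simp add: downwards_diagrams_def)
  fix t assume "t \<in> T"
  then show "\<exists>s\<in>S. {Inl s, Inr t} \<in> \<alpha>"
    using \<alpha> by (cases rule: brauer_Inr_cases[OF \<open>\<alpha> \<in> brauer_diagrams S T\<close>])
      (auto simp: downwards_diagrams_def)
next
  assume \<alpha>: "\<alpha> \<in> brauer_diagrams S T \<and> (\<forall>t\<in>T. \<exists>s\<in>S. {Inl s, Inr t} \<in> \<alpha>)"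
  have "\<not> e \<subseteq> Inr ` T" if e: "e \<in> \<alpha>" for e
  proof
    assume sub: "e \<subseteq> Inr ` T"
    obtain v w where vw: "e = {v, w}"
      using perfect_matching_edge_cases[of "Inl ` S \<union> Inr ` T" \<alpha> e] \<alpha> e
      unfolding brauer_diagrams_iff by metis
    then obtain t t' where t: "v = Inr t" "t \<in> T" "w = Inr t'" using sub by auto
    then show False
      using \<alpha> brauer_edge_unique'[of \<alpha> S T w v] e vw by (fastforce simp: insert_commute)
  qed
  then show "\<alpha> \<in> downwards_diagrams S T" using \<alpha> by (auto simp: downwards_diagrams_def)
qed

lemma upwards_diagrams_ex: "\<alpha> \<in> upwards_diagrams S T \<Longrightarrow> s \<in> S \<Longrightarrow> \<exists>t\<in>T. {Inl s, Inr t} \<in> \<alpha>"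
  and downwards_diagrams_ex: "\<alpha> \<in> downwards_diagrams S T \<Longrightarrow> t \<in> T \<Longrightarrow> \<exists>s\<in>S. {Inl s, Inr t} \<in> \<alpha>"
  by (simp_all add: upwards_diagrams_iff downwards_diagrams_iff)

lemma upwards_diagrams_subset: "upwards_diagrams S T \<subseteq> brauer_diagrams S T"
  and downwards_diagrams_subset: "downwards_diagrams S T \<subseteq> brauer_diagrams S T"
  by (auto simp: upwards_diagrams_def downwards_diagrams_def)

lemma finite_brauer_diagrams: "finite S \<Longrightarrow> finite T \<Longrightarrow> finite (brauer_diagrams S T)"
  by (rule finite_subset[of _ "Pow (Pow (Inl ` S \<union> Inr ` T))"])
    (auto simp: brauer_diagrams_def partition_on_def)

text \<open>A loop is a component inside the middle layer, so a path out of that layer from each of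
  its vertices rules out all loops.\<close>

lemma loop_count_zeroI:
  assumes \<alpha>: "\<alpha> \<in> brauer_diagrams S T" and \<beta>: "\<beta> \<in> brauer_diagrams T U"
    and fin: "finite S" "finite T" "finite U"
    and escape: "\<And>t. t \<in> T \<Longrightarrow> \<exists>v. (Inr (Inl t), v) \<in> stacked \<beta> \<alpha> \<and> v \<notin> Inr ` Inl ` T"
  shows "loop_count \<beta> \<alpha> = 0"
proof -
  let ?J = "joined (lift_diagram 0 1 \<alpha> \<union> lift_diagram 1 2 \<beta>)"
  have "closed_classes (lift_diagram 0 1 \<alpha> \<union> lift_diagram 1 2 \<beta>) ({1} \<times> T) = {}"
  proof -
    have "\<not> ?J `` {(1, t)} \<subseteq> {1} \<times> T" if t: "t \<in> T" for t
    proof -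
      obtain v where v: "(Inr (Inl t), v) \<in> stacked \<beta> \<alpha>" "v \<notin> Inr ` Inl ` T"
        using escape[OF t] by blast
      then have "(layers3 0 1 2 (Inr (Inl t)), layers3 0 1 2 v) \<in> ?J"
        using connected_in_stack_iff[of 0 1 2 \<beta> \<alpha>] by (simp add: stacked_iff)
      moreover have "layers3 0 1 2 (Inr (Inl t)) = (1, t)" by (simp add: layers3_def layers_def)
      moreover have "layers3 0 1 2 v \<notin> {1} \<times> T"
        using v(2) by (auto simp: layers3_def layers_def split: sum.splits)
      ultimately show ?thesis by auto
    qed
    then show ?thesis unfolding closed_classes_def by blast
  qed
  then show ?thesis using loop_count_eq[of 0 1 2, OF _ _ _ \<alpha> \<beta> fin] by simp
qed

lemma loop_count_downwards:
  assumes \<alpha>: "\<alpha> \<in> downwards_diagrams S T" and \<beta>: "\<beta> \<in> brauer_diagrams T U"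
    and fin: "finite S" "finite T" "finite U"
  shows "loop_count \<beta> \<alpha> = 0"
proof (rule loop_count_zeroI[OF _ \<beta> fin])
  show "\<alpha> \<in> brauer_diagrams S T" using \<alpha> downwards_diagrams_subset by blast
  fix t assume "t \<in> T"
  then obtain s where "{Inl s, Inr t} \<in> \<alpha>" using downwards_diagrams_ex[OF \<alpha>] by blast
  then have "(Inr (Inl t), Inl s) \<in> stacked \<beta> \<alpha>" by (intro stacked_sym[OF stacked_edges(2)])
  then show "\<exists>v. (Inr (Inl t), v) \<in> stacked \<beta> \<alpha> \<and> v \<notin> Inr ` Inl ` T" by blast
qed

lemma loop_count_upwards:
  assumes \<alpha>: "\<alpha> \<in> brauer_diagrams S T" and \<beta>: "\<beta> \<in> upwards_diagrams T U"
    and fin: "finite S" "finite T" "finite U"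
  shows "loop_count \<beta> \<alpha> = 0"
proof (rule loop_count_zeroI[OF \<alpha> _ fin])
  show "\<beta> \<in> brauer_diagrams T U" using \<beta> upwards_diagrams_subset by blast
  fix t assume "t \<in> T"
  then obtain u where "{Inl t, Inr u} \<in> \<beta>" using upwards_diagrams_ex[OF \<beta>] by blast
  then have "(Inr (Inl t), Inr (Inr u)) \<in> stacked \<beta> \<alpha>" by (rule stacked_edges(5))
  then show "\<exists>v. (Inr (Inl t), v) \<in> stacked \<beta> \<alpha> \<and> v \<notin> Inr ` Inl ` T" by blast
qed

lemma upwards_diagram_comp:
  assumes \<alpha>: "\<alpha> \<in> upwards_diagrams S T" and \<beta>: "\<beta> \<in> upwards_diagrams T U"
    and fin: "finite S" "finite T" "finite U"
  shows "diagram_comp S U \<beta> \<alpha> \<in> upwards_diagrams S U"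
  unfolding upwards_diagrams_iff
proof (intro conjI ballI)
  show "diagram_comp S U \<beta> \<alpha> \<in> brauer_diagrams S U"
    using \<alpha> \<beta> upwards_diagrams_subset fin by (intro diagram_comp_in[of _ S T]) auto
  fix s assume s: "s \<in> S"
  then obtain t where t: "t \<in> T" "{Inl s, Inr t} \<in> \<alpha>" using upwards_diagrams_ex[OF \<alpha>] by blast
  then obtain u where u: "u \<in> U" "{Inl t, Inr u} \<in> \<beta>" using upwards_diagrams_ex[OF \<beta>] by blast
  show "\<exists>u\<in>U. {Inl s, Inr u} \<in> diagram_comp S U \<beta> \<alpha>"
    using stacked_trans[OF stacked_edges(2)[OF t(2)] stacked_edges(5)[OF u(2)]] s u
    by (intro bexI[of _ u] diagram_comp_edgesI)
qed

lemma downwards_diagram_comp: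
  assumes \<alpha>: "\<alpha> \<in> downwards_diagrams S T" and \<beta>: "\<beta> \<in> downwards_diagrams T U"
    and fin: "finite S" "finite T" "finite U"
  shows "diagram_comp S U \<beta> \<alpha> \<in> downwards_diagrams S U"
  unfolding downwards_diagrams_iff
proof (intro conjI ballI)
  show "diagram_comp S U \<beta> \<alpha> \<in> brauer_diagrams S U"
    using \<alpha> \<beta> downwards_diagrams_subset fin by (intro diagram_comp_in[of _ S T]) auto
  fix u assume u: "u \<in> U"
  then obtain t where t: "t \<in> T" "{Inl t, Inr u} \<in> \<beta>" using downwards_diagrams_ex[OF \<beta>] by blast
  then obtain s where s: "s \<in> S" "{Inl s, Inr t} \<in> \<alpha>" using downwards_diagrams_ex[OF \<alpha>] by blast
  show "\<exists>s\<in>S. {Inl s, Inr u} \<in> diagram_comp S U \<beta> \<alpha>"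
    using stacked_trans[OF stacked_edges(2)[OF s(2)] stacked_edges(5)[OF t(2)]] s u
    by (intro bexI[of _ s] diagram_comp_edgesI)
qed

section \<open>Bijections and reversed diagrams\<close>

definition bij_diagram :: "('a \<Rightarrow> 'a) \<Rightarrow> 'a set \<Rightarrow> 'a diagram" where
  "bij_diagram h S = {{Inl s, Inr (h s)} | s. s \<in> S}"

lemma id_diagram_eq: "id_diagram S = bij_diagram id S"
  by (simp add: id_diagram_def bij_diagram_def)

lemma bij_diagram_edges:
  "{Inl s, Inr t} \<in> bij_diagram h S \<longleftrightarrow> s \<in> S \<and> t = h s"
  "{Inr t, Inl s} \<in> bij_diagram h S \<longleftrightarrow> s \<in> S \<and> t = h s"
  "{Inl s, Inl s'} \<notin> bij_diagram h S" "{Inr t, Inr t'} \<notin> bij_diagram h S"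
  by (auto simp: bij_diagram_def doubleton_eq_iff)

lemma bij_diagram_in:
  assumes "bij_betw h S T"
  shows "bij_diagram h S \<in> brauer_diagrams S T"
  unfolding brauer_diagrams_iff
proof (rule perfect_matchingI)
  have T: "T = h ` S" and inj: "inj_on h S" using assms by (auto simp: bij_betw_def)
  show "\<exists>w. {v, w} \<in> bij_diagram h S" if "v \<in> Inl ` S \<union> Inr ` T" for v
    using that by (auto simp: T bij_diagram_edges) (metis bij_diagram_edges(1,2))+
  show "\<exists>v w. e = {v, w} \<and> v \<noteq> w \<and> v \<in> Inl ` S \<union> Inr ` T \<and> w \<in> Inl ` S \<union> Inr ` T"
    if e: "e \<in> bij_diagram h S" for e
  proof -
    obtain s where "s \<in> S" "e = {Inl s, Inr (h s)}" using e by (auto simp: bij_diagram_def)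
    then show ?thesis unfolding T by blast
  qed
  show "w = w'" if "{v, w} \<in> bij_diagram h S" "{v, w'} \<in> bij_diagram h S" for v w w'
    using that inj by (cases v; cases w; cases w') (auto simp: bij_diagram_edges dest: inj_onD)
qed

lemma bij_diagram_upwards: "bij_betw h S T \<Longrightarrow> bij_diagram h S \<in> upwards_diagrams S T"
  unfolding upwards_diagrams_iff
  by (auto simp: bij_diagram_in bij_diagram_edges dest: bij_betwE)

lemma bij_diagram_downwards: "bij_betw h S T \<Longrightarrow> bij_diagram h S \<in> downwards_diagrams S T"
  unfolding downwards_diagrams_iff
  by (auto simp: bij_diagram_in bij_diagram_edges bij_betw_def)

lemmas id_diagram_in = bij_diagram_in[OF bij_betw_id, folded id_diagram_eq]
  and id_diagram_upwards = bij_diagram_upwards[OF bij_betw_id, folded id_diagram_eq]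
  and id_diagram_downwards = bij_diagram_downwards[OF bij_betw_id, folded id_diagram_eq]

lemma id_diagram_edge: "s \<in> S \<Longrightarrow> {Inl s, Inr s} \<in> id_diagram S"
  by (auto simp: id_diagram_def)

lemma diagram_comp_id_left:
  assumes \<alpha>: "\<alpha> \<in> brauer_diagrams S T" and fin: "finite S" "finite T"
  shows "diagram_comp S T (id_diagram T) \<alpha> = \<alpha>"
proof (rule diagram_comp_eqI[OF \<alpha> id_diagram_in \<alpha>])
  let ?R = "stacked (id_diagram T) \<alpha>"
  have up: "(Inr (Inl t), Inr (Inr t)) \<in> ?R" if "t \<in> T" for t
    using that by (intro stacked_edges id_diagram_edge)
  show "(Inl s, Inr (Inr u)) \<in> ?R" if e: "{Inl s, Inr u} \<in> \<alpha>" for s u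
    using stacked_trans[OF stacked_edges(2)[OF e] up] brauer_edge_in[OF \<alpha>] e by blast
  show "(Inr (Inr u), Inr (Inr u')) \<in> ?R" if e: "{Inr u, Inr u'} \<in> \<alpha>" for u u'
    using stacked_trans[OF stacked_trans[OF stacked_sym[OF up] stacked_edges(3)[OF e]] up]
      brauer_edge_in[OF \<alpha>] e by blast
qed (use fin in \<open>auto intro: stacked_edges\<close>)

lemma diagram_comp_id_right:
  assumes \<alpha>: "\<alpha> \<in> brauer_diagrams S T" and fin: "finite S" "finite T"
  shows "diagram_comp S T \<alpha> (id_diagram S) = \<alpha>"
proof (rule diagram_comp_eqI[OF id_diagram_in \<alpha> \<alpha>])
  let ?R = "stacked \<alpha> (id_diagram S)"
  have up: "(Inl s, Inr (Inl s)) \<in> ?R" if "s \<in> S" for s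
    using that by (intro stacked_edges id_diagram_edge)
  show "(Inl s, Inr (Inr u)) \<in> ?R" if e: "{Inl s, Inr u} \<in> \<alpha>" for s u
    using stacked_trans[OF up stacked_edges(5)[OF e]] brauer_edge_in[OF \<alpha>] e by blast
  show "(Inl s, Inl s') \<in> ?R" if e: "{Inl s, Inl s'} \<in> \<alpha>" for s s'
    using stacked_trans[OF stacked_trans[OF up stacked_edges(4)[OF e]] stacked_sym[OF up]]
      brauer_edge_in[OF \<alpha>] e by blast
qed (use fin in \<open>auto intro: stacked_edges\<close>)

text \<open>The diagram turned upside down; for the diagram of a bijection this is the
  inverse.\<close>

definition flip_diagram :: "'a diagram \<Rightarrow> 'a diagram" where
  "flip_diagram \<alpha> = (`) (case_sum Inr Inl) ` \<alpha>"

lemma flip_edge: "{x, y} \<in> \<alpha> \<Longrightarrow> {case_sum Inr Inl x, case_sum Inr Inl y} \<in> flip_diagram \<alpha>"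
  unfolding flip_diagram_def by (rule image_eqI[of _ _ "{x, y}"]) auto

lemma flip_edge': "{Inl s, Inr t} \<in> \<alpha> \<Longrightarrow> {Inl t, Inr s} \<in> flip_diagram \<alpha>"
  using flip_edge[of "Inl s" "Inr t" \<alpha>] by (simp add: insert_commute)

lemma flip_diagram_in:
  assumes "\<alpha> \<in> brauer_diagrams S T"
  shows "flip_diagram \<alpha> \<in> brauer_diagrams T S"
proof -
  have "inj (case_sum Inr Inl :: 'a + 'a \<Rightarrow> 'a + 'a)"
    by (auto simp: inj_def split: sum.splits)
  moreover have "case_sum Inr Inl ` (Inl ` S \<union> Inr ` T) = Inl ` T \<union> Inr ` S"
    by (auto simp: image_Un image_image)
  ultimately show ?thesis
    using perfect_matching_image_iff[of "case_sum Inr Inl" "Inl ` S \<union> Inr ` T" \<alpha>] assms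
    by (simp add: brauer_diagrams_iff flip_diagram_def)
qed

lemma flip_diagram_upwards: "\<alpha> \<in> downwards_diagrams S T \<Longrightarrow> flip_diagram \<alpha> \<in> upwards_diagrams T S"
  and flip_diagram_downwards: "\<alpha> \<in> upwards_diagrams S T \<Longrightarrow> flip_diagram \<alpha> \<in> downwards_diagrams T S"
  unfolding downwards_diagrams_iff upwards_diagrams_iff by (meson flip_diagram_in flip_edge')+

lemma diagram_comp_flip:
  assumes \<alpha>: "\<alpha> \<in> upwards_diagrams S T" and fin: "finite S" "finite T"
  shows "diagram_comp S S (flip_diagram \<alpha>) \<alpha> = id_diagram S"
proof (rule diagram_comp_eqI)
  show \<alpha>': "\<alpha> \<in> brauer_diagrams S T" using \<alpha> upwards_diagrams_subset by blast
  then show "flip_diagram \<alpha> \<in> brauer_diagrams T S" by (rule flip_diagram_in)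
  fix s u assume "{Inl s, Inr u} \<in> id_diagram S"
  then have s: "s \<in> S" "u = s" by (auto simp: id_diagram_eq bij_diagram_edges)
  then obtain t where t: "{Inl s, Inr t} \<in> \<alpha>" using upwards_diagrams_ex[OF \<alpha>] by blast
  show "(Inl s, Inr (Inr u)) \<in> stacked (flip_diagram \<alpha>) \<alpha>"
    using stacked_trans[OF stacked_edges(2)[OF t] stacked_edges(5)[OF flip_edge'[OF t]]] s(2) by simp
qed (use fin id_diagram_in in \<open>auto simp: id_diagram_eq bij_diagram_edges\<close>)

text \<open>The vertical edges define an injection from \<open>S\<close> to \<open>T\<close>. For
  equal finite cardinalities it is onto, which is why upwards and downwards endomorphisms
  agree.\<close>

lemma upwards_imp_card_le:
  assumes \<alpha>: "\<alpha> \<in> upwards_diagrams S T" and "finite T"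
  shows "card S \<le> card T"
    and "finite S \<Longrightarrow> card S = card T \<Longrightarrow> \<alpha> \<in> downwards_diagrams S T"
proof -
  have \<alpha>': "\<alpha> \<in> brauer_diagrams S T" using \<alpha> upwards_diagrams_subset by blast
  obtain f where f: "\<And>s. s \<in> S \<Longrightarrow> f s \<in> T \<and> {Inl s, Inr (f s)} \<in> \<alpha>"
    using upwards_diagrams_ex[OF \<alpha>] by metis
  have inj: "inj_on f S"
    using f brauer_edge_unique'[OF \<alpha>'] by (metis Inl_inject inj_onI)
  then show "card S \<le> card T" using f \<open>finite T\<close> by (intro card_inj_on_le[of f]) auto
  assume S: "finite S" "card S = card T"
  have "f ` S = T"
    using f inj S \<open>finite T\<close> by (intro card_subset_eq) (auto simp: card_image)
  then show "\<alpha> \<in> downwards_diagrams S T"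
    using \<alpha>' f unfolding downwards_diagrams_iff by blast
qed

lemma downwards_imp_card_le:
  assumes \<alpha>: "\<alpha> \<in> downwards_diagrams S T" and "finite S"
  shows "card T \<le> card S"
    and "finite T \<Longrightarrow> card S = card T \<Longrightarrow> \<alpha> \<in> upwards_diagrams S T"
proof -
  have \<alpha>': "\<alpha> \<in> brauer_diagrams S T" using \<alpha> downwards_diagrams_subset by blast
  obtain f where f: "\<And>t. t \<in> T \<Longrightarrow> f t \<in> S \<and> {Inl (f t), Inr t} \<in> \<alpha>"
    using downwards_diagrams_ex[OF \<alpha>] by metis
  have inj: "inj_on f T"
    using f brauer_edge_unique[OF \<alpha>'] by (metis Inr_inject inj_onI)
  then show "card T \<le> card S" using f \<open>finite S\<close> by (intro card_inj_on_le[of f]) auto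
  assume T: "finite T" "card S = card T"
  have "f ` T = S"
    using f inj T \<open>finite S\<close> by (intro card_subset_eq) (auto simp: card_image)
  then show "\<alpha> \<in> upwards_diagrams S T"
    using \<alpha>' f unfolding upwards_diagrams_iff by blast
qed

lemma upwards_eq_downwards:
  "finite S \<Longrightarrow> finite T \<Longrightarrow> card S = card T \<Longrightarrow> upwards_diagrams S T = downwards_diagrams S T"
  using upwards_imp_card_le(2) downwards_imp_card_le(2) by blast

text \<open>In a factorization of the identity through \<open>T\<close> every strand passes through \<open>T\<close>.\<close>

lemma factor_id_card_le:
  assumes \<alpha>: "\<alpha> \<in> brauer_diagrams S T" and fin: "finite T"
    and id: "diagram_comp S S \<beta> \<alpha> = id_diagram S"
  shows "card S \<le> card T"
proof -
  \<comment> \<open>The only way out of the bottom layer is an edge of \<open>\<alpha>\<close> into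
    \<open>T\<close>, so a path starting there stays in it or has met \<open>T\<close>.\<close>
  have through: "v \<in> range Inl \<or> (\<exists>t\<in>T. (Inl s, Inr (Inl t)) \<in> stacked \<beta> \<alpha>)"
    if "(Inl s, v) \<in> stacked \<beta> \<alpha>" for s v
    using that unfolding stacked_def
  proof (induction rule: joined_induct)
    case (step y z)
    show ?case
    proof (cases "y \<in> range Inl")
      case True
      then have "{y, z} \<notin> (`) Inr ` \<beta>" by auto
      then obtain e where e: "e \<in> \<alpha>" "{y, z} = map_sum id Inl ` e"
        using step(2) unfolding stack_ends_image by blast
      then obtain w where w: "w \<in> e" "z = map_sum id Inl w" by (metis imageE insertCI)
      then have "w \<in> Inl ` S \<union> Inr ` T"
        using e \<alpha> perfect_matching_Union unfolding brauer_diagrams_iff by blast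
      then have "z \<in> range Inl \<or> (\<exists>t\<in>T. z = Inr (Inl t))" using w by auto
      then show ?thesis
        using joined_trans[OF step(1) joined_edge[OF step(2)]] by blast
    qed (use step in blast)
  qed simp
  have "\<exists>t\<in>T. (Inl s, Inr (Inl t)) \<in> stacked \<beta> \<alpha>" if s: "s \<in> S" for s
  proof -
    have "{Inl s, Inr s} \<in> diagram_comp S S \<beta> \<alpha>" using s id id_diagram_edge by metis
    then have "(Inl s, Inr (Inr s)) \<in> stacked \<beta> \<alpha>" unfolding diagram_comp_edge_iff by simp
    then show ?thesis using through by blast
  qed
  then obtain f where f: "\<And>s. s \<in> S \<Longrightarrow> f s \<in> T \<and> (Inl s, Inr (Inl (f s))) \<in> stacked \<beta> \<alpha>"
    by metis
  \<comment> \<open>Two strands through the same point of \<open>T\<close> would join two bottom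
    vertices, but the identity has no horizontal edge.\<close>
  have "inj_on f S"
  proof (rule inj_onI, rule ccontr)
    fix s s' assume s: "s \<in> S" "s' \<in> S" "f s = f s'" "s \<noteq> s'"
    then have "(Inl s, Inl s') \<in> stacked \<beta> \<alpha>"
      using f[of s] f[of s'] stacked_trans stacked_sym by metis
    then have "{Inl s, Inl s'} \<in> diagram_comp S S \<beta> \<alpha>" using s by (intro diagram_comp_edgesI)
    then show False by (simp add: id id_diagram_eq bij_diagram_edges)
  qed
  then show ?thesis using f fin by (intro card_inj_on_le[of f]) auto
qed

text \<open>Each vertical edge of \<open>\<gamma>\<close> is cut at the point of \<open>Y\<close>
  that \<open>h\<close> assigns to its bottom end; the lower halves go to \<open>d\<close> and the
  upper halves to \<open>u\<close>. Horizontal edges stay in the factor on their own side.\<close>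

lemma factor_exists:
  assumes \<gamma>: "\<gamma> \<in> brauer_diagrams S U"
    and h: "bij_betw h Y {s \<in> S. \<exists>u. {Inl s, Inr u} \<in> \<gamma>}"
    and fin: "finite S" "finite Y" "finite U"
  obtains u d where "u \<in> upwards_diagrams Y U" "d \<in> downwards_diagrams S Y"
    "diagram_comp S U u d = \<gamma>"
proof -
  define d where "d = {e \<in> \<gamma>. e \<subseteq> Inl ` S} \<union> {{Inl (h y), Inr y} | y. y \<in> Y}"
  define u where "u = {e \<in> \<gamma>. e \<subseteq> Inr ` U} \<union> {{Inl y, Inr v} | y v. y \<in> Y \<and> {Inl (h y), Inr v} \<in> \<gamma>}"
  have h_inj: "y = y'" if "h y = h y'" "y \<in> Y" "y' \<in> Y" for y y'
    using h that by (meson bij_betw_imp_inj_on inj_onD)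
  have h_vert: "h y \<in> S" "\<exists>v. {Inl (h y), Inr v} \<in> \<gamma>" if "y \<in> Y" for y
    using bij_betwE[OF h] that by auto
  have h_surj: "\<exists>y\<in>Y. s = h y" if "s \<in> S" "{Inl s, Inr v} \<in> \<gamma>" for s v
    using h that by (auto simp: bij_betw_def image_iff set_eq_iff)
  note in\<gamma> = brauer_edge_in[OF \<gamma>]
  have d_edges: "{Inl s, Inl s'} \<in> d \<longleftrightarrow> {Inl s, Inl s'} \<in> \<gamma>"
    "{Inl s, Inr y} \<in> d \<longleftrightarrow> y \<in> Y \<and> s = h y" "{Inr y, Inl s} \<in> d \<longleftrightarrow> y \<in> Y \<and> s = h y"
    "{Inr y, Inr y'} \<notin> d" for s s' y y'
    using in\<gamma>(1,2) by (auto simp: d_def doubleton_eq_iff)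
  have u_edges: "{Inr v, Inr v'} \<in> u \<longleftrightarrow> {Inr v, Inr v'} \<in> \<gamma>"
    "{Inl y, Inr v} \<in> u \<longleftrightarrow> y \<in> Y \<and> {Inl (h y), Inr v} \<in> \<gamma>"
    "{Inr v, Inl y} \<in> u \<longleftrightarrow> y \<in> Y \<and> {Inl (h y), Inr v} \<in> \<gamma>"
    "{Inl y, Inl y'} \<notin> u" for v v' y y'
    using in\<gamma>(3,4) by (auto simp: u_def doubleton_eq_iff)
  note unique = brauer_edge_unique[OF \<gamma>] brauer_edge_unique'[OF \<gamma>]
  have pair: "\<exists>v w. e = {v, w} \<and> v \<noteq> w" if "e \<in> \<gamma>" for e
    using that \<gamma> by (auto simp: brauer_diagrams_def card_2_iff)
  have "d \<in> brauer_diagrams S Y"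
    unfolding brauer_diagrams_iff
  proof (rule perfect_matchingI)
    fix v :: "'a + 'a" assume v: "v \<in> Inl ` S \<union> Inr ` Y"
    show "\<exists>w. {v, w} \<in> d"
    proof (cases v)
      case (Inl s)
      then have "s \<in> S" using v by auto
      from \<gamma> this show ?thesis
        by (cases rule: brauer_Inl_cases) (use Inl d_edges h_surj \<open>s \<in> S\<close> in blast)+
    next
      case (Inr y)
      then have "{v, Inl (h y)} \<in> d" using v d_edges(3) by auto
      then show ?thesis ..
    qed
  next
    fix e assume "e \<in> d"
    then consider "e \<in> \<gamma>" "e \<subseteq> Inl ` S" | y where "y \<in> Y" "e = {Inl (h y), Inr y}"
      by (auto simp: d_def)
    then show "\<exists>v w. e = {v, w} \<and> v \<noteq> w \<and> v \<in> Inl ` S \<union> Inr ` Y \<and> w \<in> Inl ` S \<union> Inr ` Y"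
    proof cases
      case 1
      then obtain v w where "e = {v, w}" "v \<noteq> w" using pair by blast
      then show ?thesis using 1(2) by (intro exI[of _ v] exI[of _ w]) auto
    next
      case 2
      then show ?thesis using h_vert(1) by blast
    qed
  next
    fix v w w' assume *: "{v, w} \<in> d" "{v, w'} \<in> d"
    have vert: False if "{Inl (h y), Inl s} \<in> \<gamma>" "y \<in> Y" for y s
      using h_vert(2)[OF that(2)] unique(1)[OF that(1)] by blast
    show "w = w'"
      using * unique(1)[of v w w'] vert h_inj by (cases v; cases w; cases w') (auto simp: d_edges)
  qed
  then have d: "d \<in> downwards_diagrams S Y"
    using h_vert(1) d_edges(2) unfolding downwards_diagrams_iff by blast
  have "u \<in> brauer_diagrams Y U"
    unfolding brauer_diagrams_iff
  proof (rule perfect_matchingI)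
    fix v :: "'a + 'a" assume v: "v \<in> Inl ` Y \<union> Inr ` U"
    show "\<exists>w. {v, w} \<in> u"
    proof (cases v)
      case (Inl y)
      then have "y \<in> Y" using v by auto
      then show ?thesis using Inl h_vert u_edges(2) by blast
    next
      case (Inr x)
      then have "x \<in> U" using v by auto
      from \<gamma> this show ?thesis
      proof (cases rule: brauer_Inr_cases)
        case (vertical s)
        then show ?thesis using Inr u_edges(3) h_surj by blast
      qed (use Inr u_edges in blast)
    qed
  next
    fix e assume "e \<in> u"
    then consider "e \<in> \<gamma>" "e \<subseteq> Inr ` U" | y v where "y \<in> Y" "e = {Inl y, Inr v}" "{Inl (h y), Inr v} \<in> \<gamma>"
      by (auto simp: u_def)
    then show "\<exists>v w. e = {v, w} \<and> v \<noteq> w \<and> v \<in> Inl ` Y \<union> Inr ` U \<and> w \<in> Inl ` Y \<union> Inr ` U"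
    proof cases
      case 1
      then obtain v w where "e = {v, w}" "v \<noteq> w" using pair by blast
      then show ?thesis using 1(2) by (intro exI[of _ v] exI[of _ w]) auto
    next
      case 2
      then show ?thesis using in\<gamma>(4) by blast
    qed
  next
    fix v w w' assume *: "{v, w} \<in> u" "{v, w'} \<in> u"
    have vert: False if "{Inl s, Inr x} \<in> \<gamma>" "{Inr x, Inr x'} \<in> \<gamma>" for s x x'
      using unique(2)[of "Inl s" "Inr x" "Inr x'"] that by (simp add: insert_commute)
    show "w = w'"
    proof (cases v)
      case (Inl y)
      then show ?thesis
        using * unique(1)[of "Inl (h y)"] by (cases w; cases w') (auto simp: u_edges)
    next
      case (Inr x)
      have "b = b'" if "{Inr x, Inr b} \<in> \<gamma>" "{Inr x, Inr b'} \<in> \<gamma>" for b b'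
        using unique(1)[OF that] by simp
      moreover have "y = y'"
        if "{Inl (h y), Inr x} \<in> \<gamma>" "{Inl (h y'), Inr x} \<in> \<gamma>" "y \<in> Y" "y' \<in> Y" for y y'
        using unique(2)[OF that(1,2)] h_inj that(3,4) by simp
      ultimately show ?thesis
        using * vert Inr by (cases w; cases w') (auto simp: u_edges)
    qed
  qed
  then have u: "u \<in> upwards_diagrams Y U"
    using h_vert(2) u_edges(2) in\<gamma>(4) unfolding upwards_diagrams_iff by blast
  have "diagram_comp S U u d = \<gamma>"
  proof (rule diagram_comp_eqI[OF _ _ \<gamma> fin])
    show "d \<in> brauer_diagrams S Y" "u \<in> brauer_diagrams Y U" by fact+
    show "(Inl s, Inl s') \<in> stacked u d" if "{Inl s, Inl s'} \<in> \<gamma>" for s s'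
      using that by (intro stacked_edges) (simp add: d_edges)
    show "(Inr (Inr v), Inr (Inr v')) \<in> stacked u d" if "{Inr v, Inr v'} \<in> \<gamma>" for v v'
      using that by (intro stacked_edges) (simp add: u_edges)
    show "(Inl s, Inr (Inr v)) \<in> stacked u d" if e: "{Inl s, Inr v} \<in> \<gamma>" for s v
    proof -
      obtain y where "y \<in> Y" "s = h y" using h_surj in\<gamma>(1) e by blast
      then have "(Inl s, Inr (Inl y)) \<in> stacked u d" "(Inr (Inl y), Inr (Inr v)) \<in> stacked u d"
        using e d_edges(2) u_edges(2) stacked_edges(2)[of s y d] stacked_edges(5)[of y v u] by auto
      then show ?thesis by (rule stacked_trans)
    qed
  qed
  then show thesis using that u d by blast
qed

section \<open>Uniqueness of the factorization up to a bijection\<close>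

context
  fixes S U Y Y' :: "'a set" and u u' d d' :: "'a diagram"
  assumes u: "u \<in> upwards_diagrams Y U" and d: "d \<in> downwards_diagrams S Y"
    and u': "u' \<in> upwards_diagrams Y' U" and d': "d' \<in> downwards_diagrams S Y'"
    and eq: "diagram_comp S U u d = diagram_comp S U u' d'"
    and fin: "finite S" "finite Y" "finite Y'" "finite U"
begin

lemma factors_in:
  "u \<in> brauer_diagrams Y U" "d \<in> brauer_diagrams S Y" "diagram_comp S U u d \<in> brauer_diagrams S U"
  using u d upwards_diagrams_subset downwards_diagrams_subset diagram_comp_in fin by blast+

text \<open>Partners in the composite are unique, so these three shapes of edges determine the
  factors up to the naming of the points in between.\<close>

lemma factor_comp_edges:
  "{Inl s, Inl s'} \<in> d \<Longrightarrow> {Inl s, Inl s'} \<in> diagram_comp S U u d"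
  "{Inr v, Inr v'} \<in> u \<Longrightarrow> {Inr v, Inr v'} \<in> diagram_comp S U u d"
  "{Inl s, Inr t} \<in> d \<Longrightarrow> {Inl t, Inr v} \<in> u \<Longrightarrow> {Inl s, Inr v} \<in> diagram_comp S U u d"
proof -
  note in_u = brauer_edge_in[OF factors_in(1)] and in_d = brauer_edge_in[OF factors_in(2)]
  show "{Inl s, Inl s'} \<in> diagram_comp S U u d" if e: "{Inl s, Inl s'} \<in> d"
    using brauer_edge_neq[OF factors_in(2) e] in_d(1,2)[OF e]
    by (intro diagram_comp_edgesI(1) stacked_edges(1)[OF e]) auto
  show "{Inr v, Inr v'} \<in> diagram_comp S U u d" if e: "{Inr v, Inr v'} \<in> u"
    using brauer_edge_neq[OF factors_in(1) e] in_u(3,4)[OF e]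
    by (intro diagram_comp_edgesI(3) stacked_edges(6)[OF e]) auto
  show "{Inl s, Inr v} \<in> diagram_comp S U u d" if e: "{Inl s, Inr t} \<in> d" "{Inl t, Inr v} \<in> u"
    by (intro diagram_comp_edgesI(2) stacked_trans[OF stacked_edges(2)[OF e(1)] stacked_edges(5)[OF e(2)]]
        in_d(1)[OF e(1)] in_u(4)[OF e(2)])
qed

end

text \<open>The bottom ends of vertical edges are the same for \<open>d\<close> and
  \<open>d'\<close>, since the common composite shows them. The bijection \<open>h\<close> matches
  the points of \<open>Y'\<close> and \<open>Y\<close> that lie on the strand of the same bottom
  vertex.\<close>

lemma factor_unique:
  assumes u: "u \<in> upwards_diagrams Y U" and d: "d \<in> downwards_diagrams S Y"
    and u': "u' \<in> upwards_diagrams Y' U" and d': "d' \<in> downwards_diagrams S Y'"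
    and eq: "diagram_comp S U u d = diagram_comp S U u' d'"
    and fin: "finite S" "finite Y" "finite Y'" "finite U"
  obtains h where "bij_betw h Y' Y" "diagram_comp S Y (bij_diagram h Y') d' = d"
    "diagram_comp Y' U u (bij_diagram h Y') = u'"
proof -
  define \<gamma> where "\<gamma> = diagram_comp S U u d"
  note in_u = factors_in(1)[OF u d u' d' eq fin] and in_d = factors_in(2)[OF u d u' d' eq fin]
    and in_u' = factors_in(1)[OF u' d' u d eq[symmetric] fin(1,3,2,4)]
    and in_d' = factors_in(2)[OF u' d' u d eq[symmetric] fin(1,3,2,4)]
    and in_\<gamma> = factors_in(3)[OF u d u' d' eq fin, folded \<gamma>_def]
  note \<gamma>_edges = factor_comp_edges[OF u d u' d' eq fin, folded \<gamma>_def]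
    and \<gamma>_edges' = factor_comp_edges[OF u' d' u d eq[symmetric] fin(1,3,2,4), folded eq, folded \<gamma>_def]
  have vert: "\<exists>v. {Inl t, Inr v} \<in> u" if "t \<in> Y" for t
    using upwards_diagrams_ex[OF u] that by blast
  have vert': "\<exists>v. {Inl t, Inr v} \<in> u'" if "t \<in> Y'" for t
    using upwards_diagrams_ex[OF u'] that by blast
  \<comment> \<open>A vertical edge of \<open>d'\<close> at \<open>s\<close> continues through
    \<open>u'\<close> to a vertical edge of the composite. A horizontal edge of \<open>d\<close> at
    \<open>s\<close> would survive in the same composite, so \<open>s\<close> is vertical in
    \<open>d\<close> too.\<close>
  have ex: "\<exists>t\<in>Y. {Inl s, Inr t} \<in> d" if st: "{Inl s, Inr t'} \<in> d'" for s t'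
  proof -
    have "s \<in> S" "t' \<in> Y'" using st brauer_edge_in[OF in_d'] by blast+
    then obtain v where "{Inl s, Inr v} \<in> \<gamma>" using vert' \<gamma>_edges'(3) st by blast
    then have "{Inl s, Inl s'} \<notin> d" for s'
      using brauer_edge_unique[OF in_\<gamma>] \<gamma>_edges(1) by blast
    then show ?thesis using brauer_Inl_cases[OF in_d \<open>s \<in> S\<close>] by metis
  qed
  have ex': "\<exists>t\<in>Y'. {Inl s, Inr t} \<in> d'" if st: "{Inl s, Inr t'} \<in> d" for s t'
  proof -
    have "s \<in> S" "t' \<in> Y" using st brauer_edge_in[OF in_d] by blast+
    then obtain v where "{Inl s, Inr v} \<in> \<gamma>" using vert \<gamma>_edges(3) st by blast
    then have "{Inl s, Inl s'} \<notin> d'" for s'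
      using brauer_edge_unique[OF in_\<gamma>] \<gamma>_edges'(1) by blast
    then show ?thesis using brauer_Inl_cases[OF in_d' \<open>s \<in> S\<close>] by metis
  qed
  have "\<forall>t'\<in>Y'. \<exists>t. t \<in> Y \<and> (\<exists>s. {Inl s, Inr t'} \<in> d' \<and> {Inl s, Inr t} \<in> d)"
    using ex downwards_diagrams_ex[OF d'] by meson
  then obtain h where h: "\<And>t'. t' \<in> Y' \<Longrightarrow> h t' \<in> Y \<and> (\<exists>s. {Inl s, Inr t'} \<in> d' \<and> {Inl s, Inr (h t')} \<in> d)"
    by metis
  have h_eq: "h t' = t" if "{Inl s, Inr t'} \<in> d'" "{Inl s, Inr t} \<in> d" for s t t'
  proof -
    have "t' \<in> Y'" using that brauer_edge_in[OF in_d'] by blast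
    then obtain s' where s': "{Inl s', Inr t'} \<in> d'" "{Inl s', Inr (h t')} \<in> d" using h by blast
    have "s' = s" using brauer_edge_unique'[OF in_d' s'(1) that(1)] by simp
    then show ?thesis using brauer_edge_unique[OF in_d s'(2), of "Inr t"] that by simp
  qed
  have bij: "bij_betw h Y' Y"
    unfolding bij_betw_def
  proof (intro conjI inj_onI equalityI subsetI)
    fix t t' assume t: "t \<in> Y'" "t' \<in> Y'" "h t = h t'"
    then obtain s s' where s: "{Inl s, Inr t} \<in> d'" "{Inl s', Inr t'} \<in> d'"
      "{Inl s, Inr (h t)} \<in> d" "{Inl s', Inr (h t)} \<in> d" using h by metis
    have "s = s'" using brauer_edge_unique'[OF in_d s(3,4)] by simp
    then show "t = t'" using brauer_edge_unique[OF in_d' s(1), of "Inr t'"] s(2) by simp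
  next
    fix t assume "t \<in> Y"
    then obtain s where s: "{Inl s, Inr t} \<in> d" using downwards_diagrams_ex[OF d] by blast
    then obtain t' where "t' \<in> Y'" "{Inl s, Inr t'} \<in> d'" using ex' by blast
    then show "t \<in> h ` Y'" using h_eq s by blast
  qed (use h in auto)
  let ?\<sigma> = "bij_diagram h Y'"
  have \<sigma>: "{Inl t', Inr (h t')} \<in> ?\<sigma>" if "t' \<in> Y'" for t'
    using that by (simp add: bij_diagram_edges)
  have "diagram_comp S Y ?\<sigma> d' = d"
  proof (rule diagram_comp_eqI[OF in_d' bij_diagram_in[OF bij] in_d fin(1,3,2)])
    fix s s' assume e: "{Inl s, Inl s'} \<in> d"
    have "s \<in> S" using e brauer_edge_in[OF in_d] by blast
    from in_d' this have "{Inl s, Inl s'} \<in> d'"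
    proof (cases rule: brauer_Inl_cases)
      case (horizontal s'')
      then show ?thesis
        using brauer_edge_unique[OF in_\<gamma> \<gamma>_edges(1)[OF e] \<gamma>_edges'(1)] by metis
    next
      case (vertical t)
      then show ?thesis using ex brauer_edge_unique[OF in_d e] by blast
    qed
    then show "(Inl s, Inl s') \<in> stacked ?\<sigma> d'" by (rule stacked_edges)
  next
    fix s t assume e: "{Inl s, Inr t} \<in> d"
    then obtain t' where t': "t' \<in> Y'" "{Inl s, Inr t'} \<in> d'" using ex' by blast
    then have "t = h t'" using h_eq e by simp
    then show "(Inl s, Inr (Inr t)) \<in> stacked ?\<sigma> d'"
      using stacked_trans[OF stacked_edges(2)[OF t'(2)] stacked_edges(5)[OF \<sigma>[OF t'(1)]]] by simp
  next
    fix t t' assume e: "{Inr t, Inr t'} \<in> d"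
    then have "t \<in> Y" using brauer_edge_in[OF in_d] by blast
    then obtain s where "{Inl s, Inr t} \<in> d" using downwards_diagrams_ex[OF d] by blast
    then show "(Inr (Inr t), Inr (Inr t')) \<in> stacked ?\<sigma> d'"
      using brauer_edge_unique'[OF in_d, of "Inl s" "Inr t" "Inr t'"] e by (simp add: insert_commute)
  qed
  moreover have "diagram_comp Y' U u ?\<sigma> = u'"
  proof (rule diagram_comp_eqI[OF bij_diagram_in[OF bij] in_u in_u' fin(3,2,4)])
    fix t t' assume e: "{Inl t, Inl t'} \<in> u'"
    then have "t \<in> Y'" using brauer_edge_in[OF in_u'] by blast
    then obtain v where "{Inl t, Inr v} \<in> u'" using vert' by blast
    then show "(Inl t, Inl t') \<in> stacked u ?\<sigma>"
      using brauer_edge_unique[OF in_u' e] by blast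
  next
    fix t' v assume e: "{Inl t', Inr v} \<in> u'"
    then have t': "t' \<in> Y'" using brauer_edge_in[OF in_u'] by blast
    then obtain s where s: "{Inl s, Inr t'} \<in> d'" "{Inl s, Inr (h t')} \<in> d" "h t' \<in> Y" using h by blast
    obtain w where w: "{Inl (h t'), Inr w} \<in> u" using vert s(3) by blast
    \<comment> \<open>Both routes from the bottom vertex \<open>s\<close> end at the partner of
      \<open>s\<close> in the common composite.\<close>
    have "{Inl s, Inr v} \<in> \<gamma>" "{Inl s, Inr w} \<in> \<gamma>" using \<gamma>_edges'(3)[OF s(1) e] \<gamma>_edges(3)[OF s(2) w] .
    then have "v = w" using brauer_edge_unique[OF in_\<gamma>] by blast
    then show "(Inl t', Inr (Inr v)) \<in> stacked u ?\<sigma>"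
      using stacked_trans[OF stacked_edges(2)[OF \<sigma>[OF t']] stacked_edges(5)[OF w]] by simp
  next
    fix v v' assume e: "{Inr v, Inr v'} \<in> u'"
    have "v \<in> U" using e brauer_edge_in[OF in_u'] by blast
    from in_u this have "{Inr v, Inr v'} \<in> u"
    proof (cases rule: brauer_Inr_cases)
      case (horizontal v'')
      then show ?thesis
        using brauer_edge_unique[OF in_\<gamma> \<gamma>_edges'(2)[OF e] \<gamma>_edges(2)] by metis
    next
      case (vertical t)
      then obtain s where "{Inl s, Inr t} \<in> d" using downwards_diagrams_ex[OF d] by blast
      then have "{Inl s, Inr v} \<in> \<gamma>" using \<gamma>_edges(3) vertical by blast
      then show ?thesis
        using brauer_edge_unique'[OF in_\<gamma>, of "Inl s" "Inr v" "Inr v'"] \<gamma>_edges'(2)[OF e]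
        by (simp add: insert_commute)
    qed
    then show "(Inr (Inr v), Inr (Inr v')) \<in> stacked u ?\<sigma>" by (rule stacked_edges)
  qed
  ultimately show thesis using that bij by blast
qed

section \<open>Linear categories and tensor products\<close>

context linear_category
begin

lemma ring_End_ring:
  assumes H: "wide_subcategory H" and x: "x \<in> Ob"
  shows "ring (End_ring H x)"
proof -
  have sub: "subspace (H x x)" "H x x \<subseteq> Hom x x" "ident x \<in> H x x"
    and comp: "\<And>f g. f \<in> H x x \<Longrightarrow> g \<in> H x x \<Longrightarrow> Comp x x x g f \<in> H x x"
    using H x unfolding wide_subcategory_def by blast+
  have in_Hom: "f \<in> Hom x x" if "f \<in> H x x" for f using sub that by blast
  note closed = subspace_add[OF sub(1)] subspace_0[OF sub(1)] subspace_neg[OF sub(1)]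
  show ?thesis
  proof (rule ringI)
    show "abelian_group (End_ring H x)"
    proof (rule abelian_groupI)
      show "\<exists>g\<in>carrier (End_ring H x). g \<oplus>\<^bsub>End_ring H x\<^esub> f = \<zero>\<^bsub>End_ring H x\<^esub>"
        if "f \<in> carrier (End_ring H x)" for f
        using that closed by (auto simp: End_ring_def intro!: bexI[of _ "- f"])
    qed (use closed in \<open>auto simp: End_ring_def algebra_simps\<close>)
    show "monoid (End_ring H x)"
      by (rule monoidI)
        (use x sub comp in \<open>auto simp: End_ring_def in_Hom Comp_assoc Comp_ident_left Comp_ident_right\<close>)
  qed (use x in \<open>auto simp: End_ring_def in_Hom Comp_add_left Comp_add_right\<close>)
qed

lemma left_ideal_End_ringI:
  assumes H: "wide_subcategory H" and x: "x \<in> Ob"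
    and J: "subspace J" "J \<subseteq> H x x" "\<And>a v. a \<in> H x x \<Longrightarrow> v \<in> J \<Longrightarrow> Comp x x x a v \<in> J"
  shows "left_ideal J (End_ring H x)"
proof -
  interpret ring "End_ring H x" by (rule ring_End_ring[OF H x])
  have "subgroup J (add_monoid (End_ring H x))"
  proof (rule add.subgroupI)
    fix f assume f: "f \<in> J"
    then have "- f \<in> J" using subspace_neg[OF J(1)] by blast
    have "\<ominus>\<^bsub>End_ring H x\<^esub> f = - f"
      by (rule minus_equality) (use f \<open>- f \<in> J\<close> J(2) in \<open>auto simp: End_ring_def\<close>)
    then show "\<ominus>\<^bsub>End_ring H x\<^esub> f \<in> J" using \<open>- f \<in> J\<close> by simp
  next
    show "J \<noteq> {}" using subspace_0[OF J(1)] by blast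
  qed (use J subspace_add[OF J(1)] in \<open>auto simp: End_ring_def\<close>)
  then show ?thesis
    using J(3) by (auto simp: left_ideal_def End_ring_def intro: additive_subgroupI)
qed

text \<open>Scaling by \<open>c\<close> is composition with \<open>scale c (ident x)\<close>, so a
  left ideal, though required only to be an additive subgroup, is a subspace. This makes linear
  projections available for Maschke's theorem.\<close>

lemma left_ideal_End_ring_subspace:
  assumes H: "wide_subcategory H" and x: "x \<in> Ob" and I: "left_ideal I (End_ring H x)"
  shows "subspace I" "I \<subseteq> H x x" "\<And>a v. a \<in> H x x \<Longrightarrow> v \<in> I \<Longrightarrow> Comp x x x a v \<in> I"
proof -
  have sub: "subspace (H x x)" "H x x \<subseteq> Hom x x" "ident x \<in> H x x"
    using H x unfolding wide_subcategory_def by blast+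
  interpret I: additive_subgroup I "End_ring H x" using I by (simp add: left_ideal_def)
  show IH: "I \<subseteq> H x x" using I.a_subset by (simp add: End_ring_def)
  show comp: "Comp x x x a v \<in> I" if "a \<in> H x x" "v \<in> I" for a v
    using I that by (auto simp: left_ideal_def End_ring_def)
  show "subspace I"
  proof (rule subspaceI)
    show "0 \<in> I" using I.zero_closed by (simp add: End_ring_def)
    show "f + g \<in> I" if "f \<in> I" "g \<in> I" for f g
      using I.a_closed[OF that] by (simp add: End_ring_def)
    fix c f assume f: "f \<in> I"
    then have "Comp x x x (scale c (ident x)) f \<in> I"
      using subspace_scale[OF sub(1,3)] comp by blast
    moreover have "f \<in> Hom x x" using f IH sub by blast
    ultimately show "scale c f \<in> I"
      using x sub by (simp add: Comp_scale_left Comp_ident_left subset_iff)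
  qed
qed

end

section \<open>Tensor products by generators and relations\<close>

locale tensor_data =
  fixes R :: "'r set" and M :: "'m::ab_group_add set" and N :: "'n::ab_group_add set"
    and ra :: "'m \<Rightarrow> 'r \<Rightarrow> 'm" and la :: "'r \<Rightarrow> 'n \<Rightarrow> 'n"
  assumes M_add: "m \<in> M \<Longrightarrow> m' \<in> M \<Longrightarrow> m + m' \<in> M" and M_zero: "0 \<in> M"
    and N_add: "n \<in> N \<Longrightarrow> n' \<in> N \<Longrightarrow> n + n' \<in> N"
    and ra_in: "m \<in> M \<Longrightarrow> r \<in> R \<Longrightarrow> ra m r \<in> M"
    and la_in: "r \<in> R \<Longrightarrow> n \<in> N \<Longrightarrow> la r n \<in> N"
begin

abbreviation (input) "F \<equiv> free_Abelian_group (M \<times> N)"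
abbreviation (input) "K \<equiv> tensor_kernel R M N ra la"

lemma keys_relators:
  assumes "a \<in> tensor_relators R M N ra la"
  shows "Poly_Mapping.keys a \<subseteq> M \<times> N"
proof -
  have 3: "Poly_Mapping.keys (frag_of p - frag_of q - frag_of r) \<subseteq> M \<times> N"
    if "p \<in> M \<times> N" "q \<in> M \<times> N" "r \<in> M \<times> N" for p q r
    using that keys_diff[of "frag_of p - frag_of q" "frag_of r"] keys_diff[of "frag_of p" "frag_of q"]
    by (auto simp: keys_frag_of)
  have 2: "Poly_Mapping.keys (frag_of p - frag_of q) \<subseteq> M \<times> N"
    if "p \<in> M \<times> N" "q \<in> M \<times> N" for p q
    using that keys_diff[of "frag_of p" "frag_of q"] by (auto simp: keys_frag_of)
  show ?thesis
    using assms unfolding tensor_relators_def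
    by (elim UnE CollectE exE conjE; hypsubst; intro 2 3) (simp_all add: M_add N_add ra_in la_in)
qed

lemma subgroup_K: "subgroup K F"
  unfolding tensor_kernel_def
  by (rule group.generate_is_subgroup) (auto dest: keys_relators)

lemma K_zero: "0 \<in> K"
  using subgroup.one_closed[OF subgroup_K] by simp

lemma K_add: "a \<in> K \<Longrightarrow> b \<in> K \<Longrightarrow> a + b \<in> K"
  using subgroup.m_closed[OF subgroup_K] by simp

lemma keys_K: "a \<in> K \<Longrightarrow> Poly_Mapping.keys a \<subseteq> M \<times> N"
  using subgroup.mem_carrier[OF subgroup_K, of a] by (simp only: carrier_free_Abelian_group_iff)

lemma K_minus: "a \<in> K \<Longrightarrow> - a \<in> K"
  using subgroup.m_inv_closed[OF subgroup_K, of a] keys_K by simp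

lemma K_diff: "a \<in> K \<Longrightarrow> b \<in> K \<Longrightarrow> a - b \<in> K"
  using K_add[of a "- b"] K_minus by simp

lemma K_trans: "a - b \<in> K \<Longrightarrow> b - c \<in> K \<Longrightarrow> a - c \<in> K"
  using K_add[of "a - b" "b - c"] by simp

lemma K_sym: "a - b \<in> K \<Longrightarrow> b - a \<in> K"
  using K_minus[of "a - b"] by simp

lemma K_sum: "(\<And>i. i \<in> A \<Longrightarrow> f i \<in> K) \<Longrightarrow> sum f A \<in> K"
  by (induction A rule: infinite_finite_induct) (auto simp: K_zero K_add)

lemma relator_in_K: "a \<in> tensor_relators R M N ra la \<Longrightarrow> a \<in> K"
  unfolding tensor_kernel_def by (rule generate.incl)

lemma K_add_left:
  "m \<in> M \<Longrightarrow> m' \<in> M \<Longrightarrow> n \<in> N \<Longrightarrow> frag_of (m + m', n) - frag_of (m, n) - frag_of (m', n) \<in> K"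
  by (rule relator_in_K) (auto simp: tensor_relators_def)

lemma K_add_right:
  "m \<in> M \<Longrightarrow> n \<in> N \<Longrightarrow> n' \<in> N \<Longrightarrow> frag_of (m, n + n') - frag_of (m, n) - frag_of (m, n') \<in> K"
  by (rule relator_in_K) (auto simp: tensor_relators_def)

lemma K_balance: "m \<in> M \<Longrightarrow> r \<in> R \<Longrightarrow> n \<in> N \<Longrightarrow> frag_of (ra m r, n) - frag_of (m, la r n) \<in> K"
  by (rule relator_in_K) (auto simp: tensor_relators_def)

text \<open>The additivity relator with both left entries \<open>0\<close> is
  \<open>- frag_of (0, n)\<close>. In the free group itself \<open>frag_of (0, n)\<close> is a
  generator and not zero.\<close>

lemma K_zero_left: "n \<in> N \<Longrightarrow> frag_of (0, n) \<in> K"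
  using K_minus[OF K_add_left[OF M_zero M_zero]] by simp

lemma K_zero_right: "m \<in> M \<Longrightarrow> 0 \<in> N \<Longrightarrow> frag_of (m, 0) \<in> K"
  using K_minus[OF K_add_right[of m 0 0]] by simp

text \<open>The first isomorphism theorem: \<open>rel\<close> and \<open>ker\<close> together say
  that the kernel of \<open>h\<close> is exactly the subgroup generated by the relators.\<close>

lemma tensor_group_map:
  assumes G: "group G" and h: "h \<in> hom F G"
    and rel: "\<And>a. a \<in> tensor_relators R M N ra la \<Longrightarrow> h a = \<one>\<^bsub>G\<^esub>"
    and ker: "\<And>a. Poly_Mapping.keys a \<subseteq> M \<times> N \<Longrightarrow> h a = \<one>\<^bsub>G\<^esub> \<Longrightarrow> a \<in> K"
  obtains \<Phi> where "\<Phi> \<in> hom (tensor_group R M N ra la) G"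
    "inj_on \<Phi> (carrier (tensor_group R M N ra la))"
    "\<Phi> ` carrier (tensor_group R M N ra la) = h ` carrier F"
    "\<And>m n. m \<in> M \<Longrightarrow> n \<in> N \<Longrightarrow> \<Phi> (pure_tensor R M N ra la m n) = h (frag_of (m, n))"
proof -
  interpret G: group G by (rule G)
  interpret group_hom F G h
    using G h by (simp add: group_hom_def group_hom_axioms_def)
  have K_eq: "K = kernel F G h"
  proof
    show "K \<subseteq> kernel F G h"
      unfolding tensor_kernel_def
      by (rule group.generate_subgroup_incl[OF _ _ subgroup_kernel])
        (auto simp: kernel_def rel dest: keys_relators)
    show "kernel F G h \<subseteq> K" using ker by (auto simp: kernel_def)
  qed
  \<comment> \<open>The map \<open>h\<close> is constant on a coset of its kernel, so its image of
    the coset is a singleton.\<close>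
  define \<Phi> where "\<Phi> X = the_elem (h ` X)" for X
  have coset: "\<Phi> (K #>\<^bsub>F\<^esub> g) = h g" if g: "g \<in> carrier F" for g
  proof -
    have "h (a + g) = h g" if "a \<in> K" for a
      using that hom_mult[of a g] g unfolding K_eq by (simp add: kernel_def)
    then have "h ` (K #>\<^bsub>F\<^esub> g) = {h g}"
      using K_zero by (auto simp: r_coset_def)
    then show ?thesis by (simp add: \<Phi>_def)
  qed
  show thesis
  proof
    show "\<Phi> \<in> hom (tensor_group R M N ra la) G"
      unfolding \<Phi>_def tensor_group_def K_eq by (rule FactGroup_hom)
    show "inj_on \<Phi> (carrier (tensor_group R M N ra la))"
      unfolding \<Phi>_def tensor_group_def K_eq by (rule FactGroup_inj_on)
    show "\<Phi> ` carrier (tensor_group R M N ra la) = h ` carrier F"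
      unfolding tensor_group_def carrier_FactGroup image_image by (rule image_cong) (auto simp: coset)
    show "\<Phi> (pure_tensor R M N ra la m n) = h (frag_of (m, n))" if "m \<in> M" "n \<in> N" for m n
      unfolding pure_tensor_def using that by (intro coset) simp
  qed
qed

lemma group_tensor_group: "group (tensor_group R M N ra la)"
  unfolding tensor_group_def
  by (intro normal.factorgroup_is_group comm_group.subgroup_imp_normal subgroup_K
      abelian_free_Abelian_group)

lemma pure_tensor_in: "m \<in> M \<Longrightarrow> n \<in> N \<Longrightarrow> pure_tensor R M N ra la m n \<in> carrier (tensor_group R M N ra la)"
  unfolding pure_tensor_def tensor_group_def carrier_FactGroup by (rule imageI) simp

end

section \<open>The Brauer category\<close>

lemma flip_flip: "flip_diagram (flip_diagram \<alpha>) = \<alpha>"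
proof -
  have "case_sum Inr Inl (case_sum Inr Inl v) = v" for v :: "'a + 'a" by (cases v) auto
  then show ?thesis by (simp add: flip_diagram_def image_image)
qed

lemma brauer_objects_iff: "S \<in> brauer_objects \<longleftrightarrow> finite S"
  by (simp add: brauer_objects_def)

lemma lookup_vec_scale: "Poly_Mapping.lookup (vec_scale c f) k = c * Poly_Mapping.lookup f k"
  by (simp add: vec_scale_def map.rep_eq when_def)

interpretation vec: vector_space vec_scale
  by unfold_locales
    (simp_all add: poly_mapping_eq_iff fun_eq_iff lookup_vec_scale lookup_add algebra_simps)

lemma vec_sum_expansion:
  fixes f :: "'a brauer_vec"
  shows "(\<Sum>\<alpha>\<in>Poly_Mapping.keys f. vec_scale (Poly_Mapping.lookup f \<alpha>) (diagram_vec \<alpha>)) = f"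
proof (rule poly_mapping_eqI)
  fix k
  have "(\<Sum>\<alpha>\<in>Poly_Mapping.keys f. Poly_Mapping.lookup f \<alpha> * (if \<alpha> = k then 1 else 0)) =
      Poly_Mapping.lookup f k"
    by (simp add: sum.delta' if_distrib[where f = "(*) _"] in_keys_iff cong: if_cong)
  then show "Poly_Mapping.lookup (\<Sum>\<alpha>\<in>Poly_Mapping.keys f. vec_scale (Poly_Mapping.lookup f \<alpha>)
      (diagram_vec \<alpha>)) k = Poly_Mapping.lookup f k"
    by (simp add: lookup_sum lookup_vec_scale diagram_vec_def lookup_single when_def)
qed

abbreviation (input) vecs :: "'a set \<Rightarrow> ('a \<Rightarrow>\<^sub>0 complex) set" where
  "vecs X \<equiv> {f. Poly_Mapping.keys f \<subseteq> X}"

lemma subspace_keys: "vec.subspace (vecs X)"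
proof (rule vec.subspaceI)
  show "f + g \<in> vecs X"
    if "f \<in> vecs X" "g \<in> vecs X" for f g
    using that keys_add[of f g] by auto
  show "vec_scale c f \<in> vecs X"
    if "f \<in> vecs X" for c f
    using that by (auto simp: in_keys_iff lookup_vec_scale subset_iff)
qed simp

lemma keys_diagram_vec [simp]: "Poly_Mapping.keys (diagram_vec \<alpha>) = {\<alpha>}"
  by (simp add: diagram_vec_def)

lemma span_diagram_vec:
  fixes X :: "'a diagram set"
  shows "vec.span (diagram_vec ` X) = vecs X"
proof
  show "vec.span (diagram_vec ` X) \<subseteq> vecs X"
    by (rule vec.span_minimal[OF _ subspace_keys]) auto
  show "vecs X \<subseteq> vec.span (diagram_vec ` X)"
  proof
    fix f :: "'a brauer_vec" assume "f \<in> vecs X"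
    then have "(\<Sum>\<alpha>\<in>Poly_Mapping.keys f. vec_scale (Poly_Mapping.lookup f \<alpha>) (diagram_vec \<alpha>))
        \<in> vec.span (diagram_vec ` X)"
      by (intro vec.span_sum vec.span_scale vec.span_base) auto
    then show "f \<in> vec.span (diagram_vec ` X)" by (simp add: vec_sum_expansion)
  qed
qed

lemma brauer_U_eq: "brauer_U S T = vecs (upwards_diagrams S T)"
  and brauer_D_eq: "brauer_D S T = vecs (downwards_diagrams S T)"
  by (simp_all add: brauer_U_def brauer_D_def span_diagram_vec)

lemma vec_induct [consumes 1, case_names zero add scale]:
  assumes "Poly_Mapping.keys f \<subseteq> X" and 0: "R 0"
    and add: "\<And>f g. Poly_Mapping.keys f \<subseteq> X \<Longrightarrow> Poly_Mapping.keys g \<subseteq> X \<Longrightarrow> R f \<Longrightarrow> R g \<Longrightarrow> R (f + g)"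
    and scale: "\<And>c \<alpha>. \<alpha> \<in> X \<Longrightarrow> R (vec_scale c (diagram_vec \<alpha>))"
  shows "R f"
proof -
  let ?g = "\<lambda>A. \<Sum>\<alpha>\<in>A. vec_scale (Poly_Mapping.lookup f \<alpha>) (diagram_vec \<alpha>)"
  have term_in: "vec_scale (Poly_Mapping.lookup f \<alpha>) (diagram_vec \<alpha>) \<in> vecs X"
    if "\<alpha> \<in> X" for \<alpha>
    using that by (intro vec.subspace_scale[OF subspace_keys]) auto
  \<comment> \<open>Membership in \<open>vecs X\<close> is carried along because \<open>add\<close>
    applies only to vectors supported in \<open>X\<close>.\<close>
  have "A \<subseteq> X \<Longrightarrow> R (?g A) \<and> ?g A \<in> vecs X" if "finite A" for A
    using that
  proof (induction A)
    case empty
    then show ?case using 0 by simp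
  next
    case (insert \<alpha> A)
    then show ?case
      using add[of "vec_scale (Poly_Mapping.lookup f \<alpha>) (diagram_vec \<alpha>)" "?g A"] scale[of \<alpha>]
        term_in[of \<alpha>] vec.subspace_add[OF subspace_keys, of _ X "?g A"] by simp
  qed
  from this[of "Poly_Mapping.keys f"] assms(1) show ?thesis by (simp add: vec_sum_expansion)
qed

section \<open>Bilinear composition with a parameter\<close>

context
  fixes \<delta> :: complex
begin

text \<open>The defining sums run over the supports, which change under addition and scaling. Fixed
  finite index sets make bilinearity a computation with coefficients.\<close>

lemma brauer_Comp_expand:
  assumes "finite X" "finite Y" "Poly_Mapping.keys g \<subseteq> X" "Poly_Mapping.keys f \<subseteq> Y"
  shows "brauer_Comp \<delta> S T U g f =
     (\<Sum>\<beta>\<in>X. \<Sum>\<alpha>\<in>Y. vec_scale (Poly_Mapping.lookup g \<beta> * Poly_Mapping.lookup f \<alpha> * \<delta> ^ loop_count \<beta> \<alpha>)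
        (diagram_vec (diagram_comp S U \<beta> \<alpha>)))"
proof -
  have "(\<Sum>\<alpha>\<in>Poly_Mapping.keys f. vec_scale (Poly_Mapping.lookup g \<beta> * Poly_Mapping.lookup f \<alpha> * \<delta> ^ loop_count \<beta> \<alpha>)
        (diagram_vec (diagram_comp S U \<beta> \<alpha>))) =
    (\<Sum>\<alpha>\<in>Y. vec_scale (Poly_Mapping.lookup g \<beta> * Poly_Mapping.lookup f \<alpha> * \<delta> ^ loop_count \<beta> \<alpha>)
        (diagram_vec (diagram_comp S U \<beta> \<alpha>)))" for \<beta>
    using assms by (intro sum.mono_neutral_left) (auto simp: in_keys_iff)
  then show ?thesis
    unfolding brauer_Comp_def
    using assms by (simp add: in_keys_iff) (intro sum.mono_neutral_left; auto simp: in_keys_iff)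
qed

lemma brauer_Comp_add_left:
  "brauer_Comp \<delta> S T U (g + g') f = brauer_Comp \<delta> S T U g f + brauer_Comp \<delta> S T U g' f"
proof -
  let ?X = "Poly_Mapping.keys g \<union> Poly_Mapping.keys g'" and ?Y = "Poly_Mapping.keys f"
  show ?thesis
    using keys_add[of g g']
    by (simp add: brauer_Comp_expand[of ?X ?Y] lookup_add distrib_right vec.scale_left_distrib
        sum.distrib)
qed

lemma brauer_Comp_add_right:
  "brauer_Comp \<delta> S T U g (f + f') = brauer_Comp \<delta> S T U g f + brauer_Comp \<delta> S T U g f'"
proof -
  let ?X = "Poly_Mapping.keys g" and ?Y = "Poly_Mapping.keys f \<union> Poly_Mapping.keys f'"
  show ?thesis
    using keys_add[of f f']
    by (simp add: brauer_Comp_expand[of ?X ?Y] lookup_add distrib_right distrib_left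
        vec.scale_left_distrib sum.distrib)
qed

lemma brauer_Comp_scale_left:
  "brauer_Comp \<delta> S T U (vec_scale a g) f = vec_scale a (brauer_Comp \<delta> S T U g f)"
proof -
  let ?X = "Poly_Mapping.keys g" and ?Y = "Poly_Mapping.keys f"
  have "Poly_Mapping.keys (vec_scale a g) \<subseteq> ?X" by (auto simp: in_keys_iff lookup_vec_scale)
  then show ?thesis
    by (simp add: brauer_Comp_expand[of ?X ?Y] lookup_vec_scale vec.scale_sum_right mult.assoc)
qed

lemma brauer_Comp_scale_right:
  "brauer_Comp \<delta> S T U g (vec_scale a f) = vec_scale a (brauer_Comp \<delta> S T U g f)"
proof -
  let ?X = "Poly_Mapping.keys g" and ?Y = "Poly_Mapping.keys f"
  have "Poly_Mapping.keys (vec_scale a f) \<subseteq> ?Y" by (auto simp: in_keys_iff lookup_vec_scale)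
  then show ?thesis
    by (simp add: brauer_Comp_expand[of ?X ?Y] lookup_vec_scale vec.scale_sum_right mult_ac)
qed

lemma brauer_Comp_zero [simp]: "brauer_Comp \<delta> S T U 0 f = 0" "brauer_Comp \<delta> S T U g 0 = 0"
  by (simp_all add: brauer_Comp_def)

lemma brauer_Comp_basis [simp]:
  "brauer_Comp \<delta> S T U (diagram_vec \<beta>) (diagram_vec \<alpha>) =
     vec_scale (\<delta> ^ loop_count \<beta> \<alpha>) (diagram_vec (diagram_comp S U \<beta> \<alpha>))"
  by (simp add: brauer_Comp_def) (simp add: diagram_vec_def)

lemma brauer_Comp_keys:
  assumes "\<And>\<alpha> \<beta>. \<alpha> \<in> Poly_Mapping.keys f \<Longrightarrow> \<beta> \<in> Poly_Mapping.keys g \<Longrightarrow> diagram_comp S U \<beta> \<alpha> \<in> Z"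
  shows "Poly_Mapping.keys (brauer_Comp \<delta> S T U g f) \<subseteq> Z"
proof -
  have "brauer_Comp \<delta> S T U g f \<in> vecs Z"
    unfolding brauer_Comp_def
    using assms by (intro vec.subspace_sum[OF subspace_keys] vec.subspace_scale[OF subspace_keys]) auto
  then show ?thesis by simp
qed

text \<open>Trilinearity reduces one factor at a time to a diagram. For three diagrams the
  composites agree, and so do the exponents of \<open>\<delta>\<close>, each being the total number
  of loops of the triple stack.\<close>

lemma brauer_Comp_assoc:
  assumes fin: "finite S" "finite T" "finite U" "finite V"
    and f: "f \<in> brauer_Hom S T" and g: "g \<in> brauer_Hom T U" and h: "h \<in> brauer_Hom U V"
  shows "brauer_Comp \<delta> S U V h (brauer_Comp \<delta> S T U g f) =
    brauer_Comp \<delta> S T V (brauer_Comp \<delta> T U V h g) f"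
proof -
  note bilinear = brauer_Comp_add_left brauer_Comp_add_right brauer_Comp_scale_left
    brauer_Comp_scale_right
  have assoc: "diagram_comp S V \<gamma> (diagram_comp S U \<beta> \<alpha>) = diagram_comp S V (diagram_comp T V \<gamma> \<beta>) \<alpha>"
    and loops: "\<delta> ^ loop_count \<beta> \<alpha> * \<delta> ^ loop_count \<gamma> (diagram_comp S U \<beta> \<alpha>) =
      \<delta> ^ loop_count \<gamma> \<beta> * \<delta> ^ loop_count (diagram_comp T V \<gamma> \<beta>) \<alpha>"
    if "\<alpha> \<in> brauer_diagrams S T" "\<beta> \<in> brauer_diagrams T U" "\<gamma> \<in> brauer_diagrams U V" for \<alpha> \<beta> \<gamma>
    using loop_count_assoc[OF that fin] diagram_comp_assoc[OF that fin]
    by (simp_all flip: power_add)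
  have basis: "brauer_Comp \<delta> S U V h (brauer_Comp \<delta> S T U (diagram_vec \<beta>) (diagram_vec \<alpha>)) =
      brauer_Comp \<delta> S T V (brauer_Comp \<delta> T U V h (diagram_vec \<beta>)) (diagram_vec \<alpha>)"
    if \<alpha>: "\<alpha> \<in> brauer_diagrams S T" and \<beta>: "\<beta> \<in> brauer_diagrams T U" for \<alpha> \<beta>
    using h unfolding brauer_Hom_def mem_Collect_eq
  proof (induction h rule: vec_induct)
    case (add h h')
    then show ?case by (simp only: brauer_Comp_add_left)
  next
    case (scale c \<gamma>)
    show ?case using assoc[OF \<alpha> \<beta> scale] loops[OF \<alpha> \<beta> scale] by (simp add: bilinear)
  qed simp
  have basis': "brauer_Comp \<delta> S U V h (brauer_Comp \<delta> S T U g (diagram_vec \<alpha>)) =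
      brauer_Comp \<delta> S T V (brauer_Comp \<delta> T U V h g) (diagram_vec \<alpha>)"
    if \<alpha>: "\<alpha> \<in> brauer_diagrams S T" for \<alpha>
    using g unfolding brauer_Hom_def mem_Collect_eq
  proof (induction g rule: vec_induct)
    case (add g g')
    then show ?case by (simp only: brauer_Comp_add_left brauer_Comp_add_right)
  next
    case (scale c \<beta>)
    show ?case
      by (simp only: brauer_Comp_scale_left brauer_Comp_scale_right basis[OF \<alpha> scale])
  qed simp
  show ?thesis
    using f unfolding brauer_Hom_def mem_Collect_eq
  proof (induction f rule: vec_induct)
    case (add f f')
    then show ?case by (simp only: brauer_Comp_add_right)
  next
    case (scale c \<alpha>)
    show ?case
      by (simp only: brauer_Comp_scale_right basis'[OF scale])
  qed simp
qed

lemma brauer_Comp_ident_left: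
  assumes "finite S" "finite T" "f \<in> brauer_Hom S T"
  shows "brauer_Comp \<delta> S T T (brauer_ident T) f = f"
proof -
  have "Poly_Mapping.keys f \<subseteq> brauer_diagrams S T" using assms by (simp add: brauer_Hom_def)
  then show ?thesis
    by (induction f rule: vec_induct)
      (use assms in \<open>simp_all add: brauer_ident_def brauer_Comp_add_right brauer_Comp_scale_right
        diagram_comp_id_left loop_count_upwards[OF _ id_diagram_upwards]\<close>)
qed

lemma brauer_Comp_ident_right:
  assumes "finite S" "finite T" "f \<in> brauer_Hom S T"
  shows "brauer_Comp \<delta> S S T f (brauer_ident S) = f"
proof -
  have "Poly_Mapping.keys f \<subseteq> brauer_diagrams S T" using assms by (simp add: brauer_Hom_def)
  then show ?thesis
    by (induction f rule: vec_induct)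
      (use assms in \<open>simp_all add: brauer_ident_def brauer_Comp_add_left brauer_Comp_scale_left
        diagram_comp_id_right loop_count_downwards[OF id_diagram_downwards]\<close>)
qed

lemma brauer_linear_category:
  "linear_category vec_scale brauer_objects brauer_Hom brauer_ident (brauer_Comp \<delta>)"
proof unfold_locales
  fix x y z w :: "'a set" and f f' g g' h
  assume x: "x \<in> brauer_objects"
  show "brauer_ident x \<in> brauer_Hom x x"
    by (simp add: brauer_ident_def brauer_Hom_def id_diagram_in)
  assume y: "y \<in> brauer_objects"
  show "vec.subspace (brauer_Hom x y)"
    unfolding brauer_Hom_def by (rule subspace_keys)
  show "f \<in> brauer_Hom x y \<Longrightarrow> brauer_Comp \<delta> x y y (brauer_ident y) f = f"
    "f \<in> brauer_Hom x y \<Longrightarrow> brauer_Comp \<delta> x x y f (brauer_ident x) = f"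
    using x y brauer_Comp_ident_left brauer_Comp_ident_right by (auto simp: brauer_objects_iff)
  assume z: "z \<in> brauer_objects"
  show "brauer_Comp \<delta> x y z g f \<in> brauer_Hom x z" if "f \<in> brauer_Hom x y" "g \<in> brauer_Hom y z"
    using that x y z unfolding brauer_Hom_def brauer_objects_iff
    by (auto intro!: brauer_Comp_keys diagram_comp_in[of _ x y _ z])
qed (auto simp: brauer_Comp_assoc brauer_objects_iff brauer_Comp_add_left brauer_Comp_add_right
    brauer_Comp_scale_left brauer_Comp_scale_right)

interpretation brauer: linear_category vec_scale brauer_objects brauer_Hom brauer_ident "brauer_Comp \<delta>"
  by (rule brauer_linear_category)

section \<open>Isomorphism classes are cardinalities: smallness, wide subcategories and
  order\<close>

lemma brauer_isomorphic_iff: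
  assumes fin: "finite S" "finite T"
  shows "brauer.isomorphic S T \<longleftrightarrow> card S = card T"
proof
  assume "brauer.isomorphic S T"
  then obtain f g where fg: "f \<in> brauer_Hom S T" "g \<in> brauer_Hom T S"
      "brauer_Comp \<delta> S T S g f = brauer_ident S" "brauer_Comp \<delta> T S T f g = brauer_ident T"
    unfolding brauer.isomorphic_def by blast
  \<comment> \<open>The morphisms are linear combinations, but the identity diagram must occur in
    their composite. Hence some pair of diagrams from the two supports composes to it, and its
    strands can be counted.\<close>
  have le: "card S \<le> card T" if "finite T" "f \<in> brauer_Hom S T" "brauer_Comp \<delta> S T S g f = brauer_ident S"
    for S T :: "'a set" and f g
  proof -
    have "Poly_Mapping.keys (brauer_ident S) \<subseteq>
        (\<lambda>(\<beta>, \<alpha>). diagram_comp S S \<beta> \<alpha>) ` (Poly_Mapping.keys g \<times> Poly_Mapping.keys f)"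
      unfolding that(3)[symmetric] by (rule brauer_Comp_keys) auto
    then obtain \<alpha> \<beta> where "\<alpha> \<in> Poly_Mapping.keys f" "diagram_comp S S \<beta> \<alpha> = id_diagram S"
      by (auto simp: brauer_ident_def)
    then show ?thesis using that factor_id_card_le[of \<alpha> S T \<beta>] by (auto simp: brauer_Hom_def)
  qed
  show "card S = card T"
    using le[OF fin(2) fg(1,3)] le[OF fin(1) fg(2,4)] by simp
next
  assume "card S = card T"
  then obtain h where h: "bij_betw h S T" using fin finite_same_card_bij by blast
  define \<alpha> where "\<alpha> = bij_diagram h S"
  have \<alpha>: "\<alpha> \<in> upwards_diagrams S T" "\<alpha> \<in> downwards_diagrams S T"
    unfolding \<alpha>_def using h bij_diagram_upwards bij_diagram_downwards by blast+
  note \<alpha>' = flip_diagram_upwards[OF \<alpha>(2)] flip_diagram_downwards[OF \<alpha>(1)]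
  have in_Hom: "diagram_vec \<alpha> \<in> brauer_Hom S T" "diagram_vec (flip_diagram \<alpha>) \<in> brauer_Hom T S"
    using \<alpha> \<alpha>' upwards_diagrams_subset by (auto simp: brauer_Hom_def)
  have "diagram_comp S S (flip_diagram \<alpha>) \<alpha> = id_diagram S"
    "diagram_comp T T \<alpha> (flip_diagram \<alpha>) = id_diagram T"
    using diagram_comp_flip[OF \<alpha>(1)] diagram_comp_flip[OF \<alpha>'(1)] fin by (simp_all add: flip_flip)
  moreover have "loop_count (flip_diagram \<alpha>) \<alpha> = 0" "loop_count \<alpha> (flip_diagram \<alpha>) = 0"
    using loop_count_downwards[OF \<alpha>(2)] loop_count_downwards[OF \<alpha>'(2)] \<alpha> \<alpha>' fin
      upwards_diagrams_subset by blast+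
  ultimately show "brauer.isomorphic S T"
    unfolding brauer.isomorphic_def brauer_ident_def
    by (intro bexI[OF _ in_Hom(1)] bexI[OF _ in_Hom(2)]) simp
qed

lemma brauer_iso_class: "finite S \<Longrightarrow> brauer.iso_class S = {T. finite T \<and> card T = card S}"
  by (auto simp: brauer.iso_class_def brauer_objects_iff brauer_isomorphic_iff)

lemma brauer_iso_class_eq_iff:
  "finite S \<Longrightarrow> finite T \<Longrightarrow> brauer.iso_class S = brauer.iso_class T \<longleftrightarrow> card S = card T"
  by (auto simp: brauer_iso_class)

lemma brauer_iso_classes: "brauer.iso_classes = brauer.iso_class ` {S. finite S}"
proof -
  have "brauer_objects = {S. finite S}" by (auto simp: brauer_objects_iff)
  then show ?thesis unfolding brauer.iso_classes_def by (rule arg_cong)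
qed

lemma brauer_rep:
  assumes "c \<in> brauer.iso_classes" "S \<in> c"
  shows "finite S" "c = brauer.iso_class S"
  using assms by (auto simp: brauer_iso_classes brauer_iso_class)

lemma brauer_essentially_small: "brauer.essentially_small TYPE('a) TYPE(nat)"
  unfolding brauer.essentially_small_def
proof (intro exI inj_onI)
  fix b c :: "'a set set" assume bc: "b \<in> brauer.iso_classes" "c \<in> brauer.iso_classes"
    \<comment> \<open>Classes are encoded by the cardinality of a chosen member, which determines
      the class.\<close>
    and eq: "card (SOME S. S \<in> b) = card (SOME S. S \<in> c)"
  have "\<exists>S. S \<in> b" "\<exists>S. S \<in> c"
    using bc by (auto simp: brauer_iso_classes brauer_iso_class)
  then have "(SOME S. S \<in> b) \<in> b" "(SOME S. S \<in> c) \<in> c"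
    using someI_ex[of "\<lambda>S. S \<in> b"] someI_ex[of "\<lambda>S. S \<in> c"] by blast+
  then show "b = c"
    using brauer_rep[OF bc(1)] brauer_rep[OF bc(2)] eq brauer_iso_class_eq_iff by metis
qed

lemma brauer_finite_dimensional: "brauer.finite_dimensional_Homs TYPE('a)"
  unfolding brauer.finite_dimensional_Homs_def
proof (intro ballI)
  fix S T :: "'a set" assume "S \<in> brauer_objects" "T \<in> brauer_objects"
  then show "\<exists>B. finite B \<and> B \<subseteq> brauer_Hom S T \<and> vec.span B = brauer_Hom S T"
    by (intro exI[of _ "diagram_vec ` brauer_diagrams S T"])
      (auto simp: brauer_objects_iff finite_brauer_diagrams span_diagram_vec brauer_Hom_def)
qed

lemma brauer_wide_U: "brauer.wide_subcategory brauer_U"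
  unfolding brauer.wide_subcategory_def
proof (intro conjI ballI)
  fix x y z :: "'a set" and f g assume x: "x \<in> brauer_objects"
  show "brauer_ident x \<in> brauer_U x x"
    by (simp add: brauer_U_eq brauer_ident_def id_diagram_upwards)
  assume y: "y \<in> brauer_objects"
  show "vec.subspace (brauer_U x y)" "brauer_U x y \<subseteq> brauer_Hom x y"
    using subspace_keys upwards_diagrams_subset[of x y] by (auto simp: brauer_U_eq brauer_Hom_def)
  assume "z \<in> brauer_objects" "f \<in> brauer_U x y" "g \<in> brauer_U y z"
  then show "brauer_Comp \<delta> x y z g f \<in> brauer_U x z"
    using x y unfolding brauer_U_eq brauer_objects_iff
    by (auto intro!: brauer_Comp_keys upwards_diagram_comp[of _ x y _ z])
qed

lemma brauer_wide_D: "brauer.wide_subcategory brauer_D"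
  unfolding brauer.wide_subcategory_def
proof (intro conjI ballI)
  fix x y z :: "'a set" and f g assume x: "x \<in> brauer_objects"
  show "brauer_ident x \<in> brauer_D x x"
    by (simp add: brauer_D_eq brauer_ident_def id_diagram_downwards)
  assume y: "y \<in> brauer_objects"
  show "vec.subspace (brauer_D x y)" "brauer_D x y \<subseteq> brauer_Hom x y"
    using subspace_keys downwards_diagrams_subset[of x y] by (auto simp: brauer_D_eq brauer_Hom_def)
  assume "z \<in> brauer_objects" "f \<in> brauer_D x y" "g \<in> brauer_D y z"
  then show "brauer_Comp \<delta> x y z g f \<in> brauer_D x z"
    using x y unfolding brauer_D_eq brauer_objects_iff
    by (auto intro!: brauer_Comp_keys downwards_diagram_comp[of _ x y _ z])
qed

lemma brauer_order:
  "\<exists>ord. partial_order_on brauer.iso_classes ord \<and>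
     (\<forall>c\<in>brauer.iso_classes. finite {b \<in> brauer.iso_classes. (b, c) \<in> ord}) \<and>
     brauer.upwards ord brauer_U \<and> brauer.downwards ord brauer_D"
proof (intro exI conjI ballI)
  \<comment> \<open>The order of the cardinalities, expressed through representatives; the next fact
    shows that their choice does not matter.\<close>
  define ord :: "('a set set \<times> 'a set set) set"
    where "ord = {(brauer.iso_class S, brauer.iso_class T) | S T. finite S \<and> finite T \<and> card S \<le> card T}"
  have ord_iff: "(brauer.iso_class S, brauer.iso_class T) \<in> ord \<longleftrightarrow> card S \<le> card T"
    if "finite S" "finite T" for S T
  proof
    assume "(brauer.iso_class S, brauer.iso_class T) \<in> ord"
    then obtain S' T' where *: "brauer.iso_class S = brauer.iso_class S'"
        "brauer.iso_class T = brauer.iso_class T'" "finite S'" "finite T'" "card S' \<le> card T'"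
      unfolding ord_def by blast
    then show "card S \<le> card T" using brauer_iso_class_eq_iff that by metis
  qed (use that in \<open>auto simp: ord_def\<close>)
  show "partial_order_on brauer.iso_classes ord"
    unfolding partial_order_on_def preorder_on_def
  proof (intro conjI)
    show "ord \<subseteq> brauer.iso_classes \<times> brauer.iso_classes" by (auto simp: ord_def brauer_iso_classes)
    show "refl_on brauer.iso_classes ord" by (auto simp: refl_on_def brauer_iso_classes ord_iff)
    show "trans ord"
    proof (rule transI)
      fix a b c assume "(a, b) \<in> ord" "(b, c) \<in> ord"
      moreover from this obtain S T U where "a = brauer.iso_class S" "b = brauer.iso_class T"
          "c = brauer.iso_class U" "finite S" "finite T" "finite U"
        unfolding ord_def by blast
      ultimately show "(a, c) \<in> ord" using ord_iff by simp
    qed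
    show "antisym ord"
    proof (rule antisymI)
      fix a b assume ab: "(a, b) \<in> ord" "(b, a) \<in> ord"
      from ab(1) obtain S T where "a = brauer.iso_class S" "b = brauer.iso_class T" "finite S" "finite T"
        unfolding ord_def by blast
      then show "a = b" using ab by (simp add: ord_iff brauer_iso_class_eq_iff)
    qed
  qed
  show "finite {b \<in> brauer.iso_classes. (b, c) \<in> ord}" if c: "c \<in> brauer.iso_classes" for c
  proof -
    obtain T where T: "finite T" "c = brauer.iso_class T" using c by (auto simp: brauer_iso_classes)
    \<comment> \<open>A class below that of \<open>T\<close> consists of all finite sets of one
      cardinality, which is at most \<open>card T\<close>.\<close>
    have "{b \<in> brauer.iso_classes. (b, c) \<in> ord} \<subseteq> (\<lambda>n. {S. finite S \<and> card S = n}) ` {..card T}"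
    proof
      fix b assume b: "b \<in> {b \<in> brauer.iso_classes. (b, c) \<in> ord}"
      then obtain S where S: "finite S" "b = brauer.iso_class S" by (auto simp: brauer_iso_classes)
      then have "card S \<le> card T" using b T ord_iff by simp
      then show "b \<in> (\<lambda>n. {S. finite S \<and> card S = n}) ` {..card T}"
        unfolding S(2) brauer_iso_class[OF S(1)] by blast
    qed
    then show ?thesis by (rule finite_subset) simp
  qed
  have nonzero: "Poly_Mapping.keys f \<noteq> {}" if "f \<noteq> 0" for f :: "'a brauer_vec"
    using that by simp
  show "brauer.upwards ord brauer_U"
    unfolding brauer.upwards_def
  proof (intro ballI impI)
    fix S T :: "'a set" assume "S \<in> brauer_objects" "T \<in> brauer_objects" "\<exists>f\<in>brauer_U S T. f \<noteq> 0"
    then obtain \<alpha> where "\<alpha> \<in> upwards_diagrams S T" "finite S" "finite T"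
      using nonzero by (fastforce simp: brauer_U_eq brauer_objects_iff)
    then show "(brauer.iso_class S, brauer.iso_class T) \<in> ord"
      using ord_iff upwards_imp_card_le(1) by blast
  qed
  show "brauer.downwards ord brauer_D"
    unfolding brauer.downwards_def
  proof (intro ballI impI)
    fix S T :: "'a set" assume "S \<in> brauer_objects" "T \<in> brauer_objects" "\<exists>f\<in>brauer_D S T. f \<noteq> 0"
    then obtain \<alpha> where "\<alpha> \<in> downwards_diagrams S T" "finite S" "finite T"
      using nonzero by (fastforce simp: brauer_D_eq brauer_objects_iff)
    then show "(brauer.iso_class T, brauer.iso_class S) \<in> ord"
      using ord_iff downwards_imp_card_le(1) by blast
  qed
qed

section \<open>Semisimplicity of the endomorphism rings\<close>

lemma brauer_End_eq: "finite S \<Longrightarrow> brauer.End_ring brauer_U S = brauer.End_ring brauer_D S"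
  by (simp add: brauer.End_ring_def brauer_U_eq brauer_D_eq upwards_eq_downwards)

context
  fixes S :: "'a set"
  assumes fin: "finite S"
begin

abbreviation (input) "permutation_diagrams \<equiv> upwards_diagrams S S"
abbreviation (input) "comp_S \<equiv> brauer_Comp \<delta> S S S"
abbreviation (input) "mult_S \<equiv> diagram_comp S S"

lemma permutation_diagrams_brauer: "\<sigma> \<in> permutation_diagrams \<Longrightarrow> \<sigma> \<in> brauer_diagrams S S"
  using upwards_diagrams_subset by blast

lemma flip_permutation: "\<sigma> \<in> permutation_diagrams \<Longrightarrow> flip_diagram \<sigma> \<in> permutation_diagrams"
  using upwards_eq_downwards[OF fin fin] flip_diagram_upwards by blast

lemma mult_flip:
  assumes "\<sigma> \<in> permutation_diagrams"
  shows "mult_S (flip_diagram \<sigma>) \<sigma> = id_diagram S" "mult_S \<sigma> (flip_diagram \<sigma>) = id_diagram S"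
  using diagram_comp_flip[OF assms fin fin] diagram_comp_flip[OF flip_permutation[OF assms] fin fin]
  by (simp_all add: flip_flip)

lemma mult_in: "\<sigma> \<in> permutation_diagrams \<Longrightarrow> \<tau> \<in> permutation_diagrams \<Longrightarrow> mult_S \<sigma> \<tau> \<in> permutation_diagrams"
  using upwards_diagram_comp fin by blast

lemma mult_assoc:
  assumes "\<sigma> \<in> permutation_diagrams" "\<tau> \<in> permutation_diagrams" "\<rho> \<in> permutation_diagrams"
  shows "mult_S \<sigma> (mult_S \<tau> \<rho>) = mult_S (mult_S \<sigma> \<tau>) \<rho>"
  by (rule diagram_comp_assoc) (use assms permutation_diagrams_brauer fin in auto)

lemma mult_id:
  assumes "\<sigma> \<in> permutation_diagrams"
  shows "mult_S (id_diagram S) \<sigma> = \<sigma>" "mult_S \<sigma> (id_diagram S) = \<sigma>"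
  using assms permutation_diagrams_brauer fin diagram_comp_id_left diagram_comp_id_right by blast+

text \<open>In the group of permutation diagrams this is the inverse of \<sigma> written as \<tau>
  times the inverse of \<sigma>\<tau>. It is the substitution that makes the averaged projection
  equivariant.\<close>

lemma flip_eq_mult:
  assumes \<sigma>: "\<sigma> \<in> permutation_diagrams" and \<tau>: "\<tau> \<in> permutation_diagrams"
  shows "flip_diagram \<sigma> = mult_S \<tau> (flip_diagram (mult_S \<sigma> \<tau>))"
proof -
  let ?\<rho> = "mult_S \<sigma> \<tau>"
  have \<rho>: "?\<rho> \<in> permutation_diagrams" by (rule mult_in[OF assms])
  have "mult_S \<tau> (flip_diagram ?\<rho>) = mult_S (mult_S (flip_diagram \<sigma>) \<sigma>) (mult_S \<tau> (flip_diagram ?\<rho>))"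
    using mult_flip[OF \<sigma>] mult_id[OF mult_in[OF \<tau> flip_permutation[OF \<rho>]]] by simp
  also have "\<dots> = mult_S (flip_diagram \<sigma>) (mult_S \<sigma> (mult_S \<tau> (flip_diagram ?\<rho>)))"
    using \<sigma> \<tau> \<rho> by (simp add: mult_assoc[symmetric] flip_permutation mult_in)
  also have "mult_S \<sigma> (mult_S \<tau> (flip_diagram ?\<rho>)) = mult_S ?\<rho> (flip_diagram ?\<rho>)"
    using \<sigma> \<tau> \<rho> by (simp add: mult_assoc flip_permutation)
  also have "mult_S (flip_diagram \<sigma>) (mult_S ?\<rho> (flip_diagram ?\<rho>)) = flip_diagram \<sigma>"
    using mult_flip[OF \<rho>] mult_id[OF flip_permutation[OF \<sigma>]] by simp
  finally show ?thesis ..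
qed

lemma comp_S_basis:
  "\<sigma> \<in> permutation_diagrams \<Longrightarrow> \<tau> \<in> permutation_diagrams \<Longrightarrow>
     comp_S (diagram_vec \<sigma>) (diagram_vec \<tau>) = diagram_vec (mult_S \<sigma> \<tau>)"
  using loop_count_upwards[of \<tau> S S \<sigma> S] fin permutation_diagrams_brauer by simp

lemma comp_S_assoc:
  assumes "f \<in> brauer_U S S" "g \<in> brauer_U S S" "h \<in> brauer_U S S"
  shows "comp_S h (comp_S g f) = comp_S (comp_S h g) f"
proof -
  have "brauer_U S S \<subseteq> brauer_Hom S S"
    using upwards_diagrams_subset[of S S] by (auto simp: brauer_U_eq brauer_Hom_def)
  then show ?thesis using assms by (intro brauer_Comp_assoc fin) auto
qed

text \<open>Maschke's theorem: a linear projection onto a left ideal is averaged over the permutations.\<close>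

lemma brauer_End_semisimple: "semisimple_ring (brauer.End_ring brauer_U S)"
  unfolding semisimple_ring_def
proof (intro conjI allI impI)
  let ?R = "brauer.End_ring brauer_U S" and ?U = "brauer_U S S" and ?e = diagram_vec
    and ?P = permutation_diagrams
  have ob: "S \<in> brauer_objects" using fin by (simp add: brauer_objects_iff)
  note wide = brauer_wide_U
  show "ring ?R" by (rule brauer.ring_End_ring[OF wide ob])
  fix I assume I: "left_ideal I ?R"
  note I_sub = brauer.left_ideal_End_ring_subspace(1)[OF wide ob I]
    and I_U = brauer.left_ideal_End_ring_subspace(2)[OF wide ob I]
    and I_comp = brauer.left_ideal_End_ring_subspace(3)[OF wide ob I]
  have U_sub: "vec.subspace ?U" unfolding brauer_U_eq by (rule subspace_keys)
  have U_comp: "comp_S g f \<in> ?U" if "f \<in> ?U" "g \<in> ?U" for f g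
    using wide ob that unfolding brauer.wide_subcategory_def by blast
  have e_U: "?e \<sigma> \<in> ?U" if "\<sigma> \<in> ?P" for \<sigma> using that by (simp add: brauer_U_eq)
  have P: "finite ?P" "?P \<noteq> {}"
    using finite_subset[OF upwards_diagrams_subset finite_brauer_diagrams[OF fin fin]]
      id_diagram_upwards[of S] by auto
  interpret pair: vector_space_pair vec_scale "vec_scale :: complex \<Rightarrow> 'a brauer_vec \<Rightarrow> _" ..
  \<comment> \<open>A projection of the whole vector space onto the subspace \<open>I\<close>,
    linear but in general not compatible with composition.\<close>
  obtain p where p: "range p \<subseteq> I" "Vector_Spaces.linear vec_scale vec_scale p" "\<And>v. v \<in> I \<Longrightarrow> p v = v"
    using pair.linear_exists_left_inverse_on[OF vec.linear_id I_sub] by auto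
  have p_add: "p (f + g) = p f + p g" and p_scale: "p (vec_scale c f) = vec_scale c (p f)" for f g c
    using p(2) by (simp_all add: Vector_Spaces.linear.axioms pair.linear_add pair.linear_scale)
  define T where "T v \<sigma> = comp_S (?e (flip_diagram \<sigma>)) (p (comp_S (?e \<sigma>) v))" for v \<sigma>
  \<comment> \<open>The number of permutations is nonzero in the complex numbers. Dividing by it
    keeps the average equal to the identity on \<open>I\<close>.\<close>
  define q where "q v = vec_scale (1 / of_nat (card ?P)) (\<Sum>\<sigma>\<in>?P. T v \<sigma>)" for v
  note bilinear = brauer_Comp_add_left brauer_Comp_add_right brauer_Comp_scale_left
    brauer_Comp_scale_right
  have T_add: "T (f + g) \<sigma> = T f \<sigma> + T g \<sigma>" and T_scale: "T (vec_scale c f) \<sigma> = vec_scale c (T f \<sigma>)"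
    for f g c \<sigma>
    by (simp_all add: T_def bilinear p_add p_scale)
  have q_add: "q (f + g) = q f + q g" for f g
    by (simp add: q_def T_add sum.distrib vec.scale_right_distrib)
  have q_scale: "q (vec_scale c f) = vec_scale c (q f)" for c f
    by (simp add: q_def T_scale vec.scale_sum_right mult.commute)
  have q_0: "q 0 = 0" using q_scale[of 0 0] by simp
  have q_I: "q v \<in> I" for v
    unfolding q_def T_def
  proof (intro vec.subspace_scale[OF I_sub] vec.subspace_sum[OF I_sub] I_comp)
    show "?e (flip_diagram \<sigma>) \<in> ?U" if "\<sigma> \<in> ?P" for \<sigma> using e_U flip_permutation that by blast
  qed (use p(1) in blast)
  have q_id: "q v = v" if v: "v \<in> I" for v
  proof -
    have "T v \<sigma> = v" if \<sigma>: "\<sigma> \<in> ?P" for \<sigma>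
    proof -
      have vU: "v \<in> ?U" using v I_U by blast
      then have "v \<in> brauer_Hom S S"
        using upwards_diagrams_subset[of S S] by (auto simp: brauer_U_eq brauer_Hom_def)
      have "T v \<sigma> = comp_S (?e (flip_diagram \<sigma>)) (comp_S (?e \<sigma>) v)"
        using p(3)[OF I_comp[OF e_U[OF \<sigma>] v]] by (simp add: T_def)
      also have "\<dots> = comp_S (?e (id_diagram S)) v"
        using comp_S_assoc[OF vU e_U[OF \<sigma>] e_U[OF flip_permutation[OF \<sigma>]]]
          comp_S_basis[OF flip_permutation[OF \<sigma>] \<sigma>] mult_flip[OF \<sigma>] by simp
      also have "\<dots> = v"
        using brauer_Comp_ident_left[OF fin fin \<open>v \<in> brauer_Hom S S\<close>] by (simp add: brauer_ident_def)
      finally show ?thesis .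
    qed
    then have "(\<Sum>\<sigma>\<in>?P. T v \<sigma>) = vec_scale (of_nat (card ?P)) v"
      by (simp add: vec.sum_constant_scale)
    then show ?thesis using P by (simp add: q_def)
  qed
  have q_basis: "q (comp_S (?e \<tau>) v) = comp_S (?e \<tau>) (q v)" if \<tau>: "\<tau> \<in> ?P" and v: "v \<in> ?U" for \<tau> v
  proof -
    \<comment> \<open>With \<rho> = \<sigma>\<tau> the reversal of \<sigma> becomes \<tau> after the
      reversal of \<rho>. So \<tau> moves to the front, and summing over the group absorbs the
      change of index.\<close>
    have shift: "T (comp_S (?e \<tau>) v) \<sigma> = comp_S (?e \<tau>) (T v (mult_S \<sigma> \<tau>))" if \<sigma>: "\<sigma> \<in> ?P" for \<sigma>
    proof -
      let ?\<rho> = "mult_S \<sigma> \<tau>"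
      have \<rho>: "?\<rho> \<in> ?P" by (rule mult_in[OF \<sigma> \<tau>])
      let ?w = "p (comp_S (?e ?\<rho>) v)"
      have w: "?w \<in> ?U" using p(1) I_U by blast
      have "T (comp_S (?e \<tau>) v) \<sigma> = comp_S (?e (flip_diagram \<sigma>)) ?w"
        using comp_S_assoc[OF v e_U[OF \<tau>] e_U[OF \<sigma>]] comp_S_basis[OF \<sigma> \<tau>] by (simp add: T_def)
      also have "\<dots> = comp_S (comp_S (?e \<tau>) (?e (flip_diagram ?\<rho>))) ?w"
        using flip_eq_mult[OF \<sigma> \<tau>] comp_S_basis[OF \<tau> flip_permutation[OF \<rho>]] by simp
      also have "\<dots> = comp_S (?e \<tau>) (T v ?\<rho>)"
        using comp_S_assoc[OF w e_U[OF flip_permutation[OF \<rho>]] e_U[OF \<tau>]] by (simp add: T_def)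
      finally show ?thesis .
    qed
    have comp_sum: "comp_S g (sum f A) = (\<Sum>x\<in>A. comp_S g (f x))" for g f and A :: "'a diagram set"
      by (induction A rule: infinite_finite_induct) (simp_all add: bilinear)
    have "(\<Sum>\<sigma>\<in>?P. T (comp_S (?e \<tau>) v) \<sigma>) = (\<Sum>\<sigma>\<in>?P. comp_S (?e \<tau>) (T v (mult_S \<sigma> \<tau>)))"
      by (rule sum.cong) (auto simp: shift)
    also have "\<dots> = (\<Sum>\<rho>\<in>?P. comp_S (?e \<tau>) (T v \<rho>))"
    proof (rule sum.reindex_bij_witness[of _ "\<lambda>\<rho>. mult_S \<rho> (flip_diagram \<tau>)" "\<lambda>\<sigma>. mult_S \<sigma> \<tau>"])
      show "mult_S (mult_S \<sigma> \<tau>) (flip_diagram \<tau>) = \<sigma>" "mult_S \<sigma> \<tau> \<in> ?P" if "\<sigma> \<in> ?P" for \<sigma>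
        using that mult_in \<tau> mult_assoc[OF that \<tau> flip_permutation[OF \<tau>]] mult_flip[OF \<tau>] mult_id
        by simp_all
      show "mult_S (mult_S \<rho> (flip_diagram \<tau>)) \<tau> = \<rho>" "mult_S \<rho> (flip_diagram \<tau>) \<in> ?P" if "\<rho> \<in> ?P" for \<rho>
        using that mult_in flip_permutation[OF \<tau>] mult_assoc[OF that flip_permutation[OF \<tau>] \<tau>]
          mult_flip[OF \<tau>] mult_id by simp_all
    qed simp
    also have "\<dots> = comp_S (?e \<tau>) (\<Sum>\<rho>\<in>?P. T v \<rho>)" by (simp add: comp_sum)
    finally show ?thesis by (simp add: q_def bilinear)
  qed
  have q_comp: "q (comp_S a v) = comp_S a (q v)" if a: "a \<in> ?U" and v: "v \<in> ?U" for a v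
  proof -
    have "Poly_Mapping.keys a \<subseteq> ?P" using a by (simp add: brauer_U_eq)
    then show ?thesis
      by (induction a rule: vec_induct) (simp_all add: q_0 bilinear q_add q_scale q_basis v)
  qed
  \<comment> \<open>The complement is the kernel of the averaged projection, a left ideal because
    \<open>q\<close> commutes with composition on the left.\<close>
  define J where "J = {v \<in> ?U. q v = 0}"
  have J_sub: "vec.subspace J"
    by (rule vec.subspaceI)
      (use vec.subspace_add[OF U_sub] vec.subspace_0[OF U_sub] vec.subspace_scale[OF U_sub]
        in \<open>auto simp: J_def q_0 q_add q_scale\<close>)
  show "\<exists>J. left_ideal J ?R \<and> I \<inter> J = {\<zero>\<^bsub>?R\<^esub>} \<and> I <+>\<^bsub>?R\<^esub> J = carrier ?R"
  proof (intro exI conjI)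
    show "left_ideal J ?R"
      by (rule brauer.left_ideal_End_ringI[OF wide ob J_sub]) (auto simp: J_def U_comp q_comp)
    show "I \<inter> J = {\<zero>\<^bsub>?R\<^esub>}"
      using q_id vec.subspace_0[OF I_sub] vec.subspace_0[OF J_sub]
      by (auto simp: J_def brauer.End_ring_def)
    show "I <+>\<^bsub>?R\<^esub> J = carrier ?R"
    proof (intro equalityI subsetI)
      fix v assume "v \<in> I <+>\<^bsub>?R\<^esub> J"
      then show "v \<in> carrier ?R"
        using I_U vec.subspace_add[OF U_sub] by (auto simp: set_add_def' brauer.End_ring_def J_def)
    next
      fix v assume "v \<in> carrier ?R"
      then have v: "v \<in> ?U" by (simp add: brauer.End_ring_def)
      have "q (v - q v) = 0"
        using q_add[of "v - q v" "q v"] q_id[OF q_I] by simp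
      then have "v - q v \<in> J"
        using vec.subspace_diff[OF U_sub v] q_I I_U by (auto simp: J_def)
      moreover have "v = q v \<oplus>\<^bsub>?R\<^esub> (v - q v)" by (simp add: brauer.End_ring_def)
      ultimately show "v \<in> I <+>\<^bsub>?R\<^esub> J"
        using q_I unfolding set_add_def' by blast
    qed
  qed
qed

end

section \<open>The triangular decomposition\<close>

lemma comm_group_Hom_group: "comm_group (brauer.Hom_group S T)"
proof (rule comm_groupI)
  show "\<exists>g\<in>carrier (brauer.Hom_group S T). g \<otimes>\<^bsub>brauer.Hom_group S T\<^esub> f = \<one>\<^bsub>brauer.Hom_group S T\<^esub>"
    if "f \<in> carrier (brauer.Hom_group S T)" for f
    using that by (auto simp: brauer.Hom_group_def brauer_Hom_def intro!: exI[of _ "- f"])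
  show "f \<otimes>\<^bsub>brauer.Hom_group S T\<^esub> g \<in> carrier (brauer.Hom_group S T)"
    if "f \<in> carrier (brauer.Hom_group S T)" "g \<in> carrier (brauer.Hom_group S T)" for f g
    using that keys_add[of f g] by (auto simp: brauer.Hom_group_def brauer_Hom_def)
qed (simp_all add: brauer.Hom_group_def brauer_Hom_def add.assoc add.commute)

text \<open>The diagrams with a factorization through \<open>Y\<close> span the image of the \<open>Y\<close>-summand.\<close>

definition diagrams_through :: "'a set \<Rightarrow> 'a set \<Rightarrow> 'a set \<Rightarrow> 'a diagram set" where
  "diagrams_through S U Y =
     {diagram_comp S U u d | u d. u \<in> upwards_diagrams Y U \<and> d \<in> downwards_diagrams S Y}"

lemma diagrams_through_disjoint:
  assumes "\<gamma> \<in> diagrams_through S U Y" "\<gamma> \<in> diagrams_through S U Y'"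
    and fin: "finite S" "finite Y" "finite Y'" "finite U"
  shows "card Y = card Y'"
proof -
  obtain u d u' d' where *: "u \<in> upwards_diagrams Y U" "d \<in> downwards_diagrams S Y"
      "u' \<in> upwards_diagrams Y' U" "d' \<in> downwards_diagrams S Y'"
      "diagram_comp S U u d = diagram_comp S U u' d'"
    using assms(1,2) unfolding diagrams_through_def by auto
  show ?thesis
    by (rule factor_unique[OF * fin]) (use bij_betw_same_card in metis)
qed

lemma diagrams_through_subset:
  "finite S \<Longrightarrow> finite Y \<Longrightarrow> finite U \<Longrightarrow> diagrams_through S U Y \<subseteq> brauer_diagrams S U"
  using upwards_diagrams_subset[of Y U] downwards_diagrams_subset[of S Y]
  by (auto simp: diagrams_through_def intro!: diagram_comp_in[of _ S Y])

section \<open>A single summand: the composites through a fixed set\<close>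

context
  fixes S Y U :: "'a set"
  assumes fin: "finite S" "finite Y" "finite U"
begin

abbreviation (input) "Through \<equiv> diagrams_through S U Y"
abbreviation (input) "R_Y \<equiv> brauer_U Y Y"
abbreviation (input) "M_Y \<equiv> brauer_U Y U"
abbreviation (input) "N_Y \<equiv> brauer_D S Y"
abbreviation (input) "ra_Y \<equiv> brauer_Comp \<delta> Y Y U"
abbreviation (input) "la_Y \<equiv> brauer_Comp \<delta> S Y Y"

lemma objects_SYU: "S \<in> brauer_objects" "Y \<in> brauer_objects" "U \<in> brauer_objects"
  using fin by (simp_all add: brauer_objects_iff)

lemma brauer_subcategories:
  "brauer_U Y U \<subseteq> brauer_Hom Y U" "brauer_D S Y \<subseteq> brauer_Hom S Y" "brauer_U Y Y \<subseteq> brauer_Hom Y Y"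
  using brauer_wide_U brauer_wide_D objects_SYU
  unfolding brauer.wide_subcategory_def by blast+

lemma tensor_data_brauer: "tensor_data R_Y M_Y N_Y ra_Y la_Y"
proof
  have sub: "vec.subspace M_Y" "vec.subspace N_Y"
    unfolding brauer_U_eq brauer_D_eq by (rule subspace_keys)+
  show "0 \<in> M_Y" "\<And>m m'. m \<in> M_Y \<Longrightarrow> m' \<in> M_Y \<Longrightarrow> m + m' \<in> M_Y"
    "\<And>n n'. n \<in> N_Y \<Longrightarrow> n' \<in> N_Y \<Longrightarrow> n + n' \<in> N_Y"
    using sub vec.subspace_0 vec.subspace_add by blast+
  show "ra_Y m r \<in> M_Y" if "m \<in> M_Y" "r \<in> R_Y" for m r
    using that brauer_wide_U objects_SYU unfolding brauer.wide_subcategory_def by blast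
  \<comment> \<open>The ring consists of upwards endomorphisms but has to act on downwards
    morphisms. It does, because upwards and downwards endomorphisms of \<open>Y\<close> are the
    same.\<close>
  have "R_Y = brauer_D Y Y"
    using upwards_eq_downwards[OF fin(2,2)] by (simp add: brauer_U_eq brauer_D_eq)
  then show "la_Y r n \<in> N_Y" if "r \<in> R_Y" "n \<in> N_Y" for r n
    using that brauer_wide_D objects_SYU unfolding brauer.wide_subcategory_def by blast
qed

interpretation tensor_data R_Y M_Y N_Y ra_Y la_Y
  by (rule tensor_data_brauer)

lemma brauer_Comp_factor:
  "u \<in> upwards_diagrams Y U \<Longrightarrow> d \<in> downwards_diagrams S Y \<Longrightarrow>
    brauer_Comp \<delta> S Y U (diagram_vec u) (diagram_vec d) = diagram_vec (diagram_comp S U u d)"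
  using loop_count_downwards[of d S Y u U] fin upwards_diagrams_subset[of Y U] by auto

lemma scaled_in:
  "u \<in> upwards_diagrams Y U \<Longrightarrow> vec_scale c (diagram_vec u) \<in> M_Y"
  "d \<in> downwards_diagrams S Y \<Longrightarrow> vec_scale c (diagram_vec d) \<in> N_Y"
  "\<sigma> \<in> upwards_diagrams Y Y \<Longrightarrow> vec_scale c (diagram_vec \<sigma>) \<in> R_Y"
  unfolding brauer_U_eq brauer_D_eq by (rule vec.subspace_scale[OF subspace_keys]; simp)+

lemma unscaled_in:
  "u \<in> upwards_diagrams Y U \<Longrightarrow> diagram_vec u \<in> M_Y"
  "d \<in> downwards_diagrams S Y \<Longrightarrow> diagram_vec d \<in> N_Y"
  "\<sigma> \<in> upwards_diagrams Y Y \<Longrightarrow> diagram_vec \<sigma> \<in> R_Y"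
  by (simp_all add: brauer_U_eq brauer_D_eq)

text \<open>
  Modulo the tensor relations every element is a unique combination of \<open>u\<^sub>\<gamma> \<otimes> d\<^sub>\<gamma>\<close>, for one chosen
  factorization of each diagram \<open>\<gamma>\<close> through \<open>Y\<close>; this makes the composition map injective.
\<close>

context
  fixes uf df :: "'a diagram \<Rightarrow> 'a diagram"
  assumes factors: "\<And>\<gamma>. \<gamma> \<in> Through \<Longrightarrow>
    uf \<gamma> \<in> upwards_diagrams Y U \<and> df \<gamma> \<in> downwards_diagrams S Y \<and> diagram_comp S U (uf \<gamma>) (df \<gamma>) = \<gamma>"
begin

lemma uf_in: "\<gamma> \<in> Through \<Longrightarrow> uf \<gamma> \<in> upwards_diagrams Y U"
  and df_in: "\<gamma> \<in> Through \<Longrightarrow> df \<gamma> \<in> downwards_diagrams S Y"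
  and diagram_comp_factors: "\<gamma> \<in> Through \<Longrightarrow> diagram_comp S U (uf \<gamma>) (df \<gamma>) = \<gamma>"
  using factors by blast+

text \<open>The free group has integer coefficients, so the complex coefficient of
  \<open>\<gamma>\<close> is stored in the left tensor factor.\<close>

definition normal_form :: "'a brauer_vec \<Rightarrow> ('a brauer_vec \<times> 'a brauer_vec) \<Rightarrow>\<^sub>0 int" where
  "normal_form f = (\<Sum>\<gamma>\<in>Through.
     frag_of (vec_scale (Poly_Mapping.lookup f \<gamma>) (diagram_vec (uf \<gamma>)), diagram_vec (df \<gamma>)))"

definition normalizable :: "('a brauer_vec \<times> 'a brauer_vec \<Rightarrow>\<^sub>0 int) \<Rightarrow> bool" where
  "normalizable a \<longleftrightarrow> (\<exists>f. Poly_Mapping.keys f \<subseteq> Through \<and> a - normal_form f \<in> K)"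

lemma finite_Through: "finite Through"
  using finite_subset[OF diagrams_through_subset finite_brauer_diagrams] fin by blast

lemma normal_form_add: "normal_form (f + g) - normal_form f - normal_form g \<in> K"
proof -
  have "normal_form (f + g) - normal_form f - normal_form g =
    (\<Sum>\<gamma>\<in>Through.
      frag_of (vec_scale (Poly_Mapping.lookup f \<gamma>) (diagram_vec (uf \<gamma>))
          + vec_scale (Poly_Mapping.lookup g \<gamma>) (diagram_vec (uf \<gamma>)), diagram_vec (df \<gamma>))
      - frag_of (vec_scale (Poly_Mapping.lookup f \<gamma>) (diagram_vec (uf \<gamma>)), diagram_vec (df \<gamma>))
      - frag_of (vec_scale (Poly_Mapping.lookup g \<gamma>) (diagram_vec (uf \<gamma>)), diagram_vec (df \<gamma>)))"
    by (simp add: normal_form_def lookup_add vec.scale_left_distrib sum_subtractf)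
  also have "\<dots> \<in> K"
    by (intro K_sum K_add_left scaled_in unscaled_in uf_in df_in)
  finally show ?thesis .
qed

lemma normal_form_zero: "normal_form 0 \<in> K"
  unfolding normal_form_def by (intro K_sum) (simp add: K_zero_left unscaled_in df_in)

lemma normalizable_cong: "normalizable b \<Longrightarrow> a - b \<in> K \<Longrightarrow> normalizable a"
  unfolding normalizable_def using K_trans by blast

lemma normalizable_zero: "normalizable 0"
  unfolding normalizable_def using K_minus[OF normal_form_zero] by (intro exI[of _ 0]) simp

lemma normalizable_K: "a \<in> K \<Longrightarrow> normalizable a"
  using normalizable_cong[OF normalizable_zero, of a] by simp

lemma normalizable_diff:
  assumes "normalizable a" "normalizable b"
  shows "normalizable (a - b)"
proof -
  obtain f g where f: "Poly_Mapping.keys f \<subseteq> Through" "a - normal_form f \<in> K"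
    and g: "Poly_Mapping.keys g \<subseteq> Through" "b - normal_form g \<in> K"
    using assms unfolding normalizable_def by blast
  \<comment> \<open>Additivity of \<open>normal_form\<close> modulo \<open>K\<close> is applied to
    \<open>f = (f - g) + g\<close>, which handles the subtraction directly.\<close>
  have "a - b - normal_form (f - g) =
      (a - normal_form f) - (b - normal_form g)
      + (normal_form ((f - g) + g) - normal_form (f - g) - normal_form g)"
    by simp
  also have "\<dots> \<in> K" by (intro K_add K_diff f(2) g(2) normal_form_add)
  finally show ?thesis
    unfolding normalizable_def using f(1) g(1) keys_diff[of f g] by (intro exI[of _ "f - g"]) auto
qed

lemma normalizable_add: "normalizable a \<Longrightarrow> normalizable b \<Longrightarrow> normalizable (a + b)"
  using normalizable_diff[of a "0 - b"] normalizable_diff[OF normalizable_zero, of b] by simp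

lemma normal_form_basis:
  assumes \<gamma>: "\<gamma> \<in> Through"
  shows "frag_of (vec_scale c (diagram_vec (uf \<gamma>)), diagram_vec (df \<gamma>))
      - normal_form (vec_scale c (diagram_vec \<gamma>)) \<in> K"
proof -
  let ?t = "\<lambda>\<gamma>'. frag_of (vec_scale (c * (if \<gamma> = \<gamma>' then 1 else 0)) (diagram_vec (uf \<gamma>')), diagram_vec (df \<gamma>'))"
  have "normal_form (vec_scale c (diagram_vec \<gamma>)) = (\<Sum>\<gamma>'\<in>Through. ?t \<gamma>')"
    by (simp add: normal_form_def lookup_vec_scale diagram_vec_def[of \<gamma>] lookup_single when_def)
  also have "\<dots> = ?t \<gamma> + (\<Sum>\<gamma>'\<in>Through - {\<gamma>}. ?t \<gamma>')"
    by (rule sum.remove[OF finite_Through \<gamma>])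
  finally have "normal_form (vec_scale c (diagram_vec \<gamma>))
      - frag_of (vec_scale c (diagram_vec (uf \<gamma>)), diagram_vec (df \<gamma>)) = (\<Sum>\<gamma>'\<in>Through - {\<gamma>}. ?t \<gamma>')"
    by simp
  \<comment> \<open>The terms for the other diagrams have coefficient zero but are generators
    \<open>frag_of (0, _)\<close>; they vanish only modulo the relations.\<close>
  also have "\<dots> \<in> K"
    by (intro K_sum) (auto simp: K_zero_left unscaled_in df_in)
  finally show ?thesis by (rule K_sym)
qed

text \<open>Two moves across the tensor sign. The scalar \<open>b\<close> passes to the left by
  balancing with \<open>b\<close> times the identity. The bijection \<open>\<sigma>\<close> relating
  the given factorization to the chosen one passes to the right: \<open>u\<close> is
  \<open>uf \<gamma>\<close> after \<open>\<sigma>\<close>, and \<open>df \<gamma>\<close> is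
  \<open>\<sigma>\<close> after \<open>d\<close>.\<close>

lemma normalizable_basis:
  assumes u: "u \<in> upwards_diagrams Y U" and d: "d \<in> downwards_diagrams S Y"
  shows "normalizable (frag_of (vec_scale a (diagram_vec u), vec_scale b (diagram_vec d)))"
proof -
  define \<gamma> where "\<gamma> = diagram_comp S U u d"
  have \<gamma>: "\<gamma> \<in> Through" unfolding \<gamma>_def diagrams_through_def using u d by blast
  note fac = uf_in[OF \<gamma>] df_in[OF \<gamma>] diagram_comp_factors[OF \<gamma>]
  obtain h where h: "bij_betw h Y Y" "diagram_comp S Y (bij_diagram h Y) d = df \<gamma>"
      "diagram_comp Y U (uf \<gamma>) (bij_diagram h Y) = u"
    using factor_unique[of "uf \<gamma>" Y U "df \<gamma>" S u Y d] fac u d fin unfolding \<gamma>_def by metis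
  define \<sigma> where "\<sigma> = bij_diagram h Y"
  have \<sigma>: "\<sigma> \<in> upwards_diagrams Y Y" "\<sigma> \<in> downwards_diagrams Y Y" "\<sigma> \<in> brauer_diagrams Y Y"
    unfolding \<sigma>_def using h(1) bij_diagram_upwards bij_diagram_downwards bij_diagram_in by blast+
  have loops: "loop_count (uf \<gamma>) \<sigma> = 0" "loop_count \<sigma> d = 0"
    using loop_count_downwards[OF \<sigma>(2), of "uf \<gamma>" U] loop_count_downwards[OF d \<sigma>(3)] fac fin
      upwards_diagrams_subset[of Y U] by auto
  have "u \<in> brauer_diagrams Y U" "d \<in> brauer_diagrams S Y"
    using u d upwards_diagrams_subset downwards_diagrams_subset by blast+
  then have u_Hom: "diagram_vec u \<in> brauer_Hom Y U" and d_Hom: "diagram_vec d \<in> brauer_Hom S Y"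
    by (auto simp: brauer_Hom_def)
  let ?id = "vec_scale b (brauer_ident Y)"
  have id_in: "?id \<in> R_Y"
    unfolding brauer_ident_def by (rule scaled_in(3)[OF id_diagram_upwards])
  have 1: "ra_Y (vec_scale a (diagram_vec u)) ?id = vec_scale (a * b) (diagram_vec u)"
    using brauer_Comp_ident_right[OF fin(2,3) u_Hom]
    by (simp add: brauer_Comp_scale_left brauer_Comp_scale_right mult.commute)
  have 2: "la_Y ?id (diagram_vec d) = vec_scale b (diagram_vec d)"
    using brauer_Comp_ident_left[OF fin(1,2) d_Hom] by (simp add: brauer_Comp_scale_left)
  have 3: "ra_Y (vec_scale (a * b) (diagram_vec (uf \<gamma>))) (diagram_vec \<sigma>) = vec_scale (a * b) (diagram_vec u)"
    using h(3) loops by (simp add: brauer_Comp_scale_left \<sigma>_def)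
  have 4: "la_Y (diagram_vec \<sigma>) (diagram_vec d) = diagram_vec (df \<gamma>)"
    using h(2) loops by (simp add: \<sigma>_def)
  have "frag_of (vec_scale a (diagram_vec u), vec_scale b (diagram_vec d))
      - frag_of (vec_scale (a * b) (diagram_vec u), diagram_vec d) \<in> K"
    using K_sym[OF K_balance[OF scaled_in(1)[OF u] id_in unscaled_in(2)[OF d], of a]]
    unfolding 1 2 .
  moreover have "frag_of (vec_scale (a * b) (diagram_vec u), diagram_vec d)
      - frag_of (vec_scale (a * b) (diagram_vec (uf \<gamma>)), diagram_vec (df \<gamma>)) \<in> K"
    using K_balance[OF scaled_in(1)[of "uf \<gamma>"] unscaled_in(3)[OF \<sigma>(1)] unscaled_in(2)[OF d], of "a * b"]
      fac unfolding 3 4 by blast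
  ultimately have "frag_of (vec_scale a (diagram_vec u), vec_scale b (diagram_vec d))
      - normal_form (vec_scale (a * b) (diagram_vec \<gamma>)) \<in> K"
    using normal_form_basis[OF \<gamma>] K_trans by blast
  moreover have "Poly_Mapping.keys (vec_scale (a * b) (diagram_vec \<gamma>)) \<subseteq> Through"
    using vec.subspace_scale[OF subspace_keys, of "diagram_vec \<gamma>" Through] \<gamma> by simp
  ultimately show ?thesis unfolding normalizable_def by blast
qed

lemma normalizable_pure:
  assumes m: "m \<in> M_Y" and n: "n \<in> N_Y"
  shows "normalizable (frag_of (m, n))"
proof -
  have zero: "0 \<in> N_Y" by (simp add: brauer_D_eq)
  have step: "normalizable (frag_of (m, vec_scale b (diagram_vec d)))" if d: "d \<in> downwards_diagrams S Y" for b d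
    using m unfolding brauer_U_eq mem_Collect_eq
  proof (induction m rule: vec_induct)
    case zero
    then show ?case by (intro normalizable_K K_zero_left scaled_in d)
  next
    case (add m m')
    then have "m \<in> M_Y" "m' \<in> M_Y" by (simp_all add: brauer_U_eq)
    then show ?case
      using normalizable_cong[OF normalizable_add[OF add(3,4)]] K_add_left[OF _ _ scaled_in(2)[OF d]]
      by (simp add: algebra_simps)
  next
    case (scale c u)
    then show ?case by (intro normalizable_basis d)
  qed
  show ?thesis
    using n unfolding brauer_D_eq mem_Collect_eq
  proof (induction n rule: vec_induct)
    case zero
    show ?case by (intro normalizable_K K_zero_right m \<open>0 \<in> N_Y\<close>)
  next
    case (add n n')
    then have "n \<in> N_Y" "n' \<in> N_Y" by (simp_all add: brauer_D_eq)
    then show ?case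
      using normalizable_cong[OF normalizable_add[OF add(3,4)]] K_add_right[OF m]
      by (simp add: algebra_simps)
  next
    case (scale c d)
    then show ?case by (intro step)
  qed
qed

lemma normalizable_all:
  assumes "Poly_Mapping.keys a \<subseteq> M_Y \<times> N_Y"
  shows "normalizable a"
  using assms by (induction a rule: frag_induction)
    (auto simp: normalizable_zero normalizable_pure normalizable_diff)

text \<open>The composition map \<open>h\<close> on the free group undoes
  \<open>normal_form\<close>. Every element is congruent to a normal form, so its image under
  \<open>h\<close> determines it modulo \<open>K\<close>. This gives injectivity, and the normal
  forms give the image.\<close>

lemma tensor_summand_chosen:
  obtains \<Phi> where "\<Phi> \<in> hom (brauer.Hom_tensor brauer_U brauer_D S Y U) (brauer.Hom_group S U)"
    "inj_on \<Phi> (carrier (brauer.Hom_tensor brauer_U brauer_D S Y U))"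
    "\<Phi> ` carrier (brauer.Hom_tensor brauer_U brauer_D S Y U) = vecs Through"
    "\<And>u d. u \<in> M_Y \<Longrightarrow> d \<in> N_Y \<Longrightarrow>
      \<Phi> (brauer.Hom_pure_tensor brauer_U brauer_D S Y U u d) = brauer_Comp \<delta> S Y U u d"
proof -
  let ?G = "brauer.Hom_group S U" and ?C = "brauer_Comp \<delta> S Y U"
  interpret G: comm_group ?G by (rule comm_group_Hom_group)
  have G_simps: "carrier ?G = brauer_Hom S U" "\<one>\<^bsub>?G\<^esub> = 0" "f \<otimes>\<^bsub>?G\<^esub> g = f + g" for f g
    by (simp_all add: brauer.Hom_group_def)
  have C_in: "?C u d \<in> brauer_Hom S U" if "u \<in> M_Y" "d \<in> N_Y" for u d
    using that brauer_subcategories brauer.Comp_in_Hom[OF objects_SYU] by blast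
  have C_img: "(\<lambda>(u, d). ?C u d) ` (M_Y \<times> N_Y) \<subseteq> carrier ?G"
    using C_in by (auto simp: G_simps)
  obtain h where h: "h \<in> hom F ?G" and h_of': "\<And>p. p \<in> M_Y \<times> N_Y \<Longrightarrow> h (frag_of p) = (\<lambda>(u, d). ?C u d) p"
    using G.free_Abelian_group_universal[OF C_img] by blast
  have h_of: "h (frag_of (u, d)) = ?C u d" if "u \<in> M_Y" "d \<in> N_Y" for u d
    using h_of'[of "(u, d)"] that by simp
  have h_add: "h (a + b) = h a + h b"
    if "Poly_Mapping.keys a \<subseteq> M_Y \<times> N_Y" "Poly_Mapping.keys b \<subseteq> M_Y \<times> N_Y" for a b
    using hom_mult[OF h, of a b] that by (simp add: G_simps)
  have h_diff: "h (a - b) = h a - h b"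
    if "Poly_Mapping.keys a \<subseteq> M_Y \<times> N_Y" "Poly_Mapping.keys b \<subseteq> M_Y \<times> N_Y" for a b
  proof -
    have "Poly_Mapping.keys (a - b) \<subseteq> M_Y \<times> N_Y" using that keys_diff[of a b] by blast
    from h_add[OF this that(2)] show ?thesis by simp
  qed
  have h_zero: "h 0 = 0"
    using h_diff[of 0 0] by simp
  have h_sum: "h (\<Sum>i\<in>A. frag_of (p i)) = (\<Sum>i\<in>A. h (frag_of (p i)))"
    if "\<And>i. i \<in> A \<Longrightarrow> p i \<in> M_Y \<times> N_Y" "finite A" for p and A :: "'a diagram set"
    using that(2,1)
  proof (induction A)
    case (insert i A)
    have "Poly_Mapping.keys (\<Sum>i\<in>A. frag_of (p i)) \<subseteq> M_Y \<times> N_Y"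
      by (rule order_trans[OF keys_sum], rule UN_least) (simp add: insert.prems)
    then show ?case using insert by (simp add: h_add keys_frag_of)
  qed (simp add: h_zero)
  note bilinear = brauer_Comp_add_left brauer_Comp_add_right brauer_Comp_scale_left
    brauer_Comp_scale_right
  have h_rel: "h a = 0" if "a \<in> tensor_relators R_Y M_Y N_Y ra_Y la_Y" for a
  proof -
    have d3: "h (frag_of p - frag_of q - frag_of r) = h (frag_of p) - h (frag_of q) - h (frag_of r)"
      if "p \<in> M_Y \<times> N_Y" "q \<in> M_Y \<times> N_Y" "r \<in> M_Y \<times> N_Y" for p q r
    proof -
      have "Poly_Mapping.keys (frag_of p - frag_of q) \<subseteq> M_Y \<times> N_Y"
        using that keys_diff[of "frag_of p" "frag_of q"] by (auto simp: keys_frag_of)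
      then show ?thesis using that by (simp add: h_diff keys_frag_of)
    qed
    consider m m' n where "a = frag_of (m + m', n) - frag_of (m, n) - frag_of (m', n)"
        "m \<in> M_Y" "m' \<in> M_Y" "n \<in> N_Y"
      | m n n' where "a = frag_of (m, n + n') - frag_of (m, n) - frag_of (m, n')"
        "m \<in> M_Y" "n \<in> N_Y" "n' \<in> N_Y"
      | m r n where "a = frag_of (ra_Y m r, n) - frag_of (m, la_Y r n)"
        "m \<in> M_Y" "r \<in> R_Y" "n \<in> N_Y"
      using \<open>a \<in> tensor_relators R_Y M_Y N_Y ra_Y la_Y\<close> unfolding tensor_relators_def by blast
    then show ?thesis
    proof cases
      case 1
      then show ?thesis by (simp add: d3 h_of M_add bilinear)
    next
      case 2
      then show ?thesis by (simp add: d3 h_of N_add bilinear)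
    next
      case 3
      then have "h a = ?C (ra_Y m r) n - ?C m (la_Y r n)"
        by (simp add: h_diff h_of ra_in la_in keys_frag_of)
      \<comment> \<open>Composition respects the balancing relators by associativity.\<close>
      moreover have "?C m (la_Y r n) = ?C (ra_Y m r) n"
        using 3 brauer_subcategories by (intro brauer_Comp_assoc fin) auto
      ultimately show ?thesis by simp
    qed
  qed
  have h_normal: "h (normal_form f) = f" if f: "Poly_Mapping.keys f \<subseteq> Through" for f
  proof -
    let ?c = "\<lambda>\<gamma>. vec_scale (Poly_Mapping.lookup f \<gamma>)"
    have "h (normal_form f) = (\<Sum>\<gamma>\<in>Through. h (frag_of (?c \<gamma> (diagram_vec (uf \<gamma>)), diagram_vec (df \<gamma>))))"
      unfolding normal_form_def
      by (intro h_sum finite_Through) (simp add: scaled_in unscaled_in uf_in df_in)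
    also have "\<dots> = (\<Sum>\<gamma>\<in>Through. ?c \<gamma> (diagram_vec \<gamma>))"
    proof (rule sum.cong)
      fix \<gamma> assume "\<gamma> \<in> Through"
      then show "h (frag_of (?c \<gamma> (diagram_vec (uf \<gamma>)), diagram_vec (df \<gamma>))) = ?c \<gamma> (diagram_vec \<gamma>)"
        by (simp add: h_of scaled_in unscaled_in uf_in df_in brauer_Comp_scale_left brauer_Comp_factor
            diagram_comp_factors del: brauer_Comp_basis)
    qed simp
    also have "\<dots> = (\<Sum>\<gamma>\<in>Poly_Mapping.keys f. ?c \<gamma> (diagram_vec \<gamma>))"
      using f finite_Through by (intro sum.mono_neutral_right) (auto simp: in_keys_iff)
    finally show ?thesis by (simp add: vec_sum_expansion)
  qed
  have h_K: "h a = 0" if "a \<in> K" for a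
  proof -
    interpret hom: group_hom F ?G h
      using G.is_group h by (simp add: group_hom_def group_hom_axioms_def)
    have "K \<subseteq> kernel F ?G h"
      unfolding tensor_kernel_def
      by (rule group.generate_subgroup_incl[OF _ _ hom.subgroup_kernel])
        (auto simp: kernel_def h_rel G_simps dest: keys_relators)
    then show ?thesis using that by (auto simp: kernel_def G_simps)
  qed
  have norm: "\<exists>f. Poly_Mapping.keys f \<subseteq> Through \<and> a - normal_form f \<in> K \<and> h a = f"
    if a: "Poly_Mapping.keys a \<subseteq> M_Y \<times> N_Y" for a
  proof -
    obtain f where f: "Poly_Mapping.keys f \<subseteq> Through" "a - normal_form f \<in> K"
      using normalizable_all[OF a] unfolding normalizable_def by blast
    have "Poly_Mapping.keys (normal_form f) \<subseteq> M_Y \<times> N_Y"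
      using keys_diff[of a "a - normal_form f"] a keys_K[OF f(2)] by auto
    then have "h a - h (normal_form f) = 0" using h_diff[OF a] h_K[OF f(2)] by simp
    then show ?thesis using f h_normal by auto
  qed
  have ker: "a \<in> K" if a: "Poly_Mapping.keys a \<subseteq> M_Y \<times> N_Y" "h a = \<one>\<^bsub>?G\<^esub>" for a
  proof -
    \<comment> \<open>If \<open>h a\<close> vanishes, the normal form of \<open>a\<close> is that of
      the zero vector, which lies in \<open>K\<close> although it is not literally zero.\<close>
    have "a - normal_form 0 \<in> K" using norm[OF a(1)] a(2) by (auto simp: G_simps)
    then show ?thesis using K_add[OF _ normal_form_zero, of "a - normal_form 0"] by simp
  qed
  have img: "h ` carrier F = vecs Through"
  proof (intro equalityI subsetI)
    fix f assume "f \<in> h ` carrier F"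
    then obtain a where "Poly_Mapping.keys a \<subseteq> M_Y \<times> N_Y" "f = h a" by auto
    then show "f \<in> vecs Through" using norm[of a] by blast
  next
    fix f :: "'a brauer_vec"
    assume "f \<in> vecs Through"
    moreover have "normal_form f \<in> carrier F"
      unfolding carrier_free_Abelian_group_iff normal_form_def
      by (rule order_trans[OF keys_sum]) (auto simp: keys_frag_of scaled_in unscaled_in uf_in df_in)
    ultimately show "f \<in> h ` carrier F" using h_normal by (metis image_eqI mem_Collect_eq)
  qed
  have rel: "h a = \<one>\<^bsub>?G\<^esub>" if "a \<in> tensor_relators R_Y M_Y N_Y ra_Y la_Y" for a
    using h_rel[OF that] by (simp add: G_simps)
  show thesis
    by (rule tensor_group_map[OF G.is_group h rel ker])
      (use that img h_of in \<open>simp_all add: brauer.Hom_tensor_def brauer.Hom_pure_tensor_def\<close>)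
qed

end

lemma tensor_summand:
  obtains \<Phi> where "\<Phi> \<in> hom (brauer.Hom_tensor brauer_U brauer_D S Y U) (brauer.Hom_group S U)"
    "inj_on \<Phi> (carrier (brauer.Hom_tensor brauer_U brauer_D S Y U))"
    "\<Phi> ` carrier (brauer.Hom_tensor brauer_U brauer_D S Y U) =
       vecs (diagrams_through S U Y)"
    "\<And>u d. u \<in> brauer_U Y U \<Longrightarrow> d \<in> brauer_D S Y \<Longrightarrow>
      \<Phi> (brauer.Hom_pure_tensor brauer_U brauer_D S Y U u d) = brauer_Comp \<delta> S Y U u d"
proof -
  have "\<forall>\<gamma>\<in>Through. \<exists>u d. u \<in> upwards_diagrams Y U \<and> d \<in> downwards_diagrams S Y \<and> diagram_comp S U u d = \<gamma>"
    by (auto simp: diagrams_through_def)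
  then obtain uf df where "\<And>\<gamma>. \<gamma> \<in> Through \<Longrightarrow>
      uf \<gamma> \<in> upwards_diagrams Y U \<and> df \<gamma> \<in> downwards_diagrams S Y \<and> diagram_comp S U (uf \<gamma>) (df \<gamma>) = \<gamma>"
    by metis
  from tensor_summand_chosen[OF this] show thesis using that by blast
qed

lemma group_Hom_tensor: "group (brauer.Hom_tensor brauer_U brauer_D S Y U)"
  unfolding brauer.Hom_tensor_def by (rule group_tensor_group)

lemma Hom_pure_tensor_in:
  "u \<in> brauer_U Y U \<Longrightarrow> d \<in> brauer_D S Y \<Longrightarrow>
    brauer.Hom_pure_tensor brauer_U brauer_D S Y U u d \<in> carrier (brauer.Hom_tensor brauer_U brauer_D S Y U)"
  unfolding brauer.Hom_tensor_def brauer.Hom_pure_tensor_def by (rule pure_tensor_in)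

end

text \<open>The number of vertical edges partitions the diagrams from \<open>S\<close> to
  \<open>U\<close> into the sets \<open>\<Gamma> c\<close>. Each tensor summand is carried
  bijectively onto the span of its own set, so the sum is carried onto the whole Hom space.\<close>

lemma brauer_composition_isomorphism:
  fixes S U :: "'a set"
  assumes fin: "finite S" "finite U"
    and rep: "\<And>c. c \<in> brauer.iso_classes \<Longrightarrow> rep c \<in> c"
  shows "brauer.composition_isomorphism brauer_U brauer_D rep S U"
proof -
  let ?C = "brauer.iso_classes :: 'a set set set"
  define T where "T c = brauer.Hom_tensor brauer_U brauer_D S (rep c) U" for c
  define pure where "pure c = brauer.Hom_pure_tensor brauer_U brauer_D S (rep c) U" for c
  define \<Gamma> where "\<Gamma> c = diagrams_through S U (rep c)" for c
  let ?G = "sum_group ?C T" and ?H = "brauer.Hom_group S U"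
  have rep_fin: "finite (rep c)" if "c \<in> ?C" for c
    using brauer_rep(1)[OF that rep[OF that]] .
  have rep_card: "c = c'" if "c \<in> ?C" "c' \<in> ?C" "card (rep c) = card (rep c')" for c c'
    using that brauer_rep(2)[OF that(1) rep[OF that(1)]] brauer_rep(2)[OF that(2) rep[OF that(2)]]
      brauer_iso_class_eq_iff[OF rep_fin[OF that(1)] rep_fin[OF that(2)]] by metis
  have group_T: "group (T c)" if "c \<in> ?C" for c
    unfolding T_def by (rule group_Hom_tensor[OF fin(1) rep_fin[OF that] fin(2)])
  define summand_map where "summand_map c \<Phi> \<longleftrightarrow> \<Phi> \<in> hom (T c) ?H \<and> inj_on \<Phi> (carrier (T c)) \<and>
      \<Phi> ` carrier (T c) = vecs (\<Gamma> c) \<and>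
      (\<forall>u\<in>brauer_U (rep c) U. \<forall>d\<in>brauer_D S (rep c). \<Phi> (pure c u d) = brauer_Comp \<delta> S (rep c) U u d)" for c \<Phi>
  have "\<forall>c\<in>?C. \<exists>\<Phi>. summand_map c \<Phi>"
  proof
    fix c assume c: "c \<in> ?C"
    show "\<exists>\<Phi>. summand_map c \<Phi>"
      unfolding summand_map_def T_def pure_def \<Gamma>_def
      by (rule tensor_summand[OF fin(1) rep_fin[OF c] fin(2)]) blast
  qed
  then obtain \<Phi> where \<Phi>: "\<forall>c\<in>?C. summand_map c (\<Phi> c)"
    by (rule bchoice[THEN exE])
  have \<Phi>_hom: "\<And>c. c \<in> ?C \<Longrightarrow> \<Phi> c \<in> hom (T c) ?H"
    and \<Phi>_inj: "\<And>c. c \<in> ?C \<Longrightarrow> inj_on (\<Phi> c) (carrier (T c))"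
    and \<Phi>_img: "\<And>c. c \<in> ?C \<Longrightarrow> \<Phi> c ` carrier (T c) = vecs (\<Gamma> c)"
    and \<Phi>_pure: "\<And>c u d. c \<in> ?C \<Longrightarrow> u \<in> brauer_U (rep c) U \<Longrightarrow> d \<in> brauer_D S (rep c) \<Longrightarrow>
      \<Phi> c (pure c u d) = brauer_Comp \<delta> S (rep c) U u d"
    using \<Phi> unfolding summand_map_def by blast+
  have \<Phi>_mult: "\<Phi> c (v \<otimes>\<^bsub>T c\<^esub> w) = \<Phi> c v + \<Phi> c w" if "c \<in> ?C" "v \<in> carrier (T c)" "w \<in> carrier (T c)" for c v w
    using hom_mult[OF \<Phi>_hom[OF that(1)] that(2,3)] by (simp add: brauer.Hom_group_def)
  have one_in: "\<one>\<^bsub>T c\<^esub> \<in> carrier (T c)" if "c \<in> ?C" for c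
    using group.is_monoid[OF group_T[OF that]] by (rule monoid.one_closed)
  have \<Phi>_one: "\<Phi> c \<one>\<^bsub>T c\<^esub> = 0" if "c \<in> ?C" for c
    using \<Phi>_mult[OF that one_in[OF that] one_in[OF that]]
      monoid.l_one[OF group.is_monoid[OF group_T[OF that]] one_in[OF that]] by simp
  have \<Phi>_keys: "Poly_Mapping.keys (\<Phi> c v) \<subseteq> \<Gamma> c" if "c \<in> ?C" "v \<in> carrier (T c)" for c v
    using \<Phi>_img[OF that(1)] that(2) by blast
  have \<Gamma>_disjoint: "c = c'" if "\<gamma> \<in> \<Gamma> c" "\<gamma> \<in> \<Gamma> c'" "c \<in> ?C" "c' \<in> ?C" for \<gamma> c c'
    using diagrams_through_disjoint[OF that(1)[unfolded \<Gamma>_def] that(2)[unfolded \<Gamma>_def] fin(1) rep_fin[OF that(3)]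
        rep_fin[OF that(4)] fin(2)] rep_card that(3,4) by blast
  have \<Gamma>_sub: "\<Gamma> c \<subseteq> brauer_diagrams S U" if "c \<in> ?C" for c
    unfolding \<Gamma>_def by (rule diagrams_through_subset[OF fin(1) rep_fin[OF that] fin(2)])
  have \<Gamma>_cover: "\<exists>c\<in>?C. \<gamma> \<in> \<Gamma> c" if \<gamma>: "\<gamma> \<in> brauer_diagrams S U" for \<gamma>
  proof -
    \<comment> \<open>The bottom ends of the vertical edges; the diagram factors through any set
      with that many points.\<close>
    let ?V = "{s \<in> S. \<exists>u. {Inl s, Inr u} \<in> \<gamma>}"
    define c where "c = brauer.iso_class ?V"
    have V: "finite ?V" using fin by simp
    then have c: "c \<in> ?C" unfolding c_def brauer_iso_classes by blast
    then have "card (rep c) = card ?V"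
      using rep[OF c] unfolding c_def brauer_iso_class[OF V] by blast
    then obtain h where h: "bij_betw h (rep c) ?V"
      using finite_same_card_bij[OF rep_fin[OF c] V] by blast
    obtain u d where "u \<in> upwards_diagrams (rep c) U" "d \<in> downwards_diagrams S (rep c)"
        "diagram_comp S U u d = \<gamma>"
      using factor_exists[OF \<gamma> h fin(1) rep_fin[OF c] fin(2)] by blast
    then have "\<gamma> \<in> \<Gamma> c" unfolding \<Gamma>_def diagrams_through_def by blast
    then show ?thesis using c by blast
  qed
  \<comment> \<open>There may be infinitely many classes. Those with a nonzero image are collected
    here, so that the map on the direct sum becomes a finite sum.\<close>
  define C0 where "C0 = {c \<in> ?C. \<Gamma> c \<noteq> {}}"
  have C0: "C0 \<subseteq> ?C" by (auto simp: C0_def)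
  have finite_C0: "finite C0"
  proof -
    \<comment> \<open>The sets \<open>\<Gamma> c\<close> are disjoint, so a diagram determines its
      class and \<open>C0\<close> has no more elements than there are diagrams.\<close>
    have "C0 \<subseteq> (\<lambda>\<gamma>. THE c. c \<in> ?C \<and> \<gamma> \<in> \<Gamma> c) ` brauer_diagrams S U"
    proof
      fix c assume c: "c \<in> C0"
      then obtain \<gamma> where \<gamma>: "\<gamma> \<in> \<Gamma> c" by (auto simp: C0_def)
      have "(THE c. c \<in> ?C \<and> \<gamma> \<in> \<Gamma> c) = c"
        using \<gamma> c C0 \<Gamma>_disjoint by (intro the_equality) blast+
      moreover have "\<gamma> \<in> brauer_diagrams S U" using \<Gamma>_sub \<gamma> c C0 by blast
      ultimately show "c \<in> (\<lambda>\<gamma>. THE c. c \<in> ?C \<and> \<gamma> \<in> \<Gamma> c) ` brauer_diagrams S U" by force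
    qed
    then show ?thesis using finite_brauer_diagrams[OF fin] by (rule finite_surj[rotated])
  qed
  define \<phi> where "\<phi> w = (\<Sum>c\<in>C0. \<Phi> c (w c))" for w
  have G_carrier: "carrier ?G = {w \<in> \<Pi>\<^sub>E c\<in>?C. carrier (T c). finite {c \<in> ?C. w c \<noteq> \<one>\<^bsub>T c\<^esub>}}"
    by (rule carrier_sum_group[OF group_T])
  have G_in: "w c \<in> carrier (T c)" if "w \<in> carrier ?G" "c \<in> ?C" for w c
    using that unfolding G_carrier by auto
  have \<phi>_hom: "\<phi> \<in> hom ?G ?H"
  proof (rule homI)
    fix v w assume v: "v \<in> carrier ?G"
    have "Poly_Mapping.keys (\<phi> v) \<subseteq> brauer_diagrams S U"
      unfolding \<phi>_def using \<Phi>_keys G_in[OF v] C0 \<Gamma>_sub by (intro order_trans[OF keys_sum]) blast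
    then show "\<phi> v \<in> carrier ?H" by (simp add: brauer.Hom_group_def brauer_Hom_def)
    assume w: "w \<in> carrier ?G"
    have "\<Phi> c (v c \<otimes>\<^bsub>T c\<^esub> w c) = \<Phi> c (v c) + \<Phi> c (w c)" if "c \<in> C0" for c
      using that C0 by (intro \<Phi>_mult G_in v w) auto
    then have "\<phi> (v \<otimes>\<^bsub>?G\<^esub> w) = \<phi> v + \<phi> w"
      unfolding \<phi>_def sum.distrib[symmetric] using C0 by (intro sum.cong) auto
    then show "\<phi> (v \<otimes>\<^bsub>?G\<^esub> w) = \<phi> v \<otimes>\<^bsub>?H\<^esub> \<phi> w" by (simp add: brauer.Hom_group_def)
  qed
  interpret H: comm_group ?H by (rule comm_group_Hom_group)
  interpret \<phi>: group_hom ?G ?H \<phi>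
    using \<phi>_hom sum_group[OF group_T] H.is_group by (simp add: group_hom_def group_hom_axioms_def)
  \<comment> \<open>Coefficients at diagrams of \<open>\<Gamma> c\<close> see the component
    \<open>c\<close> alone, since the other components have disjoint supports.\<close>
  have \<phi>_lookup: "Poly_Mapping.lookup (\<phi> w) \<gamma> = Poly_Mapping.lookup (\<Phi> c (w c)) \<gamma>"
    if w: "w \<in> carrier ?G" and c: "c \<in> C0" and \<gamma>: "\<gamma> \<in> \<Gamma> c" for w c \<gamma>
  proof -
    have "Poly_Mapping.lookup (\<phi> w) \<gamma> = (\<Sum>c'\<in>C0. Poly_Mapping.lookup (\<Phi> c' (w c')) \<gamma>)"
      by (simp add: \<phi>_def lookup_sum)
    also have "\<dots> = (\<Sum>c'\<in>C0. if c' = c then Poly_Mapping.lookup (\<Phi> c (w c)) \<gamma> else 0)"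
    proof (rule sum.cong)
      fix c' assume c': "c' \<in> C0"
      have "Poly_Mapping.lookup (\<Phi> c' (w c')) \<gamma> = 0" if "c' \<noteq> c"
      proof -
        have "\<gamma> \<notin> \<Gamma> c'" using \<Gamma>_disjoint[OF \<gamma>, of c'] that c c' C0 by blast
        then have "\<gamma> \<notin> Poly_Mapping.keys (\<Phi> c' (w c'))"
          using \<Phi>_keys[of c' "w c'"] G_in[OF w] c' C0 by blast
        then show ?thesis by (simp add: in_keys_iff)
      qed
      then show "Poly_Mapping.lookup (\<Phi> c' (w c')) \<gamma> =
          (if c' = c then Poly_Mapping.lookup (\<Phi> c (w c)) \<gamma> else 0)" by simp
    qed simp
    also have "\<dots> = Poly_Mapping.lookup (\<Phi> c (w c)) \<gamma>" using finite_C0 c by simp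
    finally show ?thesis .
  qed
  have inj: "inj_on \<phi> (carrier ?G)"
    unfolding \<phi>.inj_on_one_iff
  proof (intro allI impI)
    fix w assume w: "w \<in> carrier ?G" "\<phi> w = \<one>\<^bsub>?H\<^esub>"
    then have \<phi>0: "\<phi> w = 0" by (simp add: brauer.Hom_group_def)
    have "w c = \<one>\<^bsub>T c\<^esub>" if c: "c \<in> ?C" for c
    proof -
      have "\<Phi> c (w c) = 0"
      proof (rule poly_mapping_eqI)
        fix \<gamma>
        show "Poly_Mapping.lookup (\<Phi> c (w c)) \<gamma> = Poly_Mapping.lookup 0 \<gamma>"
        proof (cases "\<gamma> \<in> \<Gamma> c")
          case True
          then have "c \<in> C0" using c by (auto simp: C0_def)
          then show ?thesis using \<phi>_lookup[OF w(1) _ True] \<phi>0 by simp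
        next
          case False
          then have "\<gamma> \<notin> Poly_Mapping.keys (\<Phi> c (w c))" using \<Phi>_keys[OF c G_in[OF w(1) c]] by blast
          then show ?thesis by (simp add: in_keys_iff)
        qed
      qed
      then show ?thesis
        using inj_onD[OF \<Phi>_inj[OF c] _ G_in[OF w(1) c] one_in[OF c]] \<Phi>_one[OF c] by simp
    qed
    then show "w = \<one>\<^bsub>?G\<^esub>"
      using w(1) unfolding G_carrier one_sum_group by (intro ext) (auto simp: restrict_def PiE_def extensional_def)
  qed
  have surj: "\<phi> ` carrier ?G = carrier ?H"
  proof (intro equalityI subsetI)
    fix f assume "f \<in> \<phi> ` carrier ?G" then show "f \<in> carrier ?H" by auto
  next
    fix f assume "f \<in> carrier ?H"
    then have f: "Poly_Mapping.keys f \<subseteq> brauer_diagrams S U"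
      by (simp add: brauer.Hom_group_def brauer_Hom_def)
    define part where "part c = (\<Sum>\<gamma>\<in>Poly_Mapping.keys f \<inter> \<Gamma> c. vec_scale (Poly_Mapping.lookup f \<gamma>) (diagram_vec \<gamma>))" for c
    have "part c \<in> vecs (\<Gamma> c)" for c
      unfolding part_def
      by (intro vec.subspace_sum[OF subspace_keys] vec.subspace_scale[OF subspace_keys]) auto
    then have part_in: "part c \<in> \<Phi> c ` carrier (T c)" if "c \<in> ?C" for c
      using \<Phi>_img[OF that] by simp
    \<comment> \<open>Off \<open>C0\<close> the entry is the unit, because an element of the sum
      group has only finitely many other entries.\<close>
    define w where "w = (\<lambda>c\<in>?C. if c \<in> C0 then inv_into (carrier (T c)) (\<Phi> c) (part c) else \<one>\<^bsub>T c\<^esub>)"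
    have w_in: "w \<in> carrier ?G"
      unfolding G_carrier
    proof (intro CollectI conjI PiE_I)
      show "w c \<in> carrier (T c)" if "c \<in> ?C" for c
        using that inv_into_into[OF part_in[OF that]] one_in[OF that] by (simp add: w_def)
      show "finite {c \<in> ?C. w c \<noteq> \<one>\<^bsub>T c\<^esub>}"
        by (rule finite_subset[OF _ finite_C0]) (auto simp: w_def)
    qed (simp add: w_def)
    have disj: "\<forall>c\<in>C0. \<forall>c'\<in>C0. c \<noteq> c' \<longrightarrow>
        (Poly_Mapping.keys f \<inter> \<Gamma> c) \<inter> (Poly_Mapping.keys f \<inter> \<Gamma> c') = {}"
      using \<Gamma>_disjoint C0 by blast
    have "\<phi> w = (\<Sum>c\<in>C0. part c)"
      unfolding \<phi>_def
    proof (rule sum.cong)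
      fix c assume c: "c \<in> C0"
      then show "\<Phi> c (w c) = part c"
        using C0 f_inv_into_f[OF part_in[of c]] by (auto simp: w_def)
    qed simp
    also have "\<dots> = (\<Sum>\<gamma>\<in>(\<Union>c\<in>C0. Poly_Mapping.keys f \<inter> \<Gamma> c). vec_scale (Poly_Mapping.lookup f \<gamma>) (diagram_vec \<gamma>))"
      unfolding part_def by (intro sum.UNION_disjoint[symmetric] finite_C0 disj) auto
    also have "(\<Union>c\<in>C0. Poly_Mapping.keys f \<inter> \<Gamma> c) = Poly_Mapping.keys f"
      using f \<Gamma>_cover by (auto simp: C0_def) blast
    finally have "\<phi> w = f" by (simp add: vec_sum_expansion)
    then show "f \<in> \<phi> ` carrier ?G" using w_in by blast
  qed
  have val: "\<phi> (sum_group_inclusion ?C T c (pure c u d)) = brauer_Comp \<delta> S (rep c) U u d"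
    if c: "c \<in> ?C" and u: "u \<in> brauer_U (rep c) U" and d: "d \<in> brauer_D S (rep c)" for c u d
  proof -
    have "\<phi> (sum_group_inclusion ?C T c (pure c u d)) = (\<Sum>c'\<in>C0. if c' = c then \<Phi> c (pure c u d) else 0)"
      unfolding \<phi>_def using C0 by (intro sum.cong) (auto simp: sum_group_inclusion_def \<Phi>_one)
    also have "\<dots> = \<Phi> c (pure c u d)"
    proof (cases "c \<in> C0")
      case True
      then show ?thesis using finite_C0 by simp
    next
      case False
      \<comment> \<open>A class outside \<open>C0\<close> is left out of the sum that defines
        \<open>\<phi>\<close>. Its own map is supported on the empty set and takes only the value
        \<open>0\<close>, so the two sides still agree.\<close>
      then have "\<Gamma> c = {}" using c by (simp add: C0_def)
      moreover have "pure c u d \<in> carrier (T c)"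
        unfolding pure_def T_def by (rule Hom_pure_tensor_in[OF fin(1) rep_fin[OF c] fin(2) u d])
      ultimately have "\<Phi> c (pure c u d) = 0" using \<Phi>_keys[OF c] by fastforce
      then show ?thesis using finite_C0 by simp
    qed
    finally show ?thesis using \<Phi>_pure[OF c u d] by simp
  qed
  have "\<phi> \<in> iso ?G ?H"
    using \<phi>_hom inj surj by (simp add: iso_def bij_betw_def)
  then show ?thesis
    unfolding brauer.composition_isomorphism_def Let_def T_def[symmetric, abs_def] pure_def[symmetric, abs_def]
    using val by blast
qed

end

theorem theorem2p1:
  fixes \<delta> :: complex
  shows "triangular_category vec_scale
           (brauer_objects :: 'a::infinite set set) brauer_Hom brauer_ident (brauer_Comp \<delta>)
           TYPE(nat) brauer_U brauer_D"
proof -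
  interpret brauer: linear_category vec_scale "brauer_objects :: 'a set set" brauer_Hom brauer_ident "brauer_Comp \<delta>"
    by (rule brauer_linear_category)
  show ?thesis
  proof unfold_locales
    show "brauer.wide_subcategory brauer_U" by (rule brauer_wide_U)
    show "brauer.wide_subcategory brauer_D" by (rule brauer_wide_D)
    show "brauer.essentially_small TYPE(nat)" by (rule brauer_essentially_small)
    show "brauer.finite_dimensional_Homs" by (rule brauer_finite_dimensional)
    show "brauer.End_ring brauer_U x = brauer.End_ring brauer_D x" if "x \<in> brauer_objects" for x
      using that by (intro brauer_End_eq) (simp add: brauer_objects_iff)
    show "semisimple_ring (brauer.End_ring brauer_U x)" if "x \<in> brauer_objects" for x
      using that by (intro brauer_End_semisimple) (simp add: brauer_objects_iff)
    show "\<exists>ord. partial_order_on brauer.iso_classes ord \<and>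
        (\<forall>c\<in>brauer.iso_classes. finite {b \<in> brauer.iso_classes. (b, c) \<in> ord}) \<and>
        brauer.upwards ord brauer_U \<and> brauer.downwards ord brauer_D"
      by (rule brauer_order)
    show "brauer.composition_isomorphism brauer_U brauer_D rep x z"
      if "x \<in> brauer_objects" "z \<in> brauer_objects" "\<And>c. c \<in> brauer.iso_classes \<Longrightarrow> rep c \<in> c" for x z rep
      using that by (intro brauer_composition_isomorphism) (simp_all add: brauer_objects_iff)
  qed
qed

end
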